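(* In the setting described in the context (with a closed normal subgroup $G_0\subset G$ and the restriction of $\Phi$ to the set $M_0$ of $G_0$-invariant elements of $M$), suppose that $G$ satisfies: ($G_*$) if $g_n \ast u \to v$ in $X$ for a sequence $(g_n)_n$ in $G$ and $u,v \in X$, then there exists $g \in G$ with $g \ast u = v$. Suppose that there are values $c_*, c_\infty \in \mathbb{R} \cup \{+\infty\}$, $c_* < c_\infty$, with the following properties: (i) The metric space $(\Phi^{-1}([c_*,c]),d)$ is complete for all $c < c_\infty$. (ii) $k_*:= \lim_{c \to c_*,\, c>c_*}\gamma(\Phi^c)< \infty$. (iii) $\lim_{c \to c_\infty,\, c<c_\infty}\gamma(\Phi^c)=\infty$. (iv) For every $c \in (c_*,c_\infty)$ the condition $(NCG_0)_c$ holds, and $g\ast u\neq -u$ for all $u\in K_c$ and $g\in G\setminus G_0$. Then $$c_* < c_{k_*+1} \le c_{k_*+2} \le \dots \le c_{k_*+\ell} \to c_\infty \quad \text{as } \ell \to \infty,$$ and these values are critical values of $\Phi$. Hence there exists a sequence of pairs of critical points $\{\pm u_k\}$ of $\Phi$ with $\Phi(u_k) \to c_\infty$ as $k \to \infty$.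
   Context: Setting. $X$ is a real Hilbert space with scalar product $\langle\cdot,\cdot\rangle_X$ and norm $\|\cdot\|_X$. For every $u\in X\setminus\{0\}$ a scalar product $\langle\cdot,\cdot\rangle_u$ on $X$ with induced norm $\|\cdot\|_u$ is given. $G$ is a topological group acting linearly on $X$ from the left, the action being written $g\ast u$. Assume: (M1) For all $u\in X\setminus\{0\}$ there are a neighborhood $U\subset X\setminus\{0\}$ of $u$ and $C=C(u)$ with $\frac1C\|v\|_X\le\|v\|_{\tilde u}\le C\|v\|_X$ for all $\tilde u\in U$, $v\in X$. (M2) For all $u\in X\setminus\{0\}$ there are a neighborhood $U\subset X\setminus\{0\}$ of $u$ and $C=C(u)>0$ with $|\langle v,w\rangle_{u_1}-\langle v,w\rangle_{u_2}|\le C\|u_1-u_2\|_X\|v\|_X\|w\|_X$ for all $u_1,u_2\in U$, $v,w\in X$. (M3) $\langle g\ast v,g\ast w\rangle_{g\ast u}=\langle v,w\rangle_u$ for all $u,v,w\in X\setminus\{0\}$, $g\in G$. $M\subset X\setminus\{0\}$ is a submanifold of class $C^{1,1}$ with $M=-M$, and $\Phi\in C^{1,1}(M)$ is even; $M$ and $\Phi$ are $G$-invariant. $G_0\subset G$ is a closed normal subgroup, $X_0=\{u\in X: g\ast u=u\ \forall g\in G_0\}$ (a closed, $G$-invariant subspace), and $M_0=M\cap X_0$. All notions below refer to $X_0$, $M_0$ in place of $X$, $M$, where $M_0$ is a $C^{1,1}$-submanifold of $X_0$; the restriction of $\Phi$ to $M_0$ is again denoted by $\Phi$, and critical points/values are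 those of this restriction. Metric: for $u,v\in M_0$, $d(u,v)=\inf\{\int_0^1\|\gamma'(s)\|_{\gamma(s)}ds:\gamma\in C^1([0,1],M_0),\gamma(0)=u,\gamma(1)=v\}$ ($=\infty$ if $u,v$ lie in different components). $N(w)=\inf\{\|u\|_u+d(u,w):u\in M_0\}$ for $w\in M_0$; $\|\Phi'(u)\|_u$ denotes the norm of $\Phi'(u)$ on $T_uM_0$ dual to $\|\cdot\|_u$ (equivalently, the $\|\cdot\|_u$-norm of the gradient of $\Phi|_{M_0}$ with respect to $\langle\cdot,\cdot\rangle_u$). $\Phi^c=\{u\in M_0:\Phi(u)\le c\}$, $K_c=\{u\in M_0:\Phi'(u)=0,\ \Phi(u)=c\}$. Condition $(NCG_0)_c$: if $(u_n)_n\subset M_0$ satisfies $\Phi(u_n)\to c$ and $\|\Phi'(u_n)\|_{u_n}(1+N(u_n))\to0$, then, after passing to a subsequence, there are $g_n\in G$ and $u\in M_0$ with $g_n\ast u_n\to u$ in $X$. Krasnoselskii genus: for a locally closed symmetric ($Z=-Z$) subset $Z\subset X$, $\gamma(\varnothing)=0$; if $Z\ne\varnothing$, $\gamma(Z)$ is the smallest integer $k\ge1$ such that there is an odd continuous map $Z\to\mathbb{S}^{k-1}\subset\mathbb{R}^k$, and $\gamma(Z)=\infty$ if no such $k$ exists. Ljusternik-Schnirelmann values: $c_k=\inf\{c\in\mathbb{R}:\gamma(\Phi^c)\ge k\}\in[-\infty,\infty]$, $k\in\mathbb{N}$. *)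

theory Defs
  imports "HOL-Analysis.Analysis" "HOL-Algebra.Group_Action"
begin

section \<open>Submanifolds and functions of class C^{1,1}\<close>

text \<open>
  Class \<open>C\<^sup>1\<^sup>,\<^sup>1\<close>: differentiable with locally Lipschitz derivative.  The set \<open>U\<close> will always be
  relatively open in a closed subspace \<open>Y\<close>; only the values of the operators \<open>D x\<close> on \<open>Y\<close>
  are then determined by \<open>f\<close>, and an operator on \<open>Y\<close> extends to the whole space by composition with
  the orthogonal projection onto \<open>Y\<close>, so this is the usual notion for maps between subsets of \<open>Y\<close>.
\<close>

definition C11_on :: "'a::real_normed_vector set \<Rightarrow> ('a \<Rightarrow> 'b::real_normed_vector) \<Rightarrow> bool" where
  "C11_on U f \<longleftrightarrow>
     (\<exists>D :: 'a \<Rightarrow> ('a \<Rightarrow>\<^sub>L 'b).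
        (\<forall>x\<in>U. (f has_derivative blinfun_apply (D x)) (at x within U)) \<and>
        (\<forall>x\<in>U. \<exists>e>0. \<exists>L. lipschitz_on L (ball x e \<inter> U) D))"

text \<open>
  A \<open>C\<^sup>1\<^sup>,\<^sup>1\<close>-submanifold \<open>M\<close> of the closed subspace \<open>Y\<close> of a Hilbert space, given by straightening
  charts of \<open>Y\<close>.  The closed model subspace \<open>F\<close> may depend on the point; it is automatically
  complemented.
\<close>

definition C11_submanifold :: "'a::real_normed_vector set \<Rightarrow> 'a set \<Rightarrow> bool" where
  "C11_submanifold Y M \<longleftrightarrow> M \<subseteq> Y \<and>
     (\<forall>u\<in>M. \<exists>U V \<phi> \<psi> F.
        openin (top_of_set Y) U \<and> u \<in> U \<and> openin (top_of_set Y) V \<and>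
        homeomorphism U V \<phi> \<psi> \<and> C11_on U \<phi> \<and> C11_on V \<psi> \<and>
        subspace F \<and> closed F \<and> F \<subseteq> Y \<and> \<phi> ` (U \<inter> M) = V \<inter> F)"

definition C11_function :: "'a::real_normed_vector set \<Rightarrow> ('a \<Rightarrow> real) \<Rightarrow> bool" where
  "C11_function M \<Phi> \<longleftrightarrow>
     (\<forall>u\<in>M. \<exists>U f. open U \<and> u \<in> U \<and> C11_on U f \<and> (\<forall>x\<in>U \<inter> M. f x = \<Phi> x))"

definition tangent_space :: "'a::real_normed_vector set \<Rightarrow> 'a \<Rightarrow> 'a set" where
  "tangent_space M u =
     {v. \<exists>\<gamma> :: real \<Rightarrow> 'a. \<exists>\<epsilon>>0. \<gamma> 0 = u \<and> (\<forall>t. \<bar>t\<bar> < \<epsilon> \<longrightarrow> \<gamma> t \<in> M) \<and>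
           (\<gamma> has_vector_derivative v) (at 0)}"

text \<open>
  The differential \<open>\<Phi>'(u)\<close> of the restriction of \<open>\<Phi>\<close> to \<open>M\<close>.  As a derivative within \<open>M\<close> it is
  uniquely determined on the tangent space only, and it is used only there.
\<close>

definition mderiv :: "'a::real_normed_vector set \<Rightarrow> ('a \<Rightarrow> real) \<Rightarrow> 'a \<Rightarrow> 'a \<Rightarrow> real" where
  "mderiv M \<Phi> u = frechet_derivative \<Phi> (at u within M)"

definition critical_point :: "'a::real_normed_vector set \<Rightarrow> ('a \<Rightarrow> real) \<Rightarrow> 'a \<Rightarrow> bool" where
  "critical_point M \<Phi> u \<longleftrightarrow> u \<in> M \<and> (\<forall>v\<in>tangent_space M u. mderiv M \<Phi> u v = 0)"

definition critical_value :: "'a::real_normed_vector set \<Rightarrow> ('a \<Rightarrow> real) \<Rightarrow> ereal \<Rightarrow> bool" where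
  "critical_value M \<Phi> c \<longleftrightarrow> (\<exists>u. critical_point M \<Phi> u \<and> ereal (\<Phi> u) = c)"

definition critical_set :: "'a::real_normed_vector set \<Rightarrow> ('a \<Rightarrow> real) \<Rightarrow> real \<Rightarrow> 'a set" where
  "critical_set M \<Phi> c = {u. critical_point M \<Phi> u \<and> \<Phi> u = c}"

definition sublevel :: "'a set \<Rightarrow> ('a \<Rightarrow> real) \<Rightarrow> ereal \<Rightarrow> 'a set" where
  "sublevel M \<Phi> c = {u\<in>M. ereal (\<Phi> u) \<le> c}"


section \<open>The family of scalar products\<close>

text \<open>Throughout, \<open>ip u v w\<close> is the scalar product of \<open>v\<close> and \<open>w\<close> with index \<open>u \<noteq> 0\<close>.\<close>

definition is_scalar_product :: "('a::real_vector \<Rightarrow> 'a \<Rightarrow> real) \<Rightarrow> bool" where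
  "is_scalar_product B \<longleftrightarrow>
     bilinear B \<and> (\<forall>v w. B v w = B w v) \<and> (\<forall>v. v \<noteq> 0 \<longrightarrow> 0 < B v v)"

definition ip_norm :: "('a \<Rightarrow> 'a \<Rightarrow> 'a \<Rightarrow> real) \<Rightarrow> 'a \<Rightarrow> 'a \<Rightarrow> real" where
  "ip_norm ip u v = sqrt (ip u v v)"

definition cond_M1 :: "('a::real_normed_vector \<Rightarrow> 'a \<Rightarrow> 'a \<Rightarrow> real) \<Rightarrow> bool" where
  "cond_M1 ip \<longleftrightarrow>
     (\<forall>u. u \<noteq> 0 \<longrightarrow> (\<exists>U C. open U \<and> u \<in> U \<and> 0 \<notin> U \<and> 0 < C \<and>
        (\<forall>u'\<in>U. \<forall>v. (1 / C) * norm v \<le> ip_norm ip u' v \<and> ip_norm ip u' v \<le> C * norm v)))"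

definition cond_M2 :: "('a::real_normed_vector \<Rightarrow> 'a \<Rightarrow> 'a \<Rightarrow> real) \<Rightarrow> bool" where
  "cond_M2 ip \<longleftrightarrow>
     (\<forall>u. u \<noteq> 0 \<longrightarrow> (\<exists>U C. open U \<and> u \<in> U \<and> 0 \<notin> U \<and> 0 < C \<and>
        (\<forall>u1\<in>U. \<forall>u2\<in>U. \<forall>v w.
           \<bar>ip u1 v w - ip u2 v w\<bar> \<le> C * norm (u1 - u2) * norm v * norm w)))"

definition cond_M3 ::
  "('g, 'm) monoid_scheme \<Rightarrow> ('g \<Rightarrow> 'a \<Rightarrow> 'a) \<Rightarrow> ('a::zero \<Rightarrow> 'a \<Rightarrow> 'a \<Rightarrow> real) \<Rightarrow> bool" where
  "cond_M3 G act ip \<longleftrightarrow>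
     (\<forall>g\<in>carrier G. \<forall>u v w. u \<noteq> 0 \<longrightarrow> v \<noteq> 0 \<longrightarrow> w \<noteq> 0 \<longrightarrow>
        ip (act g u) (act g v) (act g w) = ip u v w)"

text \<open>The value is \<open>\<infinity>\<close> (infimum of the empty set) if no curve in \<open>M\<close> joins \<open>u\<close> and \<open>v\<close>.\<close>

definition path_dist ::
  "('a::real_normed_vector \<Rightarrow> 'a \<Rightarrow> 'a \<Rightarrow> real) \<Rightarrow> 'a set \<Rightarrow> 'a \<Rightarrow> 'a \<Rightarrow> ennreal" where
  "path_dist ip M u v =
     Inf {ennreal (integral {0..1} (\<lambda>s. ip_norm ip (\<gamma> s) (\<gamma>' s))) | (\<gamma> :: real \<Rightarrow> 'a) \<gamma>'.
            (\<forall>s\<in>{0..1}. \<gamma> s \<in> M \<and> (\<gamma> has_vector_derivative \<gamma>' s) (at s within {0..1})) \<and>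
            continuous_on {0..1} \<gamma>' \<and> \<gamma> 0 = u \<and> \<gamma> 1 = v}"

definition complete_wrt :: "('a \<Rightarrow> 'a \<Rightarrow> ennreal) \<Rightarrow> 'a set \<Rightarrow> bool" where
  "complete_wrt d S \<longleftrightarrow>
     (\<forall>\<sigma> :: nat \<Rightarrow> 'a. (\<forall>n. \<sigma> n \<in> S) \<longrightarrow>
        (\<forall>e>0. \<exists>n0. \<forall>m\<ge>n0. \<forall>n\<ge>n0. d (\<sigma> m) (\<sigma> n) < e) \<longrightarrow>
        (\<exists>l\<in>S. (\<lambda>n. d (\<sigma> n) l) \<longlonglongrightarrow> 0))"

definition N_fun ::
  "('a::real_normed_vector \<Rightarrow> 'a \<Rightarrow> 'a \<Rightarrow> real) \<Rightarrow> 'a set \<Rightarrow> 'a \<Rightarrow> ennreal" where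
  "N_fun ip M w = (INF u\<in>M. ennreal (ip_norm ip u u) + path_dist ip M u w)"

definition deriv_norm ::
  "('a::real_normed_vector \<Rightarrow> 'a \<Rightarrow> 'a \<Rightarrow> real) \<Rightarrow> 'a set \<Rightarrow> ('a \<Rightarrow> real) \<Rightarrow> 'a \<Rightarrow> ennreal" where
  "deriv_norm ip M \<Phi> u =
     (SUP v\<in>{v \<in> tangent_space M u. ip_norm ip u v \<le> 1}. ennreal \<bar>mderiv M \<Phi> u v\<bar>)"


section \<open>The group action\<close>

definition topological_group :: "('g, 'm) monoid_scheme \<Rightarrow> 'g topology \<Rightarrow> bool" where
  "topological_group G T \<longleftrightarrow>
     group G \<and> topspace T = carrier G \<and>
     continuous_map (prod_topology T T) T (\<lambda>(g, h). g \<otimes>\<^bsub>G\<^esub> h) \<and>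
     continuous_map T T (\<lambda>g. inv\<^bsub>G\<^esub> g)"

text \<open>
  As usual for topological groups, an action is meant to be jointly continuous.  Under (M1) and (M3)
  every group element acts as a bounded operator, so this can always be achieved by
  passing to the discrete topology on the group.
\<close>

definition linear_group_action ::
  "('g, 'm) monoid_scheme \<Rightarrow> 'g topology \<Rightarrow> ('g \<Rightarrow> 'a::real_normed_vector \<Rightarrow> 'a) \<Rightarrow> bool" where
  "linear_group_action G T act \<longleftrightarrow>
     group_action G UNIV act \<and> (\<forall>g\<in>carrier G. linear (act g)) \<and>
     continuous_map (prod_topology T euclidean) euclidean (\<lambda>(g, u). act g u)"

definition fixed_space :: "('g \<Rightarrow> 'a \<Rightarrow> 'a) \<Rightarrow> 'g set \<Rightarrow> 'a set" where
  "fixed_space act H = {u. \<forall>g\<in>H. act g u = u}"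

definition cond_G_star ::
  "('g, 'm) monoid_scheme \<Rightarrow> ('g \<Rightarrow> 'a::topological_space \<Rightarrow> 'a) \<Rightarrow> bool" where
  "cond_G_star G act \<longleftrightarrow>
     (\<forall>(gs :: nat \<Rightarrow> 'g) u v. (\<forall>n. gs n \<in> carrier G) \<longrightarrow> (\<lambda>n. act (gs n) u) \<longlonglongrightarrow> v \<longrightarrow>
        (\<exists>g\<in>carrier G. act g u = v))"

definition NCG ::
  "('g, 'm) monoid_scheme \<Rightarrow> ('g \<Rightarrow> 'a \<Rightarrow> 'a) \<Rightarrow> ('a::real_normed_vector \<Rightarrow> 'a \<Rightarrow> 'a \<Rightarrow> real) \<Rightarrow>
     'a set \<Rightarrow> ('a \<Rightarrow> real) \<Rightarrow> real \<Rightarrow> bool" where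
  "NCG G act ip M \<Phi> c \<longleftrightarrow>
     (\<forall>us :: nat \<Rightarrow> 'a. (\<forall>n. us n \<in> M) \<longrightarrow> (\<lambda>n. \<Phi> (us n)) \<longlonglongrightarrow> c \<longrightarrow>
        (\<lambda>n. deriv_norm ip M \<Phi> (us n) * (1 + N_fun ip M (us n))) \<longlonglongrightarrow> 0 \<longrightarrow>
        (\<exists>(r :: nat \<Rightarrow> nat) gs u. strict_mono r \<and> (\<forall>n. gs n \<in> carrier G) \<and> u \<in> M \<and>
           (\<lambda>n. act (gs n) (us (r n))) \<longlonglongrightarrow> u))"


section \<open>Krasnoselskii genus and Ljusternik-Schnirelmann values\<close>

text \<open>Note that \<open>nsphere n\<close> is the unit sphere of dimension \<open>n\<close> in \<open>n + 1\<close> real coordinates.\<close>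

definition genus :: "'a::real_normed_vector set \<Rightarrow> enat" where
  "genus Z =
     (if Z = {} then 0
      else Inf {enat k | k. 1 \<le> k \<and>
             (\<exists>f. continuous_map (top_of_set Z) (nsphere (k - 1)) f \<and>
                  (\<forall>x\<in>Z. f (- x) = (\<lambda>i. - f x i)))})"

definition LS_value :: "'a::real_normed_vector set \<Rightarrow> ('a \<Rightarrow> real) \<Rightarrow> nat \<Rightarrow> ereal" where
  "LS_value M \<Phi> k = Inf {ereal c | c :: real. enat k \<le> genus (sublevel M \<Phi> (ereal c))}"

end

(*
The critical levels are detected by deforming sublevel sets of \<Phi> with odd maps.  No gradient flow is
used: near a noncritical point the constant vector fields of a flattening chart already decrease \<Phi> at
almost the optimal rate, and such local deformations are glued by Stone's \<sigma>-discrete refinement and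
iterated.  Because |\<Phi>'|(1 + N) is bounded below near a level c away from the critical set K, all
these steps respect the preorder d(v,w) \<le> (1 + N v)(exp ((\<Phi> v - \<Phi> w)/\<beta>) - 1), which is transitive
since N is 1-Lipschitz for d; hence a trajectory that does not reach the lower level is a d-Cauchy
sequence, and its limit would be moved further down.

The scalar products are not assumed to be even in their index, so a deformation x \<mapsto> F(x,t) built from
them is not odd.  It is made odd by composing F and its mirror image -F(-x,t) infinitely often,
with times given by a locally finite sequence of odd functions on X - {0} without common zero.

Points starting outside a neighbourhood of K stay away from K by the additional monotone quantity
\<Phi> - \<kappa> min \<delta> P, where P is a group invariant even distance to K.  By compactness of K modulo the group
and the orbit condition on G, finitely many odd functions have no common zero near K, so crossing the level c raises the
genus by at most a finite amount, and by nothing if K is empty.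
*)

theory Submission
  imports Defs
begin

section \<open>Krasnoselskii genus and partitions\<close>

text \<open>The theorem rests on how the genus changes across a single level c. A finite gain at
  every level of the range makes the genus finite below its upper end, since the infimum of the
  levels with infinite genus could otherwise be crossed. Zero gain at levels without critical points
  then forces the min-max values to be critical. The descent composes countably many steps whose
  sizes have no positive lower bound, so every estimate along it must compose with unchanged
  constants. Bounding the distance by a fixed multiple of (1 + N v) times the drop of
  \<open>\<Phi>\<close> would fail, because N changes on the way; the exponential absorbs this
  change. Completeness concerns the path distance, while charts, continuity and the genus refer to
  the norm. The two are linked only locally, by one estimate in each direction, and the constants of
  (M1) depend on the point. Near K they become uniform through invariance under the group and
  compactness modulo the group. The norms indexed by v and -v are unrelated, so these estimates are
  kept for both.\<close>

definition genus_bound :: "'a::real_normed_vector set \<Rightarrow> nat \<Rightarrow> bool" where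
  "genus_bound Z n \<longleftrightarrow>
     (\<exists>g :: nat \<Rightarrow> 'a \<Rightarrow> real.
        (\<forall>i<n. continuous_on Z (g i) \<and> (\<forall>x\<in>Z. g i (- x) = - g i x)) \<and>
        (\<forall>x\<in>Z. \<exists>i<n. g i x \<noteq> 0))"

text \<open>Dividing n odd functions without a common zero by their Euclidean norm gives an odd map
  to the sphere, and the coordinates of such a map have no common zero. The description by functions
  also covers n = 0, where it forces Z to be empty, and it lets families for two pieces of a cover
  be joined.\<close>

lemma genus_le_iff: "genus Z \<le> enat n \<longleftrightarrow> genus_bound Z n"
proof (cases "Z = {}")
  case True
  then show ?thesis by (auto simp: genus_def genus_bound_def)
next
  case False
  let ?P = "\<lambda>k. 1 \<le> k \<and> (\<exists>f. continuous_map (top_of_set Z) (nsphere (k - 1)) f \<and>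
                  (\<forall>x\<in>Z. f (- x) = (\<lambda>i. - f x i)))"
  let ?S = "{enat k | k. ?P k}"
  have genus: "genus Z = Inf ?S"
    using False by (simp add: genus_def)
  show ?thesis
  proof
    assume *: "genus Z \<le> enat n"
    have ne: "?S \<noteq> {}"
    proof
      assume "?S = {}"
      then have "genus Z = \<infinity>" by (simp only: genus) (simp add: Inf_enat_def)
      with * show False by simp
    qed
    then obtain e where "e \<in> ?S" by blast
    \<comment> \<open>An infimum in \<open>enat\<close> over a nonempty set is a least element, so
      the genus is attained by some map.\<close>
    then have "Inf ?S \<in> ?S"
      unfolding Inf_enat_def using ne by (simp only: if_False) (rule LeastI)
    then have "genus Z \<in> ?S" by (simp only: genus)
    then obtain k where k: "genus Z = enat k" "?P k" by blast
    then obtain f where k: "1 \<le> k" "genus Z = enat k"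
      and f: "continuous_map (top_of_set Z) (nsphere (k - 1)) f"
      and odd: "\<forall>x\<in>Z. f (- x) = (\<lambda>i. - f x i)"
      by blast
    have kn: "k \<le> n" using k * by simp
    from f have c: "continuous_map (top_of_set Z) (powertop_real UNIV) f"
      and v: "\<And>x. x \<in> Z \<Longrightarrow> (\<Sum>i\<le>k-1. f x i ^ 2) = 1"
      by (auto simp: nsphere Euclidean_space_def continuous_map_in_subtopology)
    have "continuous_on Z (\<lambda>x. f x i)" for i
      using c by (simp add: continuous_map_componentwise_UNIV)
    moreover have "\<exists>i<n. f x i \<noteq> 0" if "x \<in> Z" for x
    proof (rule ccontr)
      assume "\<not> ?thesis"
      then have "(\<Sum>i\<le>k-1. f x i ^ 2) = 0"
        using kn k by (intro sum.neutral) auto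
      with v[OF that] show False by simp
    qed
    ultimately show "genus_bound Z n"
      unfolding genus_bound_def using odd by (intro exI[of _ "\<lambda>i x. f x i"]) auto
  next
    assume "genus_bound Z n"
    then obtain g :: "nat \<Rightarrow> 'a \<Rightarrow> real"
      where g: "\<And>i. i < n \<Longrightarrow> continuous_on Z (g i)"
        and odd: "\<And>i x. i < n \<Longrightarrow> x \<in> Z \<Longrightarrow> g i (- x) = - g i x"
        and nz: "\<And>x. x \<in> Z \<Longrightarrow> \<exists>i<n. g i x \<noteq> 0"
      unfolding genus_bound_def by blast
    \<comment> \<open>For n = 0 the truncated difference \<open>n - 1\<close> would give the sphere
      of dimension 0 in place of the empty set.\<close>
    from False nz have n: "n \<ge> 1" by fastforce
    define s where "s x = sqrt (\<Sum>i<n. g i x ^ 2)" for x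
    have pos: "s x > 0" if x: "x \<in> Z" for x
    proof -
      obtain i where "i < n" "g i x \<noteq> 0" using nz[OF x] by blast
      then have "(\<Sum>i<n. g i x ^ 2) > 0"
        by (intro sum_pos2[of _ i]) auto
      then show ?thesis by (simp add: s_def)
    qed
    define f where "f x i = (if i < n then g i x / s x else 0)" for x i
    have eq: "{..n-1} = {..<n}" using n by auto
    have "(\<Sum>i\<le>n-1. f x i ^ 2) = 1" if "x \<in> Z" for x
    proof -
      have "(\<Sum>i<n. g i x ^ 2) \<ge> 0" by (simp add: sum_nonneg)
      then have "s x ^ 2 = (\<Sum>i<n. g i x ^ 2)" by (simp add: s_def)
      moreover have "(\<Sum>i\<le>n-1. f x i ^ 2) = (\<Sum>i<n. g i x ^ 2) / s x ^ 2"
        unfolding eq by (simp add: f_def power_divide sum_divide_distrib)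
      ultimately show ?thesis using pos[OF that] by (metis divide_self less_numeral_extra(3) zero_less_power)
    qed
    moreover have "continuous_on Z (\<lambda>x. f x i)" for i
    proof (cases "i < n")
      case True
      have "continuous_on Z s"
        unfolding s_def by (intro continuous_intros g) auto
      then have "continuous_on Z (\<lambda>x. g i x / s x)"
        using g[OF True] pos by (intro continuous_on_divide) (auto dest: pos)
      then show ?thesis using True by (simp add: f_def)
    qed (simp add: f_def)
    moreover have "f x i = 0" if "i \<ge> n" for x i using that by (simp add: f_def)
    ultimately have "continuous_map (top_of_set Z) (nsphere (n - 1)) f"
      unfolding nsphere Euclidean_space_def continuous_map_in_subtopology
        continuous_map_componentwise_UNIV
      using n by auto
    moreover have "f (- x) = (\<lambda>i. - f x i)" if "x \<in> Z" for x
      using odd that by (auto simp: f_def s_def fun_eq_iff)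
    ultimately have "enat n \<in> ?S" using n by blast
    then show "genus Z \<le> enat n"
      unfolding genus by (rule Inf_lower)
  qed
qed

lemma genus_bound_odd_map:
  assumes "genus_bound B n" and R: "continuous_on A R" "R ` A \<subseteq> B"
    and odd: "\<And>x. x \<in> A \<Longrightarrow> R (- x) = - R x"
  shows "genus_bound A n"
proof -
  obtain g
    where g: "\<And>i::nat. i < n \<Longrightarrow> continuous_on B (g i :: _ \<Rightarrow> real)"
      "\<And>i x. i < n \<Longrightarrow> x \<in> B \<Longrightarrow> g i (- x) = - g i x"
      "\<And>x. x \<in> B \<Longrightarrow> \<exists>i<n. g i x \<noteq> 0"
    using assms(1) unfolding genus_bound_def by blast
  show ?thesis
    unfolding genus_bound_def
  proof (intro exI[of _ "\<lambda>i x. g i (R x)"] conjI allI impI ballI)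
    fix i assume "i < n"
    show "continuous_on A (\<lambda>x. g i (R x))"
      using continuous_on_compose2[OF g(1)[OF \<open>i < n\<close>] R] .
  qed (use g R odd in \<open>auto simp: image_subset_iff\<close>)
qed

lemma genus_mono: "A \<subseteq> B \<Longrightarrow> genus A \<le> genus B"
proof -
  assume "A \<subseteq> B"
  have "genus A \<le> enat n" if "genus B \<le> enat n" for n
    using genus_bound_odd_map[of B n A "\<lambda>x. x"] that \<open>A \<subseteq> B\<close>
    by (auto simp: genus_le_iff)
  then show ?thesis
    by (metis enat_ord_simps(3) not_enat_eq order_refl)
qed

section \<open>Extension by cutoffs and subadditivity of the genus\<close>

lemma continuous_on_local:
  assumes "\<And>x. x \<in> D \<Longrightarrow> \<exists>W. open W \<and> x \<in> W \<and> continuous_on (D \<inter> W) K"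
  shows "continuous_on D K"
  unfolding continuous_on_topological
proof (intro ballI allI impI)
  fix x B assume x: "x \<in> D" and B: "open B" "K x \<in> B"
  obtain W where W: "open W" "x \<in> W" "continuous_on (D \<inter> W) K" using assms[OF x] by blast
  then obtain A where "open A" "x \<in> A" "\<forall>y\<in>D \<inter> W. y \<in> A \<longrightarrow> K y \<in> B"
    using x B unfolding continuous_on_topological by (metis IntI)
  then show "\<exists>A. open A \<and> x \<in> A \<and> (\<forall>y\<in>D. y \<in> A \<longrightarrow> K y \<in> B)"
    using W by (intro exI[of _ "A \<inter> W"]) auto
qed

text \<open>At a zero of \<open>l\<close> the product is squeezed between -l and l because
  \<open>g\<close> is bounded. This extends functions known only on the positivity set of
  \<open>l\<close> to all of Z.\<close>

lemma continuous_on_cutoff_product: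
  fixes l g :: "'a::topological_space \<Rightarrow> real"
  assumes l: "continuous_on Z l" "\<And>x. x \<in> Z \<Longrightarrow> l x \<ge> 0"
    and g: "continuous_on {x\<in>Z. l x > 0} g" "\<And>x. \<bar>g x\<bar> \<le> 1"
  shows "continuous_on Z (\<lambda>x. if l x > 0 then l x * g x else 0)"
  unfolding continuous_on_def
proof
  fix x assume x: "x \<in> Z"
  let ?h = "\<lambda>x. if l x > 0 then l x * g x else 0"
  have lx: "(l \<longlongrightarrow> l x) (at x within Z)" using l(1) x by (simp add: continuous_on_def)
  show "(?h \<longlongrightarrow> ?h x) (at x within Z)"
  proof (cases "l x > 0")
    case True
    have "openin (top_of_set Z) {x\<in>Z. l x > 0}"
      using continuous_openin_preimage_gen[OF l(1), of "{0<..}"] by (simp add: vimage_def Int_def)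
    then obtain W where W: "open W" "{x\<in>Z. l x > 0} = Z \<inter> W" by (auto simp: openin_open)
    then have "continuous_on (Z \<inter> W) g" using g by simp
    then have gx0: "(g \<longlongrightarrow> g x) (at x within (Z \<inter> W))"
      using x True W by (auto simp: continuous_on_def)
    then have gx: "(g \<longlongrightarrow> g x) (at x within Z)"
    proof -
      have "x \<in> W" using W(2) x True by blast
      then have "at x within Z \<inter> W = at x within Z"
        using W(1) by (intro at_within_nhd[of x W]) auto
      with gx0 show ?thesis by simp
    qed
    have "((\<lambda>x. l x * g x) \<longlongrightarrow> l x * g x) (at x within Z)"
      by (intro tendsto_intros lx gx)
    moreover have "eventually (\<lambda>y. l y > 0) (at x within Z)"
      using order_tendstoD(1)[OF lx True] .
    ultimately show ?thesis
      using True by (auto elim!: Lim_transform_eventually eventually_mono)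
  next
    case False
    then have 0: "l x = 0" using l(2)[OF x] by simp
    have "\<bar>?h y\<bar> \<le> l y" if "y \<in> Z" for y
      using g(2)[of y] l(2)[OF that] by (auto simp: abs_mult mult_le_cancel_left1)
    then have "eventually (\<lambda>y. norm (?h y) \<le> l y) (at x within Z)"
      by (auto simp: eventually_at_filter)
    then have "(?h \<longlongrightarrow> 0) (at x within Z)"
      using lx 0 by (intro Lim_null_comparison[of ?h l]) auto
    then show ?thesis using 0 by simp
  qed
qed

text \<open>Subadditivity of the genus for two relatively open pieces, each given as the positivity
  set of an even function. Odd functions on a piece, made bounded without moving their zeros and
  multiplied by the even function of the piece, extend by zero to odd functions on Z; so the two
  families can be joined.\<close>

lemma genus_bound_cover:
  fixes Z :: "'a::real_normed_vector set"
  assumes sym: "\<And>x. x \<in> Z \<Longrightarrow> - x \<in> Z"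
    and l: "continuous_on Z l" "\<And>x. x \<in> Z \<Longrightarrow> l x \<ge> (0::real)" "\<And>x. x \<in> Z \<Longrightarrow> l (- x) = l x"
    and m: "continuous_on Z m" "\<And>x. x \<in> Z \<Longrightarrow> m x \<ge> (0::real)" "\<And>x. x \<in> Z \<Longrightarrow> m (- x) = m x"
    and lm: "\<And>x. x \<in> Z \<Longrightarrow> l x > 0 \<or> m x > 0"
    and A: "genus_bound {x\<in>Z. l x > 0} a" and B: "genus_bound {x\<in>Z. m x > 0} b"
  shows "genus_bound Z (a + b)"
proof -
  have bounded: "\<exists>g :: nat \<Rightarrow> 'a \<Rightarrow> real.
        (\<forall>i<n. continuous_on Z (g i) \<and> (\<forall>x\<in>Z. g i (- x) = - g i x)) \<and>
        (\<forall>x\<in>Z. k x > 0 \<longrightarrow> (\<exists>i<n. g i x \<noteq> 0))"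
    if k: "continuous_on Z k" "\<And>x. x \<in> Z \<Longrightarrow> k x \<ge> (0::real)" "\<And>x. x \<in> Z \<Longrightarrow> k (- x) = k x"
      and gb: "genus_bound {x\<in>Z. k x > 0} n" for k n
  proof -
    let ?A = "{x\<in>Z. k x > 0}"
    obtain g :: "nat \<Rightarrow> 'a \<Rightarrow> real"
      where g: "\<And>i. i < n \<Longrightarrow> continuous_on ?A (g i)"
        "\<And>i x. i < n \<Longrightarrow> x \<in> ?A \<Longrightarrow> g i (- x) = - g i x"
        "\<And>x. x \<in> ?A \<Longrightarrow> \<exists>i<n. g i x \<noteq> 0"
      using gb unfolding genus_bound_def by blast
    define h where "h i x = g i x / (1 + \<bar>g i x\<bar>)" for i x
    have hb: "\<bar>h i x\<bar> \<le> 1" for i x by (auto simp: h_def divide_simps)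
    have hc: "continuous_on ?A (h i)" if "i < n" for i
      unfolding h_def using g(1)[OF that] by (intro continuous_intros) auto
    define G where "G i x = (if k x > 0 then k x * h i x else 0)" for i x
    have "continuous_on Z (G i)" if i: "i < n" for i
      unfolding G_def using k hc[OF i] hb by (intro continuous_on_cutoff_product) auto
    moreover have "G i (- x) = - G i x" if i: "i < n" and x: "x \<in> Z" for i x
    proof (cases "k x > 0")
      case True
      then have "h i (- x) = - h i x" using g(2)[of i x] i x by (simp add: h_def)
      then show ?thesis using k(3)[OF x] by (simp add: G_def)
    qed (use k(3)[OF x] in \<open>simp add: G_def\<close>)
    moreover have "\<exists>i<n. G i x \<noteq> 0" if x: "x \<in> Z" "k x > 0" for x
    proof -
      obtain i where i: "i < n" "g i x \<noteq> 0" using g(3)[of x] x by blast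
      moreover have "1 + \<bar>g i x\<bar> > 0" by linarith
      ultimately have "h i x \<noteq> 0" by (simp add: h_def)
      with i x show ?thesis by (intro exI[of _ i]) (simp add: G_def)
    qed
    ultimately show ?thesis by blast
  qed
  obtain g where g: "\<And>i. i < a \<Longrightarrow> continuous_on Z (g i)"
    "\<And>i x. i < a \<Longrightarrow> x \<in> Z \<Longrightarrow> g i (- x) = - (g i x :: real)"
    "\<And>x. x \<in> Z \<Longrightarrow> l x > 0 \<Longrightarrow> \<exists>i<a. g i x \<noteq> 0"
    using bounded[OF l A] by blast
  obtain h where h: "\<And>i. i < b \<Longrightarrow> continuous_on Z (h i)"
    "\<And>i x. i < b \<Longrightarrow> x \<in> Z \<Longrightarrow> h i (- x) = - (h i x :: real)"
    "\<And>x. x \<in> Z \<Longrightarrow> m x > 0 \<Longrightarrow> \<exists>i<b. h i x \<noteq> 0"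
    using bounded[OF m B] by blast
  have "\<exists>i<a + b. (if i < a then g i x else h (i - a) x) \<noteq> 0" if x: "x \<in> Z" for x
  proof (cases "l x > 0")
    case True
    then obtain i where "i < a" "g i x \<noteq> 0" using g(3) x by blast
    then show ?thesis by (intro exI[of _ i]) auto
  next
    case False
    then obtain i where "i < b" "h i x \<noteq> 0" using h(3) lm x by blast
    then show ?thesis by (intro exI[of _ "a + i"]) auto
  qed
  moreover have "continuous_on Z (if i < a then g i else h (i - a))" if "i < a + b" for i
    using that g(1) h(1) by auto
  moreover have "(if i < a then g i else h (i - a)) (- x) = - (if i < a then g i else h (i - a)) x"
    if "i < a + b" "x \<in> Z" for i x
    using that g(2)[of i x] h(2)[of "i - a" x] by (cases "i < a") auto
  ultimately show ?thesis
    unfolding genus_bound_def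
    by (intro exI[of _ "\<lambda>i. if i < a then g i else h (i - a)"] conjI allI impI ballI)
      (simp_all add: if_distribR)
qed

section \<open>Two gluing tools: locally stationary limits and discrete patches\<close>

text \<open>Near each point the sequence equals one continuous map from some index on, and the limit
  inherits its continuity. This turns infinite compositions, all but finitely many factors of which
  are locally idle, into continuous maps.\<close>

lemma locally_stationary_limit:
  fixes Y :: "nat \<Rightarrow> 'a::topological_space \<Rightarrow> 'b::topological_space"
  assumes c: "\<And>j. continuous_on D (Y j)"
    and st: "\<And>x. x \<in> D \<Longrightarrow> \<exists>W J. open W \<and> x \<in> W \<and> (\<forall>y\<in>D \<inter> W. \<forall>j\<ge>J. Y j y = Y J y)"
  obtains K where "continuous_on D K" "\<And>x. x \<in> D \<Longrightarrow> \<exists>J. \<forall>j\<ge>J. K x = Y j x"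
proof -
  define K where "K x = Y (LEAST J. \<forall>j\<ge>J. Y j x = Y J x) x" for x
  have K: "K x = Y j x" if "\<forall>j\<ge>J. Y j x = Y J x" "j \<ge> J" for x J j
  proof -
    define L where "L = (LEAST J. \<forall>j\<ge>J. Y j x = Y J x)"
    have L: "\<forall>j\<ge>L. Y j x = Y L x"
      unfolding L_def by (rule LeastI[where P = "\<lambda>J. \<forall>j\<ge>J. Y j x = Y J x", OF that(1)])
    have "L \<le> J"
      unfolding L_def by (rule Least_le[where P = "\<lambda>J. \<forall>j\<ge>J. Y j x = Y J x", OF that(1)])
    then have "L \<le> j" using that(2) by (rule order_trans)
    with L have "Y j x = Y L x" by blast
    moreover have "K x = Y L x" by (simp add: K_def L_def)
    ultimately show ?thesis by (simp only:)
  qed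
  show thesis
  proof
    show "continuous_on D K"
    proof (rule continuous_on_local)
      fix x assume "x \<in> D"
      then obtain W J where W: "open W" "x \<in> W" "\<forall>y\<in>D \<inter> W. \<forall>j\<ge>J. Y j y = Y J y"
        using st by blast
      have "K y = Y J y" if "y \<in> D \<inter> W" for y
        by (rule K[OF bspec[OF W(3) that] order_refl])
      then have "continuous_on (D \<inter> W) K \<longleftrightarrow> continuous_on (D \<inter> W) (Y J)"
        by (intro continuous_on_cong refl)
      moreover have "continuous_on (D \<inter> W) (Y J)"
        by (rule continuous_on_subset[OF c]) simp
      ultimately show "\<exists>W. open W \<and> x \<in> W \<and> continuous_on (D \<inter> W) K"
        using W(1,2) by blast
    qed
    show "\<exists>J. \<forall>j\<ge>J. K x = Y j x" if x: "x \<in> D" for x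
    proof -
      obtain J where J: "\<forall>j\<ge>J. Y j x = Y J x" using st[OF x] x by blast
      show ?thesis by (intro exI allI impI K[OF J])
    qed
  qed
qed

text \<open>Stone's argument: the patches of a fixed level lie at a positive distance from each other.\<close>

lemma stone_patches:
  fixes U :: "'i \<Rightarrow> 'a::metric_space set"
  assumes op: "\<And>i. i \<in> I \<Longrightarrow> open (U i)"
  obtains P :: "nat \<Rightarrow> 'i \<Rightarrow> 'a set"
  where "\<And>x i. i \<in> I \<Longrightarrow> x \<in> U i \<Longrightarrow> \<exists>n i. x \<in> P n i"
    and "\<And>n i x. x \<in> P n i \<Longrightarrow> i \<in> I \<and> ball x (1 / Suc n) \<subseteq> U i"
    and "\<And>n i j x y. i \<noteq> j \<Longrightarrow> x \<in> P n i \<Longrightarrow> y \<in> P n j \<Longrightarrow> x \<notin> U j \<or> y \<notin> U i"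
proof -
  obtain r :: "'i rel" where r: "well_order_on UNIV r" using well_order_on by blast
  then have wf: "wf (r - Id)" and tot: "total r"
    by (auto simp: well_order_on_def linear_order_on_def)
  \<comment> \<open>A point is given to the first set that contains it. Of two different indices one
    comes first, and the patch of the later one avoids the set of the earlier one; the depth
    \<open>1 / Suc n\<close> turns this into a distance between patches.\<close>
  define P where "P n i = {x. i \<in> I \<and> ball x (1 / Suc n) \<subseteq> U i \<and> (\<forall>j\<in>I. (j, i) \<in> r - Id \<longrightarrow> x \<notin> U j)}" for n :: nat and i
  show thesis
  proof
    fix x i assume "i \<in> I" "x \<in> U i"
    then have "i \<in> {i\<in>I. x \<in> U i}" by simp
    with wf obtain k where k: "k \<in> I" "x \<in> U k" "\<And>j. (j, k) \<in> r - Id \<Longrightarrow> \<not> (j \<in> I \<and> x \<in> U j)"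
      by (rule wfE_min) auto
    obtain e where e: "e > 0" "ball x e \<subseteq> U k" using op k by (meson openE)
    obtain n where "1 / Suc n < e" using e(1) nat_approx_posE by blast
    then have "x \<in> P n k" using k e unfolding P_def by (auto simp: subset_iff)
    then show "\<exists>n i. x \<in> P n i" by blast
  next
    fix n i j x y assume "i \<noteq> j" "x \<in> P n i" "y \<in> P n j"
    moreover have "(i, j) \<in> r - Id \<or> (j, i) \<in> r - Id"
      using tot \<open>i \<noteq> j\<close> by (auto simp: total_on_def)
    ultimately show "x \<notin> U j \<or> y \<notin> U i" by (auto simp: P_def)
  qed (auto simp: P_def)
qed

section \<open>Gluing local deformations\<close>

text \<open>The patches of one level are \<open>e\<close> apart, so a point is within
  \<open>e / 3\<close> of at most one of them, and all their deformations can run at the same time.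
  The time is damped by the distance to the union: full on the patches, zero at distance
  \<open>e / 3\<close>, where the motion joins the identity.\<close>

lemma deformation_stage:
  fixes Z :: "'a::metric_space set" and H :: "'a \<Rightarrow> 'a \<Rightarrow> real \<Rightarrow> 'a"
  assumes e: "e > 0"
    and P1: "\<And>u x. x \<in> P u \<Longrightarrow> u \<in> I \<and> ball x e \<subseteq> ball u (r u)"
    and P2: "\<And>u v x y. u \<noteq> v \<Longrightarrow> x \<in> P u \<Longrightarrow> y \<in> P v \<Longrightarrow> e \<le> dist x y"
    and Hc: "\<And>u. u \<in> I \<Longrightarrow> continuous_on ((Z \<inter> ball u (r u)) \<times> {0..1}) (\<lambda>(v, t). H u v t)"
    and H0: "\<And>u v. u \<in> I \<Longrightarrow> v \<in> Z \<Longrightarrow> v \<in> ball u (r u) \<Longrightarrow> H u v 0 = v"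
    and HR: "\<And>u v t. u \<in> I \<Longrightarrow> v \<in> Z \<Longrightarrow> v \<in> ball u (r u) \<Longrightarrow> t \<in> {0..1} \<Longrightarrow> R v (H u v t)"
    and R: "\<And>v. v \<in> Z \<Longrightarrow> R v v"
  obtains T :: "'a \<Rightarrow> real \<Rightarrow> 'a" where "continuous_on (Z \<times> {0..1}) (\<lambda>(v, t). T v t)"
    and "\<And>v. v \<in> Z \<Longrightarrow> T v 0 = v"
    and "\<And>v t. v \<in> Z \<Longrightarrow> t \<in> {0..1} \<Longrightarrow> R v (T v t)"
    and "\<And>u v. v \<in> Z \<Longrightarrow> v \<in> P u \<Longrightarrow> T v 1 = H u v 1"
proof -
  define PP where "PP = (\<Union>u. P u)"
  define near where "near x u \<longleftrightarrow> (\<exists>p\<in>P u. dist x p < e / 3)" for x u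
  define chi where "chi x = max 0 (1 - 3 * infdist x PP / e)" for x
  define T where "T x t = (if \<exists>u. near x u then H (SOME u. near x u) x (t * chi x) else x)" for x t
  have chi01: "chi x \<in> {0..1}" for x
    using e infdist_nonneg[of x PP] by (auto simp: chi_def)
  have unique: "u = v" if "near x u" "near y v" "dist x y < e / 3" for u v x y
  proof (rule ccontr)
    assume "u \<noteq> v"
    obtain p q where p: "p \<in> P u" "dist x p < e / 3" and q: "q \<in> P v" "dist y q < e / 3"
      using \<open>near x u\<close> \<open>near y v\<close> by (auto simp: near_def)
    have "dist p q \<le> dist p x + dist x y + dist y q"
      by (metis add.commute add_left_mono dist_triangle dist_triangle_le dist_commute)
    then show False using P2[OF \<open>u \<noteq> v\<close> p(1) q(1)] p q that(3) by (simp add: dist_commute)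
  qed
  have some: "(SOME u. near x u) = u" if "near x u" for x u
    using unique[OF someI[of "near x", OF that] that] e by simp
  have near_ball: "u \<in> I \<and> x \<in> ball u (r u)" if n: "near x u" for x u
  proof -
    obtain p where "p \<in> P u" "dist x p < e / 3" using n unfolding near_def by blast
    moreover from this have "x \<in> ball p e" using e by (simp add: dist_commute)
    ultimately show ?thesis using P1[of p u] by blast
  qed
  have far: "infdist x PP \<ge> e / 3" if "PP \<noteq> {}" "\<nexists>u. near x u" for x
  proof -
    have "infdist x PP = (INF a\<in>PP. dist x a)" using that by (simp add: infdist_def)
    moreover have "e / 3 \<le> (INF a\<in>PP. dist x a)"
      using that by (intro cINF_greatest) (auto simp: PP_def near_def not_less)
    ultimately show ?thesis by simp
  qed
  have step: "T x t = H u x (t * chi x)" if "near x u" for x t u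
    using that some[OF that] by (auto simp: T_def)
  have idle: "T x t = x" if "\<nexists>u. near x u" for x t
    using that by (simp add: T_def)
  have chi_c: "continuous_on A chi" for A
    unfolding chi_def using e by (intro continuous_intros) auto
  show thesis
  proof
    show "continuous_on (Z \<times> {0..1}) (\<lambda>(v, t). T v t)"
    proof (rule continuous_on_local)
      fix z :: "'a \<times> real" assume z: "z \<in> Z \<times> {0..1}"
      \<comment> \<open>The radius makes both cases stable. If the centre is within e/2 of a patch,
        nearby points are within 7e/12 of it, and a further e/3 still stays below e, so no other
        patch interferes. Otherwise nearby points have distance at least 5e/12 from all patches and
        do not move.\<close>
      define W where "W = ball (fst z) (e / 12) \<times> (UNIV :: real set)"
      have W: "open W" "z \<in> W"
        using e by (auto simp: W_def open_Times mem_Times_iff)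
      have "continuous_on (Z \<times> {0..1} \<inter> W) (\<lambda>(v, t). T v t)"
      proof (cases "\<exists>u. \<exists>p\<in>P u. dist (fst z) p < e / 2")
        case True
        then obtain u p where p: "p \<in> P u" "dist (fst z) p < e / 2" by blast
        have yp: "dist y p < 7 * e / 12" if "y \<in> ball (fst z) (e / 12)" for y
          using that p(2) dist_triangle[of y p "fst z"] by (simp add: dist_commute)
        have u: "u \<in> I" "\<And>y. y \<in> ball (fst z) (e / 12) \<Longrightarrow> y \<in> ball u (r u)"
          using P1[OF p(1)] yp e by (force simp: subset_iff dist_commute)+
        have T: "T y t = H u y (t * chi y)" if "y \<in> Z" "y \<in> ball (fst z) (e / 12)" for y t
        proof (cases "\<exists>v. near y v")
          case True
          then obtain v where v: "near y v" by blast
          then obtain q where q: "q \<in> P v" "dist y q < e / 3" by (auto simp: near_def)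
          have "dist p q < e"
            using yp[OF that(2)] q(2) dist_triangle[of p q y] e by (simp add: dist_commute)
          then have "u = v" using P2[of u v p q] p(1) q(1) by force
          then show ?thesis using step[OF v] by simp
        next
          case False
          have "PP \<noteq> {}" using p by (auto simp: PP_def)
          then have "chi y = 0" using far[OF _ False] e by (simp add: chi_def field_simps)
          then show ?thesis using idle[OF False] H0[OF u(1) that(1) u(2)[OF that(2)]] by simp
        qed
        have "continuous_on (Z \<times> {0..1} \<inter> W) (\<lambda>z. (\<lambda>(v, t). H u v t) (fst z, snd z * chi (fst z)))"
        proof (rule continuous_on_compose2[OF Hc[OF u(1)]])
          show "continuous_on (Z \<times> {0..1} \<inter> W) (\<lambda>z. (fst z, snd z * chi (fst z)))"
            by (intro continuous_intros continuous_on_compose2[OF chi_c[of UNIV]]) auto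
          show "(\<lambda>z. (fst z, snd z * chi (fst z))) ` (Z \<times> {0..1} \<inter> W)
              \<subseteq> (Z \<inter> ball u (r u)) \<times> {0..1}"
            using chi01 u(2) by (auto simp: W_def mult_le_one)
        qed
        then show ?thesis
          by (rule continuous_on_eq) (auto simp: T W_def)
      next
        case False
        have far': "\<nexists>u. near y u" if "y \<in> ball (fst z) (e / 12)" for y
        proof
          assume "\<exists>u. near y u"
          then obtain u p where "p \<in> P u" "dist y p < e / 3" by (auto simp: near_def)
          then show False
            using False that e dist_triangle[of "fst z" p y] by (auto simp: not_less) (smt (verit) field_sum_of_halves)
        qed
        have "continuous_on (Z \<times> {0..1} \<inter> W) fst" by (intro continuous_intros)
        then show ?thesis
          by (rule continuous_on_eq) (use far' idle in \<open>auto simp: W_def\<close>)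
      qed
      then show "\<exists>W. open W \<and> z \<in> W \<and> continuous_on (Z \<times> {0..1} \<inter> W) (\<lambda>(v, t). T v t)"
        using W by blast
    qed
    fix v assume v: "v \<in> Z"
    show "T v 0 = v"
      using H0[OF _ v] near_ball step[of v _ 0] idle[of v 0] by (cases "\<exists>u. near v u") auto
    show "R v (T v t)" if t: "t \<in> {0..1}" for t
    proof (cases "\<exists>u. near v u")
      case True
      then obtain u where u: "near v u" by blast
      have "t * chi v \<in> {0..1}" using chi01[of v] t by (auto simp: mult_le_one)
      then show ?thesis using HR[OF _ v] near_ball[OF u] step[OF u] by metis
    qed (simp add: idle R v)
    show "T v 1 = H u v 1" if u: "v \<in> P u" for u
    proof -
      have "near v u" using u e by (auto simp: near_def intro!: bexI[of _ v])
      moreover have "infdist v PP = 0" using u by (intro infdist_zero) (auto simp: PP_def)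
      ultimately show ?thesis by (simp add: step chi_def)
    qed
  qed
qed

text \<open>All that is remembered of the descent is the preorder \<open>R\<close>; the assumption
  \<open>chain\<close> replaces a lower bound for the progress of single steps. The gap between
  \<open>a0\<close> and \<open>a\<close> leaves room for switching the motion off
  continuously.\<close>

lemma deformation:
  fixes Z :: "'a::metric_space set" and f :: "'a \<Rightarrow> real"
  assumes f: "continuous_on Z f" and a: "a0 < a"
    and refl: "\<And>x. x \<in> Z \<Longrightarrow> R x x"
    and trans: "\<And>x y z. x \<in> Z \<Longrightarrow> y \<in> Z \<Longrightarrow> z \<in> Z \<Longrightarrow> R x y \<Longrightarrow> R y z \<Longrightarrow> R x z"
    and R: "\<And>x y. x \<in> Z \<Longrightarrow> R x y \<Longrightarrow> y \<in> Z \<and> f y \<le> f x"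
    and local: "\<And>u. u \<in> Z \<Longrightarrow> f u > a0 \<Longrightarrow> \<exists>r>0. \<exists>H :: 'a \<Rightarrow> real \<Rightarrow> 'a.
      continuous_on ((Z \<inter> ball u r) \<times> {0..1}) (\<lambda>(v, t). H v t) \<and>
      (\<forall>v\<in>Z \<inter> ball u r. H v 0 = v \<and> (\<forall>t\<in>{0..1}. R v (H v t)) \<and> f (H v 1) < f v)"
    and chain: "\<And>x :: nat \<Rightarrow> 'a. (\<And>n. x n \<in> Z \<and> f (x n) > a0) \<Longrightarrow>
      (\<And>m n. m \<le> n \<Longrightarrow> R (x m) (x n)) \<Longrightarrow> \<exists>l\<in>Z. x \<longlonglongrightarrow> l"
  obtains K :: "'a \<Rightarrow> real \<Rightarrow> 'a" where "continuous_on (Z \<times> {0..1}) (\<lambda>(v, t). K v t)"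
    and "\<And>v. v \<in> Z \<Longrightarrow> K v 0 = v"
    and "\<And>v t. v \<in> Z \<Longrightarrow> t \<in> {0..1} \<Longrightarrow> K v t \<in> Z \<and> f (K v t) \<le> f v"
    and "\<And>v. v \<in> Z \<Longrightarrow> f (K v 1) \<le> a"
proof -
  define I where "I = {u\<in>Z. f u > a0}"
  define good where "good u r H \<longleftrightarrow>
      continuous_on ((Z \<inter> ball u r) \<times> {0..1}) (\<lambda>(v, t). H v t) \<and>
      (\<forall>v\<in>Z \<inter> ball u r. H v 0 = v \<and> (\<forall>t\<in>{0..1}. R v (H v t)) \<and> f (H v 1) < f v)" for u r and H :: "'a \<Rightarrow> real \<Rightarrow> 'a"
  have "\<exists>r>0. \<exists>H. good u r H" if "u \<in> I" for u
    unfolding good_def by (rule local) (use that in \<open>auto simp: I_def\<close>)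
  then have "\<forall>u\<in>I. \<exists>r H. r > 0 \<and> good u r H" by blast
  then obtain r H where "\<And>u. u \<in> I \<Longrightarrow> r u > 0 \<and> good u (r u) (H u)"
    unfolding bchoice_iff by blast
  then have rH: "r u > 0"
      "continuous_on ((Z \<inter> ball u (r u)) \<times> {0..1}) (\<lambda>(v, t). H u v t)"
      "\<And>v. v \<in> Z \<Longrightarrow> v \<in> ball u (r u) \<Longrightarrow> H u v 0 = v"
      "\<And>v t. v \<in> Z \<Longrightarrow> v \<in> ball u (r u) \<Longrightarrow> t \<in> {0..1} \<Longrightarrow> R v (H u v t)"
      "\<And>v. v \<in> Z \<Longrightarrow> v \<in> ball u (r u) \<Longrightarrow> f (H u v 1) < f v" if "u \<in> I" for u
    unfolding good_def using that by blast+
  obtain P :: "nat \<Rightarrow> 'a \<Rightarrow> 'a set"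
    where P0: "\<And>x i. i \<in> I \<Longrightarrow> x \<in> ball i (r i) \<Longrightarrow> \<exists>n i. x \<in> P n i"
      and P1: "\<And>n i x. x \<in> P n i \<Longrightarrow> i \<in> I \<and> ball x (1 / Suc n) \<subseteq> ball i (r i)"
      and P2: "\<And>n i j x y. i \<noteq> j \<Longrightarrow> x \<in> P n i \<Longrightarrow> y \<in> P n j
        \<Longrightarrow> x \<notin> ball j (r j) \<or> y \<notin> ball i (r i)"
    using stone_patches[of I "\<lambda>u. ball u (r u)"] by (metis open_ball)
  have P2': "1 / Suc n \<le> dist x y" if "i \<noteq> j" "x \<in> P n i" "y \<in> P n j" for n i j x y
  proof (rule ccontr)
    assume "\<not> 1 / Suc n \<le> dist x y"
    then have "y \<in> ball x (1 / Suc n)" "x \<in> ball y (1 / Suc n)" by (auto simp: dist_commute)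
    then show False using P1[OF that(2)] P1[OF that(3)] P2[OF that] by blast
  qed
  define stage where "stage n T \<longleftrightarrow> continuous_on (Z \<times> {0..1}) (\<lambda>(v, t). T v t) \<and> (\<forall>v\<in>Z. T v 0 = v) \<and>
      (\<forall>v\<in>Z. \<forall>t\<in>{0..1}. R v (T v t)) \<and> (\<forall>v\<in>Z. \<forall>u. v \<in> P n u \<longrightarrow> T v 1 = H u v 1)"
    for n and T :: "'a \<Rightarrow> real \<Rightarrow> 'a"
  have "\<forall>n. \<exists>T. stage n T"
  proof
    fix n
    show "\<exists>T. stage n T"
  proof (rule deformation_stage[of "1 / Suc n" "P n" I r Z H R])
    show "u \<in> I \<and> ball x (1 / Suc n) \<subseteq> ball u (r u)" if "x \<in> P n u" for u x
      using P1[OF that] .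
    show "1 / Suc n \<le> dist x y" if "u \<noteq> v" "x \<in> P n u" "y \<in> P n v" for u v x y
      using P2'[OF that] .
    fix T assume T: "continuous_on (Z \<times> {0..1}) (\<lambda>(v, t). T v t)"
      "\<And>v. v \<in> Z \<Longrightarrow> T v (0::real) = v"
      "\<And>v t. v \<in> Z \<Longrightarrow> t \<in> {0..1} \<Longrightarrow> R v (T v t)"
      "\<And>u v. v \<in> Z \<Longrightarrow> v \<in> P n u \<Longrightarrow> T v 1 = H u v 1"
    show ?thesis
      unfolding stage_def by (intro exI[of _ T] conjI ballI allI impI T)
  qed (use rH refl in auto)
  qed
  then obtain T where st: "\<And>n. stage n (T n)"
    using choice[of stage] by blast
  have T: "continuous_on (Z \<times> {0..1}) (\<lambda>(v, t). T n v t)"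
      "v \<in> Z \<Longrightarrow> T n v 0 = v"
      "v \<in> Z \<Longrightarrow> t \<in> {0..1} \<Longrightarrow> R v (T n v t)"
      "v \<in> Z \<Longrightarrow> v \<in> P n u \<Longrightarrow> T n v 1 = H u v 1" for n v t u
    using st[of n] unfolding stage_def by auto
  \<comment> \<open>Every stage recurs infinitely often, so a limit of the iteration would be moved by its own stage.\<close>
  define idx where "idx j = fst (prod_decode j)" for j
  define X where "X = rec_nat (\<lambda>x. x) (\<lambda>j Xj x. T (idx j) (Xj x) 1)"
  have X0: "X 0 x = x" and XS: "X (Suc j) x = T (idx j) (X j x) 1" for j x
    by (simp_all add: X_def)
  have XZ: "X j x \<in> Z" if "x \<in> Z" for x j
  proof (induction j)
    case (Suc j)
    then show ?case using R[OF Suc T(3)[OF Suc, of 1]] by (simp add: XS)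
  qed (simp add: X0 that)
  have XR: "R (X i x) (X j x)" if "i \<le> j" "x \<in> Z" for i j x
    using that(1)
  proof (induction j rule: dec_induct)
    case base show ?case using refl XZ that by blast
  next
    case (step j)
    have "R (X j x) (X (Suc j) x)" using T(3)[OF XZ[OF that(2)], of 1] by (simp add: XS)
    with step.IH show ?case by (rule trans[OF XZ XZ XZ, OF that(2) that(2) that(2)])
  qed
  have Xf: "f (X j x) \<le> f (X i x)" if "i \<le> j" "x \<in> Z" for i j x
    using R XR that XZ by blast
  have Tc: "continuous_on A (\<lambda>z. T n (g z) (h z))"
    if "continuous_on A g" "continuous_on A h" "\<And>z. z \<in> A \<Longrightarrow> g z \<in> Z \<and> h z \<in> {0..1}"
    for A :: "'c::topological_space set" and g h n
    using continuous_on_compose2[OF T(1)[of n], of A "\<lambda>z. (g z, h z)"] that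
    by (auto intro: continuous_on_Pair simp: image_subset_iff)
  have Xc: "continuous_on Z (X j)" for j
  proof (induction j)
    case 0 show ?case by (simp add: X_def continuous_on_id)
  next
    case (Suc j)
    have "X (Suc j) = (\<lambda>x. T (idx j) (X j x) 1)" by (simp add: X_def)
    then show ?case using Tc[OF Suc, of "\<lambda>_. 1"] XZ by simp
  qed
  define a' where "a' = (a0 + a) / 2"
  have a': "a0 < a'" "a' < a" using a by (auto simp: a'_def)
  have reach: "\<exists>j. f (X j x) < a'" if x: "x \<in> Z" for x
  proof (rule ccontr)
    assume "\<not> ?thesis"
    then have ge: "f (X j x) \<ge> a'" for j by (simp add: not_less)
    obtain l where l: "l \<in> Z" "(\<lambda>j. X j x) \<longlonglongrightarrow> l"
      using chain[of "\<lambda>j. X j x"] XZ[OF x] XR[OF _ x] ge a' by (metis less_le_trans)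
    have "(\<lambda>j. f (X j x)) \<longlonglongrightarrow> f l"
      using continuous_on_tendsto_compose[OF f l(2) l(1)] XZ[OF x] by simp
    then have "f l \<ge> a'" using ge by (intro LIMSEQ_le_const) auto
    then have lI: "l \<in> I" using a' l by (simp add: I_def)
    then obtain n u where nu: "l \<in> P n u" using P0[OF lI, of l] rH(1)[OF lI] by auto
    then have "u \<in> I" "l \<in> ball u (r u)" using P1[OF nu] by (auto simp: subset_iff)
    then have less: "f (T n l 1) < f l" using T(4)[OF l(1) nu] rH(5) l by auto
    \<comment> \<open>These are the times at which stage n is applied. Along them the points before
      and after its application have the same limit \<open>l\<close>, so this stage would fix
      \<open>l\<close>.\<close>
    define k where "k i = prod_encode (n, i)" for i :: nat
    have k: "strict_mono k"
      by (simp add: strict_mono_Suc_iff k_def prod_encode_def)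
    have Xk: "(\<lambda>i. X (k i) x) \<longlonglongrightarrow> l"
      using LIMSEQ_subseq_LIMSEQ[OF l(2) k] by (simp add: o_def)
    have "continuous_on Z (\<lambda>y. T n y 1)"
      by (intro Tc) (auto simp: continuous_on_id)
    then have "(\<lambda>i. T n (X (k i) x) 1) \<longlonglongrightarrow> T n l 1"
      by (rule continuous_on_tendsto_compose[OF _ Xk l(1)]) (simp add: XZ[OF x])
    moreover have "T n (X (k i) x) 1 = X (Suc (k i)) x" for i
      by (simp add: XS idx_def k_def)
    moreover have "(\<lambda>i. X (Suc (k i)) x) \<longlonglongrightarrow> l"
      using LIMSEQ_subseq_LIMSEQ[OF LIMSEQ_Suc[OF l(2)] k] by (simp add: o_def)
    ultimately have "T n l 1 = l" using LIMSEQ_unique by simp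
    then show False using less by simp
  qed
  \<comment> \<open>The weight is read off the undamped trajectory \<open>X\<close>, not off
    \<open>Y\<close>. Once \<open>X\<close> has fallen below a', the weight vanishes for all later
    stages, uniformly near the point, so \<open>Y\<close> becomes locally stationary. As long as
    \<open>X\<close> is above \<open>a\<close> the weight is 1, so at time 1 the damped trajectory
    follows \<open>X\<close> down to that level.\<close>
  define w where "w j x = max 0 (min 1 ((f (X j x) - a') / (a - a')))" for j x
  have w01: "w j x \<in> {0..1}" for j x by (auto simp: w_def)
  have wc: "continuous_on Z (w j)" for j
    unfolding w_def using a'
    by (intro continuous_intros continuous_on_compose2[OF f Xc]) (auto simp: XZ)
  define Y where "Y = rec_nat fst (\<lambda>j Yj z. T (idx j) (Yj z) (snd z * w j (fst z)))"
  let ?D = "Z \<times> {0..1::real}"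
  have Y0: "Y 0 z = fst z" and YS: "Y (Suc j) z = T (idx j) (Y j z) (snd z * w j (fst z))" for j z
    by (simp_all add: Y_def)
  have tw: "snd z * w j (fst z) \<in> {0..1}" if "z \<in> ?D" for z j
    using that w01[of j "fst z"] by (auto simp: mult_le_one)
  have YZ: "Y j z \<in> Z" if "z \<in> ?D" for j z
  proof (induction j)
    case (Suc j)
    then show ?case using R[OF Suc T(3)[OF Suc tw[OF that]]] by (simp add: YS)
  qed (use that in \<open>auto simp: Y0\<close>)
  have "R (Y j z) (Y (Suc j) z)" if "z \<in> ?D" for j z
    using T(3) YZ tw that by (simp add: YS)
  then have Yf1: "f (Y (Suc j) z) \<le> f (Y j z)" if "z \<in> ?D" for j z
    using R YZ that by blast
  have Yf: "f (Y j z) \<le> f (Y i z)" if "i \<le> j" "z \<in> ?D" for i j z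
    using that(1) by (induction j rule: dec_induct) (use Yf1[OF that(2)] in \<open>auto intro: order_trans\<close>)
  have Yc: "continuous_on ?D (Y j)" for j
  proof (induction j)
    case 0 show ?case by (simp add: Y_def continuous_on_fst continuous_on_id)
  next
    case (Suc j)
    have "Y (Suc j) = (\<lambda>z. T (idx j) (Y j z) (snd z * w j (fst z)))" by (simp add: Y_def)
    moreover have "continuous_on ?D (\<lambda>z. snd z * w j (fst z))"
      by (intro continuous_intros continuous_on_compose2[OF wc]) auto
    ultimately show ?case using Tc[OF Suc] YZ tw by simp
  qed
  have "\<exists>W J. open W \<and> z \<in> W \<and> (\<forall>y\<in>?D \<inter> W. \<forall>j\<ge>J. Y j y = Y J y)" if z: "z \<in> ?D" for z
  proof -
    obtain J where J: "f (X J (fst z)) < a'" using reach z by force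
    have "continuous_on Z (\<lambda>x. f (X J x))"
      by (rule continuous_on_compose2[OF f Xc]) (auto simp: XZ)
    then obtain V where V: "open V" "V \<inter> Z = (\<lambda>x. f (X J x)) -` {..<a'} \<inter> Z"
      using continuous_on_open_invariant[of Z "\<lambda>x. f (X J x)"] by (metis open_lessThan)
    have st: "Y j y = Y J y" if y: "y \<in> ?D" "fst y \<in> V" and j: "j \<ge> J" for y j
      using j
    proof (induction j rule: dec_induct)
      case (step j)
      have yZ: "fst y \<in> Z" using y by auto
      then have "f (X J (fst y)) < a'" using V(2) y by auto
      then have "f (X j (fst y)) < a'" using Xf[OF step(1) yZ] by simp
      then have "(f (X j (fst y)) - a') / (a - a') \<le> 0"
        using a' by (intro divide_nonpos_pos) auto
      then have "w j (fst y) = 0" by (simp add: w_def)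
      then have "Y (Suc j) y = Y j y" using T(2) YZ[OF y(1)] by (simp add: YS)
      then show ?case using step by simp
    qed simp
    show ?thesis
    proof (intro exI[of _ "V \<times> UNIV"] exI[of _ J] conjI ballI allI impI)
      show "open (V \<times> (UNIV :: real set))" using V by (simp add: open_Times)
      show "z \<in> V \<times> UNIV" using V z J by (auto simp: mem_Times_iff)
      show "Y j y = Y J y" if "y \<in> ?D \<inter> V \<times> UNIV" "J \<le> j" for y j
        by (rule st) (use that in auto)
    qed
  qed
  with Yc obtain K where K: "continuous_on ?D K" "\<And>z. z \<in> ?D \<Longrightarrow> \<exists>J. \<forall>j\<ge>J. K z = Y j z"
    using locally_stationary_limit[of ?D Y] by blast
  show thesis
  proof
    show "continuous_on ?D (\<lambda>(v, t). K (v, t))" using K(1) by simp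
    fix v assume v: "v \<in> Z"
    have "Y j (v, 0) = v" for j
      by (induction j) (use T(2) v in \<open>auto simp: Y0 YS\<close>)
    then show "K (v, 0) = v" using K(2)[of "(v, 0)"] v by auto
    show "K (v, t) \<in> Z \<and> f (K (v, t)) \<le> f v" if "t \<in> {0..1}" for t
    proof -
      have D: "(v, t) \<in> ?D" using v that by auto
      then obtain j where "K (v, t) = Y j (v, t)" using K(2) by blast
      then show ?thesis using YZ[OF D, of j] Yf[of 0 j, OF _ D] by (simp add: Y0)
    qed
    show "f (K (v, 1)) \<le> a"
    proof -
      have D: "(v, 1) \<in> ?D" using v by auto
      \<comment> \<open>Up to the first index at which \<open>X\<close> reaches the level
        \<open>a\<close> all weights are 1, so \<open>Y\<close> and \<open>X\<close> agree there at
        time 1; afterwards \<open>f\<close> cannot increase.\<close>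
      define m where "m = (LEAST m. f (X m v) \<le> a)"
      obtain j0 where "f (X j0 v) \<le> a" using reach[OF v] a' by (meson less_imp_le less_trans)
      then have m: "f (X m v) \<le> a" unfolding m_def by (rule LeastI[where P = "\<lambda>m. f (X m v) \<le> a"])
      have "Y i (v, 1) = X i v" if "i \<le> m" for i
        using that
      proof (induction i)
        case (Suc i)
        then have "\<not> f (X i v) \<le> a" unfolding m_def by (intro not_less_Least) simp
        then have "(f (X i v) - a') / (a - a') \<ge> 1" using a' by simp
        then have "w i v = 1" by (simp add: w_def)
        then show ?case using Suc by (simp add: YS XS)
      qed (simp add: Y0 X0)
      then have Ym: "f (Y m (v, 1)) \<le> a" using m by simp
      obtain J where "\<forall>j\<ge>J. K (v, 1) = Y j (v, 1)" using K(2)[OF D] by blast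
      then have "K (v, 1) = Y (max J m) (v, 1)" by simp
      then show ?thesis using Yf[of m "max J m", OF _ D] Ym by simp
    qed
  qed
qed

section \<open>Odd deformations\<close>

text \<open>An odd analogue of a locally finite partition of unity, built on the sphere and pulled
  back by \<open>sgn\<close>. Values of absolute value exactly 1 are required because the functions
  serve as deformation times, and only a full step is sure to reach the target level.\<close>

lemma odd_partition:
  obtains \<theta> :: "nat \<Rightarrow> 'a::real_normed_vector \<Rightarrow> real"
  where "\<And>n. continuous_on (- {0}) (\<theta> n)"
    and "\<And>n x. \<theta> n (- x) = - \<theta> n x"
    and "\<And>n x. x \<noteq> 0 \<Longrightarrow> \<bar>\<theta> n x\<bar> \<le> 1"
    and "\<And>x. x \<noteq> 0 \<Longrightarrow> \<exists>n. \<bar>\<theta> n x\<bar> = 1"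
    and "\<And>x. x \<noteq> 0 \<Longrightarrow> \<exists>W N. open W \<and> x \<in> W \<and> (\<forall>y\<in>W. y \<noteq> 0 \<longrightarrow> (\<forall>n\<ge>N. \<theta> n y = 0))"
proof -
  \<comment> \<open>The sphere is covered by antipodal pairs of balls; \<open>Q n\<close> collects the half of each patch near its index.\<close>
  define U where "U a = ball a (1/2) \<union> ball (- a) (1/2)" for a :: 'a
  have Usym: "- x \<in> U a \<longleftrightarrow> x \<in> U a" for x a
    by (auto simp: U_def dist_norm norm_minus_commute add.commute)
  have "\<And>i. i \<in> sphere 0 1 \<Longrightarrow> open (U i)" by (auto simp: U_def)
  then obtain P :: "nat \<Rightarrow> 'a \<Rightarrow> 'a set"
    where P0: "\<And>x i. i \<in> sphere 0 1 \<Longrightarrow> x \<in> U i \<Longrightarrow> \<exists>n i. x \<in> P n i"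
      and P1: "\<And>n i x. x \<in> P n i \<Longrightarrow> i \<in> sphere 0 1 \<and> ball x (1 / Suc n) \<subseteq> U i"
      and P2: "\<And>n i j x y. i \<noteq> j \<Longrightarrow> x \<in> P n i \<Longrightarrow> y \<in> P n j \<Longrightarrow> x \<notin> U j \<or> y \<notin> U i"
    by (rule stone_patches[of "sphere 0 1" U]) blast+
  define Q where "Q n = {y. \<exists>a. y \<in> ball a (1/2) \<and> (y \<in> P n a \<or> - y \<in> P n a)}" for n
  have QD: "\<exists>a. norm a = 1 \<and> y \<in> ball a (1/2) \<and> ball y (1 / Suc n) \<subseteq> U a \<and> (y \<in> P n a \<or> - y \<in> P n a)"
    if Q: "y \<in> Q n" for y n
  proof -
    obtain a where a: "y \<in> ball a (1/2)" "y \<in> P n a \<or> - y \<in> P n a" using Q by (auto simp: Q_def)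
    have "ball y (1 / Suc n) \<subseteq> U a"
    proof (cases "y \<in> P n a")
      case False
      then have sub: "ball (- y) (1 / Suc n) \<subseteq> U a" using P1 a by blast
      show ?thesis
      proof
        fix z assume "z \<in> ball y (1 / Suc n)"
        then have "- z \<in> ball (- y) (1 / Suc n)" by (simp add: dist_minus)
        then have "- z \<in> U a" using sub by blast
        then show "z \<in> U a" by (simp add: Usym)
      qed
    qed (use P1 in blast)
    moreover have "norm a = 1" using P1 a by fastforce
    ultimately show ?thesis using a by blast
  qed
  \<comment> \<open>\<open>Q n\<close> keeps its distance from its own mirror image. If y and z
    belong to the same unit vector a, both are within 1/2 of it and |y + z| exceeds 1. If they
    belong to different vectors and -y is close to z, then y, -y, z and -z lie in both antipodal
    pairs of balls, which the patches exclude.\<close>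
  have sep: "1 / Suc n \<le> dist (- y) z" if yz: "y \<in> Q n" "z \<in> Q n" for y z n
  proof (rule ccontr)
    assume less: "\<not> ?thesis"
    obtain a where a: "norm a = 1" "y \<in> ball a (1/2)" "ball y (1 / Suc n) \<subseteq> U a" "y \<in> P n a \<or> - y \<in> P n a"
      using QD[OF yz(1)] by blast
    obtain b where b: "norm b = 1" "z \<in> ball b (1/2)" "ball z (1 / Suc n) \<subseteq> U b" "z \<in> P n b \<or> - z \<in> P n b"
      using QD[OF yz(2)] by blast
    show False
    proof (cases "a = b")
      case True
      have "norm (2 *\<^sub>R a) \<le> norm (a - y) + norm (a - z) + norm (y + z)"
        using norm_triangle_ineq[of "(a - y) + (a - z)" "y + z"] norm_triangle_ineq[of "a - y" "a - z"]
        by (simp add: algebra_simps scaleR_2)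
      moreover have "norm (y + z) = dist (- y) z"
        by (metis dist_norm norm_minus_cancel minus_diff_eq diff_minus_eq_add add.commute)
      moreover have "1 / real (Suc n) \<le> 1" by simp
      moreover have "norm (2 *\<^sub>R a) = 2" "norm (a - y) < 1 / 2" "norm (a - z) < 1 / 2"
        using a(1,2) b(2) True by (simp_all add: dist_norm)
      ultimately show False using less by linarith
    next
      case False
      have "- y \<in> ball z (1 / Suc n)" using less by (simp add: dist_commute)
      then have "y \<in> U b" "- y \<in> U b" using b Usym by blast+
      moreover have "dist y (- z) = dist (- y) z"
        using dist_minus[of "- y" z] by simp
      then have "- z \<in> ball y (1 / Suc n)" using less by simp
      then have "z \<in> U a" "- z \<in> U a" using a Usym by blast+
      ultimately show False using P2[OF False] a(4) b(4) by blast
    qed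
  qed
  \<comment> \<open>The tents have height and width \<open>1 / Suc n\<close>. By the separation just
    shown, \<open>om n\<close> attains the full height on \<open>Q n\<close>; the heights tend to 0,
    which yields local finiteness below.\<close>
  define chi where "chi n t = max 0 (1 / Suc n - t)" for n :: nat and t :: real
  define om where "om n x = chi n (infdist x (Q n)) - chi n (infdist (- x) (Q n))" for n x
  have om_odd: "om n (- x) = - om n x" for n x by (simp add: om_def)
  have om_le: "\<bar>om n x\<bar> \<le> 1 / Suc n" for n x
    using infdist_nonneg[of x "Q n"] infdist_nonneg[of "- x" "Q n"]
    by (auto simp: om_def chi_def max_def abs_le_iff)
  have om_lip: "\<bar>om n x - om n y\<bar> \<le> 2 * dist x y" for n x y
  proof -
    have "\<bar>chi n s - chi n t\<bar> \<le> \<bar>s - t\<bar>" for s t by (auto simp: chi_def max_def)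
    moreover note infdist_triangle_abs[of x "Q n" y] infdist_triangle_abs[of "- x" "Q n" "- y"]
    moreover have "dist (- x) (- y) = dist x y" by (rule dist_minus)
    ultimately have "\<bar>chi n (infdist x (Q n)) - chi n (infdist y (Q n))\<bar> \<le> dist x y"
      "\<bar>chi n (infdist (- x) (Q n)) - chi n (infdist (- y) (Q n))\<bar> \<le> dist x y"
      by (metis order_trans)+
    then show ?thesis unfolding om_def by linarith
  qed
  have om_Q: "om n y = 1 / Suc n" if y: "y \<in> Q n" for n y
  proof -
    have "infdist (- y) (Q n) = (INF z\<in>Q n. dist (- y) z)" using y by (auto simp: infdist_def)
    moreover have "1 / Suc n \<le> (INF z\<in>Q n. dist (- y) z)"
      by (rule cINF_greatest) (use y sep in auto)
    ultimately show ?thesis using y by (simp add: om_def chi_def infdist_zero)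
  qed
  have om_pos: "\<exists>n. \<bar>om n x\<bar> > 0" if x: "norm x = 1" for x
  proof -
    obtain n a where "x \<in> P n a" using P0[of x x] x by (auto simp: U_def)
    moreover from this have "x \<in> U a" using P1[of x n a] by (auto simp: subset_iff)
    ultimately have "x \<in> Q n \<or> - x \<in> Q n"
      by (auto simp: Q_def U_def dist_norm norm_minus_commute add.commute)
    then have "om n x = 1 / Suc n \<or> om n x = - (1 / Suc n)"
      using om_Q[of x n] om_Q[of "- x" n] om_odd[of n x] by fastforce
    then have "\<bar>om n x\<bar> = 1 / Suc n" by (elim disjE) simp_all
    then show ?thesis by (intro exI[of _ n]) simp
  qed
  \<comment> \<open>The supremum is continuous because all \<open>om n\<close> share the Lipschitz
    constant 2, and it is attained because the heights tend to 0 while the supremum is positive on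
    the sphere.\<close>
  define S where "S x = (SUP n. \<bar>om n x\<bar>)" for x
  have bdd: "bdd_above (range (\<lambda>n. \<bar>om n x\<bar>))" for x
  proof (rule bdd_aboveI2)
    show "\<bar>om n x\<bar> \<le> 1" for n using om_le[of n x] order_trans[of "\<bar>om n x\<bar>" "1 / Suc n" 1] by simp
  qed
  have om_S: "\<bar>om n x\<bar> \<le> S x" for n x unfolding S_def by (rule cSUP_upper[OF _ bdd]) simp
  have S_lip1: "S x \<le> S y + 2 * dist x y" for x y
  proof -
    have "\<bar>om n x\<bar> \<le> S y + 2 * dist x y" for n
      using om_lip[of n x y] om_S[of n y] by linarith
    then show ?thesis unfolding S_def[of x] by (intro cSUP_least) auto
  qed
  have S_lip: "dist (S x) (S y) \<le> 2 * dist x y" for x y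
    using S_lip1[of x y] S_lip1[of y x] by (auto simp: dist_real_def dist_commute)
  have S_c: "continuous_on A S" for A
    unfolding continuous_on_iff
    by (metis S_lip dist_commute less_divide_eq_numeral1(1) mult.commute order_le_less_trans
        zero_less_divide_iff zero_less_numeral)
  have om_c: "continuous_on A (om n)" for A n
    unfolding om_def chi_def by (intro continuous_intros)
  have S_pos: "S x > 0" if x: "norm x = 1" for x
    using om_pos[OF x] om_S[of _ x] by (meson less_le_trans)
  have S_odd: "S (- x) = S x" for x by (simp add: S_def om_odd)
  have att: "\<exists>n. \<bar>om n x\<bar> = S x" if x: "norm x = 1" for x
  proof (rule ccontr)
    assume "\<not> ?thesis"
    then have less: "\<bar>om n x\<bar> < S x" for n using om_S[of n x] by (metis less_eq_real_def)
    obtain N where N: "1 / Suc N < S x" using S_pos[OF x] nat_approx_posE by blast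
    define m where "m = Max (insert (1 / Suc N) ((\<lambda>n. \<bar>om n x\<bar>) ` {..N}))"
    have "m < S x" unfolding m_def using N less by (subst Max_less_iff) auto
    have "\<bar>om n x\<bar> \<le> m" for n
    proof (cases "n \<le> N")
      case True
      then show ?thesis unfolding m_def by (intro Max_ge) auto
    next
      case False
      then have "1 / Suc n \<le> 1 / Suc N" by (simp add: frac_le)
      moreover have "1 / Suc N \<le> m" unfolding m_def by (rule Max_ge) auto
      ultimately show ?thesis using om_le[of n x] by linarith
    qed
    then have "S x \<le> m" unfolding S_def by (intro cSUP_least) auto
    with \<open>m < S x\<close> show False by simp
  qed
  \<comment> \<open>Soft thresholding at half the supremum: functions below half of it are cut to 0,
    which leaves locally finitely many, and the function attaining the supremum is scaled to 1 or
    -1.\<close>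
  define th where "th n x = (max 0 (om n x - S x / 2) - max 0 (- om n x - S x / 2)) / (S x / 2)" for n x
  have "norm (sgn x) = 1" if "x \<noteq> 0" for x :: 'a using that by (simp add: norm_sgn)
  note Spos = S_pos[OF this] and att = att[OF this]
  have sgn_c: "continuous_on (- {0}) (sgn :: 'a \<Rightarrow> 'a)"
    by (intro continuous_intros) auto
  show thesis
  proof
    show "continuous_on (- {0}) (\<lambda>x. th n (sgn x))" for n
      unfolding th_def
      by (intro continuous_intros continuous_on_compose2[OF om_c[of UNIV] sgn_c]
          continuous_on_compose2[OF S_c[of UNIV] sgn_c]) (use Spos in force)+
    show "th n (sgn (- x)) = - th n (sgn x)" for n x
      by (simp add: th_def sgn_minus om_odd S_odd minus_divide_left)
    show "\<bar>th n (sgn x)\<bar> \<le> 1" if "x \<noteq> 0" for n x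
      using Spos[OF that] om_S[of n "sgn x"] by (auto simp: th_def abs_le_iff field_simps max_def)
    show "\<exists>n. \<bar>th n (sgn x)\<bar> = 1" if x: "x \<noteq> 0" for x
    proof -
      obtain n where "\<bar>om n (sgn x)\<bar> = S (sgn x)" using att[OF x] by blast
      then have "\<bar>th n (sgn x)\<bar> = 1"
        using Spos[OF x] by (cases "om n (sgn x) \<ge> 0") (auto simp: th_def field_simps max_def)
      then show ?thesis by blast
    qed
    show "\<exists>W N. open W \<and> x \<in> W \<and> (\<forall>y\<in>W. y \<noteq> 0 \<longrightarrow> (\<forall>n\<ge>N. th n (sgn y) = 0))" if x: "x \<noteq> 0" for x
    proof -
      define \<sigma> where "\<sigma> = S (sgn x)"
      have \<sigma>: "\<sigma> > 0" using Spos[OF x] by (simp add: \<sigma>_def)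
      obtain N where N: "1 / Suc N < \<sigma> / 4" using \<sigma> nat_approx_posE[of "\<sigma> / 4"] by auto
      define W where "W = (\<lambda>y. S (sgn y)) -` {\<sigma>/2<..} \<inter> - {0}"
      have "continuous_on (- {0}) (\<lambda>y. S (sgn y))"
        by (rule continuous_on_compose2[OF S_c[of UNIV] sgn_c]) auto
      then have "open W" unfolding W_def
        using continuous_on_open_vimage[of "- {0}" "\<lambda>y. S (sgn y)"] by (simp add: open_Compl)
      moreover have "x \<in> W" using x \<sigma> by (simp add: W_def \<sigma>_def)
      moreover have "th n (sgn y) = 0" if y: "y \<in> W" "n \<ge> N" for y n
      proof -
        have "1 / Suc n \<le> 1 / Suc N" using y(2) by (simp add: frac_le)
        then have "\<bar>om n (sgn y)\<bar> \<le> S (sgn y) / 2" using om_le[of n "sgn y"] N y by (simp add: W_def)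
        then show ?thesis by (simp add: th_def)
      qed
      ultimately show ?thesis by blast
    qed
  qed
qed

text \<open>Reversing the sign of both the point and the time reverses the sign of the combined
  motion, so steps with odd times are odd. The times are evaluated at the starting point, hence
  local finiteness there makes the infinite composition locally finite. One of the steps has full
  time and reaches the level \<open>a\<close>, and the others do not raise \<open>f\<close>.\<close>

lemma odd_deformation:
  fixes Z :: "'a::real_normed_vector set" and f :: "'a \<Rightarrow> real" and K :: "'a \<Rightarrow> real \<Rightarrow> 'a"
  assumes sym: "\<And>x. x \<in> Z \<Longrightarrow> - x \<in> Z" and nz: "0 \<notin> Z"
    and even: "\<And>x. x \<in> Z \<Longrightarrow> f (- x) = f x"
    and Kc: "continuous_on (Z \<times> {0..1}) (\<lambda>(v, t). K v t)"
    and K0: "\<And>v. v \<in> Z \<Longrightarrow> K v 0 = v"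
    and KZ: "\<And>v t. v \<in> Z \<Longrightarrow> t \<in> {0..1} \<Longrightarrow> K v t \<in> Z \<and> f (K v t) \<le> f v"
    and K1: "\<And>v. v \<in> Z \<Longrightarrow> f (K v 1) \<le> a"
  obtains R where "continuous_on Z R" "\<And>x. x \<in> Z \<Longrightarrow> R x \<in> Z \<and> f (R x) \<le> a"
    "\<And>x. x \<in> Z \<Longrightarrow> R (- x) = - R x"
proof -
  obtain \<theta> :: "nat \<Rightarrow> 'a \<Rightarrow> real"
    where th_c: "\<And>n. continuous_on (- {0}) (\<theta> n)"
      and th_odd: "\<And>n x. \<theta> n (- x) = - \<theta> n x"
      and th_le: "\<And>n x. x \<noteq> 0 \<Longrightarrow> \<bar>\<theta> n x\<bar> \<le> 1"
      and th_1: "\<And>x. x \<noteq> 0 \<Longrightarrow> \<exists>n. \<bar>\<theta> n x\<bar> = 1"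
      and th_fin: "\<And>x. x \<noteq> 0 \<Longrightarrow> \<exists>W N. open W \<and> x \<in> W \<and> (\<forall>y\<in>W. y \<noteq> 0 \<longrightarrow> (\<forall>n\<ge>N. \<theta> n y = 0))"
    by (rule odd_partition) blast
  \<comment> \<open>For \<open>s \<ge> 0\<close> this is \<open>K y s\<close>, for \<open>s \<le> 0\<close> it is the mirror image \<open>- K (- y) (- s)\<close>.\<close>
  define S where "S y s = - K (- K y (max 0 s)) (max 0 (- s))" for y s
  have S_pos: "S y s = K y s" if "y \<in> Z" "0 \<le> s" "s \<le> 1" for y s
    using K0[of "- K y s"] KZ[of y s] sym[of "K y s"] that by (simp add: S_def)
  have S_neg: "S y s = - K (- y) (- s)" if "y \<in> Z" "s \<le> 0" for y s
    using K0[of y] that by (simp add: S_def max_def)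
  have S_f: "S y s \<in> Z \<and> f (S y s) \<le> f y" if y: "y \<in> Z" and s: "\<bar>s\<bar> \<le> 1" for y s
  proof (cases "s \<ge> 0")
    case True
    then show ?thesis using KZ[of y s] S_pos[of y s] y s by auto
  next
    case False
    then have "K (- y) (- s) \<in> Z \<and> f (K (- y) (- s)) \<le> f (- y)"
      using KZ[of "- y" "- s"] sym[OF y] s by auto
    then show ?thesis using S_neg[of y s] y False sym even by auto
  qed
  have S_odd: "S (- y) (- s) = - S y s" if y: "y \<in> Z" and s: "\<bar>s\<bar> \<le> 1" for y s
    using S_pos[of y s] S_neg[of y s] S_pos[of "- y" "- s"] S_neg[of "- y" "- s"] sym[OF y] y s
    by (cases "s \<ge> 0") auto
  have S_1: "f (S y s) \<le> a" if y: "y \<in> Z" and s: "\<bar>s\<bar> = 1" for y s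
  proof -
    have "s = 1 \<or> s = - 1" using s by linarith
    then show ?thesis
      using S_pos[OF y, of 1] S_neg[OF y, of "- 1"] K1[OF y] K1[OF sym[OF y]]
        even[of "K (- y) 1"] KZ[OF sym[OF y], of 1] by auto
  qed
  have S_0: "S y 0 = y" if "y \<in> Z" for y using S_pos[OF that, of 0] K0[OF that] by simp
  have K_c: "continuous_on A (\<lambda>z. K (g z) (h z))"
    if "continuous_on A g" "continuous_on A h" "\<And>z. z \<in> A \<Longrightarrow> g z \<in> Z \<and> h z \<in> {0..1}"
    for A :: "'a set" and g h
    using continuous_on_compose2[OF Kc, of A "\<lambda>z. (g z, h z)"] that
    by (auto intro: continuous_on_Pair simp: image_subset_iff)
  \<comment> \<open>The definition of \<open>S\<close> composes both motions, one of them always at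
    time 0. Continuity across time 0 therefore follows from a composition, without pasting at sign
    changes.\<close>
  have S_c: "continuous_on A (\<lambda>z. S (g z) (h z))"
    if g: "continuous_on A g" and h: "continuous_on A h"
      and gh: "\<And>z. z \<in> A \<Longrightarrow> g z \<in> Z \<and> \<bar>h z\<bar> \<le> 1" for A :: "'a set" and g h
    unfolding S_def
  proof (intro continuous_on_minus K_c continuous_on_max continuous_on_const g h)
    fix z assume z: "z \<in> A"
    then show "g z \<in> Z \<and> max 0 (h z) \<in> {0..1}" using gh[OF z] by auto
    then have "K (g z) (max 0 (h z)) \<in> Z" using KZ by blast
    then show "- K (g z) (max 0 (h z)) \<in> Z \<and> max 0 (- h z) \<in> {0..1}"
      using gh[OF z] sym by auto
  qed
  define Y where "Y = rec_nat (\<lambda>x. x) (\<lambda>n Yn x. S (Yn x) (\<theta> n x))"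
  have Y0: "Y 0 = (\<lambda>x. x)" and YS: "Y (Suc n) = (\<lambda>x. S (Y n x) (\<theta> n x))" for n
    by (simp_all add: Y_def)
  have ne: "x \<noteq> 0" if "x \<in> Z" for x using that nz by blast
  have YZ: "Y n x \<in> Z" if x: "x \<in> Z" for n x
    by (induction n) (use x S_f th_le[OF ne[OF x]] in \<open>auto simp: Y0 YS\<close>)
  have Yf: "f (Y m x) \<le> f (Y n x)" if x: "x \<in> Z" and mn: "n \<le> m" for n m x
    using mn
  proof (induction m rule: dec_induct)
    case (step m)
    have "f (Y (Suc m) x) \<le> f (Y m x)" using S_f[OF YZ[OF x] th_le[OF ne[OF x]]] by (simp add: YS)
    then show ?case using step by simp
  qed simp
  have Yodd: "Y n (- x) = - Y n x" if x: "x \<in> Z" for n x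
  proof (induction n)
    case (Suc n)
    then show ?case using S_odd[OF YZ[OF x] th_le[OF ne[OF x]]] by (simp add: YS th_odd)
  qed (simp add: Y0)
  have Yc: "continuous_on Z (Y n)" for n
  proof (induction n)
    case (Suc n)
    have "continuous_on Z (\<theta> n)"
      by (rule continuous_on_subset[OF th_c]) (use nz in auto)
    then show ?case
      unfolding YS by (intro S_c Suc) (use YZ th_le ne in auto)
  qed (simp add: Y0 continuous_on_id)
  have "\<exists>W J. open W \<and> x \<in> W \<and> (\<forall>y\<in>Z \<inter> W. \<forall>j\<ge>J. Y j y = Y J y)" if x: "x \<in> Z" for x
  proof -
    obtain W N where W: "open W" "x \<in> W" "\<And>y n. y \<in> W \<Longrightarrow> y \<noteq> 0 \<Longrightarrow> n \<ge> N \<Longrightarrow> \<theta> n y = 0"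
      using th_fin[OF ne[OF x]] by blast
    have "Y j y = Y N y" if y: "y \<in> Z" "y \<in> W" and j: "N \<le> j" for y j
      using j
    proof (induction j rule: dec_induct)
      case (step j)
      then have "\<theta> j y = 0" using W(3) y ne by blast
      then show ?case using step S_0[OF YZ[OF y(1)]] by (simp add: YS)
    qed simp
    then show ?thesis using W(1,2) by blast
  qed
  with Yc obtain R where R: "continuous_on Z R" "\<And>x. x \<in> Z \<Longrightarrow> \<exists>J. \<forall>j\<ge>J. R x = Y j x"
    using locally_stationary_limit[of Z Y] by blast
  show thesis
  proof
    show "continuous_on Z R" by (rule R)
    fix x assume x: "x \<in> Z"
    obtain J where J: "\<And>j. j \<ge> J \<Longrightarrow> R x = Y j x" using R(2)[OF x] by blast
    obtain J' where J': "\<And>j. j \<ge> J' \<Longrightarrow> R (- x) = Y j (- x)" using R(2)[OF sym[OF x]] by blast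
    show "R (- x) = - R x"
      using J[of "max J J'"] J'[of "max J J'"] Yodd[OF x] by simp
    obtain n where "\<bar>\<theta> n x\<bar> = 1" using th_1[OF ne[OF x]] by blast
    then have "f (Y (Suc n) x) \<le> a" using S_1[OF YZ[OF x]] by (simp add: YS)
    then have "f (Y (max J (Suc n)) x) \<le> a" using Yf[OF x, of "Suc n" "max J (Suc n)"] by simp
    then show "R x \<in> Z \<and> f (R x) \<le> a" using J[of "max J (Suc n)"] YZ[OF x] by simp
  qed
qed

section \<open>The path metric\<close>

lemma scalar_product_simps:
  assumes "is_scalar_product B"
  shows "B (x + y) z = B x z + B y z" "B x (y + z) = B x y + B x z"
    "B (x - y) z = B x z - B y z" "B x (y - z) = B x y - B x z"
    "B (c *\<^sub>R x) z = c * B x z" "B x (c *\<^sub>R z) = c * B x z"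
    "B (- x) z = - B x z" "B x (- z) = - B x z" "B 0 z = 0" "B x 0 = 0"
    "B x y = B y x" "B x x \<ge> 0"
proof -
  have b: "bilinear B" and pos: "\<And>v. v \<noteq> 0 \<Longrightarrow> 0 < B v v" and sym: "\<And>v w. B v w = B w v"
    using assms by (auto simp: is_scalar_product_def)
  show "B (x + y) z = B x z + B y z" "B x (y + z) = B x y + B x z"
    "B (x - y) z = B x z - B y z" "B x (y - z) = B x y - B x z"
    "B (c *\<^sub>R x) z = c * B x z" "B x (c *\<^sub>R z) = c * B x z"
    "B (- x) z = - B x z" "B x (- z) = - B x z" and z: "B 0 z = 0" "B x 0 = 0"
    using b by (auto simp: bilinear_ladd bilinear_radd bilinear_lsub bilinear_rsub bilinear_lmul
        bilinear_rmul bilinear_lneg bilinear_rneg bilinear_lzero bilinear_rzero)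
  show "B x y = B y x" by (rule sym)
  show "B x x \<ge> 0"
  proof (cases "x = 0")
    case True
    then show ?thesis using b bilinear_lzero[of B 0] by simp
  qed (use pos in \<open>simp add: less_imp_le\<close>)
qed

lemma scalar_product_Cauchy_Schwarz:
  assumes B: "is_scalar_product B"
  shows "(B v w)\<^sup>2 \<le> B v v * B w w"
proof (cases "w = 0")
  case True
  then show ?thesis by (simp add: scalar_product_simps[OF B])
next
  case False
  then have pos: "B w w > 0" using B by (simp add: is_scalar_product_def)
  define t where "t = B v w / B w w"
  have "0 \<le> B (v - t *\<^sub>R w) (v - t *\<^sub>R w)" by (rule scalar_product_simps(12)[OF B])
  also have "\<dots> = B v v - 2 * t * B v w + t * t * B w w"
    by (simp add: scalar_product_simps(3-6)[OF B] scalar_product_simps(11)[OF B, of w v] algebra_simps)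
  also have "\<dots> = B v v - (B v w)\<^sup>2 / B w w"
    using pos by (simp add: t_def power2_eq_square field_simps)
  finally show ?thesis using pos by (simp add: field_simps)
qed

definition C1_path :: "'a::real_normed_vector set \<Rightarrow> (real \<Rightarrow> 'a) \<Rightarrow> (real \<Rightarrow> 'a) \<Rightarrow> bool" where
  "C1_path M \<gamma> \<gamma>' \<longleftrightarrow>
     (\<forall>s\<in>{0..1}. \<gamma> s \<in> M \<and> (\<gamma> has_vector_derivative \<gamma>' s) (at s within {0..1})) \<and>
     continuous_on {0..1} \<gamma>'"

lemma C1_path_continuous: "C1_path M \<gamma> \<gamma>' \<Longrightarrow> continuous_on {0..1} \<gamma>"
  unfolding C1_path_def by (meson continuous_on_vector_derivative)

lemma C1_pathD:
  assumes "C1_path M \<gamma> \<gamma>'" "s \<in> {0..1}"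
  shows "\<gamma> s \<in> M" "S \<subseteq> {0..1} \<Longrightarrow> (\<gamma> has_vector_derivative \<gamma>' s) (at s within S)"
  using assms has_vector_derivative_within_subset[of \<gamma> "\<gamma>' s" s "{0..1}" S]
  by (auto simp: C1_path_def)

text \<open>Continuity is not part of being a scalar product; by Cauchy-Schwarz, comparison with the
  norm makes pairing with a fixed vector a bounded linear map, through which derivatives
  pass.\<close>

lemma has_vector_derivative_bilinear_left:
  assumes B: "is_scalar_product B" and C: "\<And>v. sqrt (B v v) \<le> C * norm v"
    and g: "(g has_vector_derivative g') (at x within S)"
  shows "((\<lambda>t. B (g t) e) has_real_derivative B g' e) (at x within S)"
proof -
  have "bounded_linear (\<lambda>v. B v e)"
  proof (rule bounded_linear_intro[where K = "C * sqrt (B e e)"])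
    fix v
    have "(B v e)\<^sup>2 \<le> (sqrt (B v v) * sqrt (B e e))\<^sup>2"
      using scalar_product_Cauchy_Schwarz[OF B, of v e] scalar_product_simps(12)[OF B]
      by (simp add: power_mult_distrib)
    then have "\<bar>B v e\<bar> \<le> \<bar>sqrt (B v v) * sqrt (B e e)\<bar>"
      by (rule abs_le_square_iff[THEN iffD2])
    then have "\<bar>B v e\<bar> \<le> sqrt (B v v) * sqrt (B e e)"
      using scalar_product_simps(12)[OF B] by simp
    also have "\<dots> \<le> (C * norm v) * sqrt (B e e)"
      by (intro mult_right_mono C) (simp add: scalar_product_simps(12)[OF B])
    finally show "norm (B v e) \<le> norm v * (C * sqrt (B e e))" by (simp add: mult_ac)
  qed (simp_all add: scalar_product_simps[OF B])
  from bounded_linear.has_vector_derivative[OF this g]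
  show ?thesis by (simp add: has_real_derivative_iff_has_vector_derivative)
qed

section \<open>The norms indexed by nonzero points\<close>

locale ip_family =
  fixes ip :: "'a::real_inner \<Rightarrow> 'a \<Rightarrow> 'a \<Rightarrow> real"
  assumes sp: "u \<noteq> 0 \<Longrightarrow> is_scalar_product (ip u)"
    and M1: "cond_M1 ip" and M2: "cond_M2 ip"
begin

abbreviation "nrm \<equiv> ip_norm ip"

lemma nrm_simps:
  assumes "u \<noteq> 0"
  shows "nrm u v \<ge> 0" "nrm u (- v) = nrm u v" "nrm u 0 = 0" "nrm u (c *\<^sub>R v) = \<bar>c\<bar> * nrm u v"
    "(nrm u v)\<^sup>2 = ip u v v" "nrm u (v - w) = nrm u (w - v)"
proof -
  note s = scalar_product_simps[OF sp[OF assms]]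
  show "nrm u v \<ge> 0" "nrm u (- v) = nrm u v" "nrm u 0 = 0" "(nrm u v)\<^sup>2 = ip u v v"
    using s(7-10,12) by (simp_all add: ip_norm_def)
  show "nrm u (c *\<^sub>R v) = \<bar>c\<bar> * nrm u v"
    using s(5,6) by (simp add: ip_norm_def real_sqrt_mult mult.assoc[symmetric])
  show "nrm u (v - w) = nrm u (w - v)"
    by (simp add: ip_norm_def s(3,4))
qed

lemma ip_le: "u \<noteq> 0 \<Longrightarrow> \<bar>ip u v w\<bar> \<le> nrm u v * nrm u w"
proof -
  assume u: "u \<noteq> 0"
  have "(ip u v w)\<^sup>2 \<le> (nrm u v * nrm u w)\<^sup>2"
    using scalar_product_Cauchy_Schwarz[OF sp[OF u], of v w]
    by (simp only: power_mult_distrib nrm_simps(5)[OF u])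
  then have "\<bar>ip u v w\<bar> \<le> \<bar>nrm u v * nrm u w\<bar>" by (rule abs_le_square_iff[THEN iffD2])
  then show ?thesis using nrm_simps(1)[OF u] by simp
qed

lemma nrm_triangle: assumes "u \<noteq> 0" shows "nrm u (v + w) \<le> nrm u v + nrm u w"
proof (rule power2_le_imp_le)
  note s = scalar_product_simps[OF sp[OF assms]]
  have "(nrm u (v + w))\<^sup>2 = (nrm u v)\<^sup>2 + 2 * ip u v w + (nrm u w)\<^sup>2"
    using assms s(1,2) s(11)[of w v] by (simp add: nrm_simps)
  also have "\<dots> \<le> (nrm u v + nrm u w)\<^sup>2"
    using ip_le[OF assms, of v w] by (simp add: power2_sum)
  finally show "(nrm u (v + w))\<^sup>2 \<le> (nrm u v + nrm u w)\<^sup>2" .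
qed (simp add: assms nrm_simps)

lemma nrm_triangle_diff: "u \<noteq> 0 \<Longrightarrow> nrm u (v - w) \<le> nrm u (v - x) + nrm u (x - w)"
  using nrm_triangle[of u "v - x" "x - w"] by simp

lemma M1_at:
  assumes "u \<noteq> 0"
  shows "\<exists>U C. open U \<and> u \<in> U \<and> 0 \<notin> U \<and> C > 0 \<and>
    (\<forall>u'\<in>U. \<forall>v. norm v \<le> C * nrm u' v \<and> nrm u' v \<le> C * norm v)"
proof -
  from M1[unfolded cond_M1_def, rule_format, OF assms]
  obtain U C where U: "open U" "u \<in> U" "0 \<notin> U" "C > 0"
    "\<And>u' v. u' \<in> U \<Longrightarrow> (1 / C) * norm v \<le> nrm u' v \<and> nrm u' v \<le> C * norm v"
    by blast
  then have "norm v \<le> C * nrm u' v" if "u' \<in> U" for u' v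
    using U(4) U(5)[OF that, of v] by (simp add: field_simps)
  with U show ?thesis by blast
qed

lemma nrm_le:
  assumes "u \<noteq> 0"
  shows "\<exists>C>0. \<forall>v. nrm u v \<le> C * norm v \<and> norm v \<le> C * nrm u v"
  using M1_at[OF assms] by blast

text \<open>A change of the index is controlled by (M2), with a factor |h|^2 that stays bounded; a
  change of the argument at fixed index is controlled by the norm comparison in (M1).\<close>

lemma tendsto_nrm:
  assumes g: "(g \<longlongrightarrow> u) F" and h: "(h \<longlongrightarrow> v) F" and u: "u \<noteq> 0"
  shows "((\<lambda>x. nrm (g x) (h x)) \<longlongrightarrow> nrm u v) F"
proof -
  from M2[unfolded cond_M2_def, rule_format, OF u]
  obtain U C where U: "open U" "u \<in> U" and C:
    "\<And>u1 u2 v w. u1 \<in> U \<Longrightarrow> u2 \<in> U \<Longrightarrow> \<bar>ip u1 v w - ip u2 v w\<bar> \<le> C * norm (u1 - u2) * norm v * norm w"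
    by blast
  have "eventually (\<lambda>x. g x \<in> U) F" using g U by (rule topological_tendstoD)
  then have "eventually (\<lambda>x. norm (ip (g x) (h x) (h x) - ip u (h x) (h x))
      \<le> C * norm (g x - u) * norm (h x) * norm (h x)) F"
    by eventually_elim (use C U in auto)
  moreover have "((\<lambda>x. C * norm (g x - u) * norm (h x) * norm (h x)) \<longlongrightarrow> C * norm (u - u) * norm v * norm v) F"
    by (intro tendsto_intros g h)
  ultimately have 1: "((\<lambda>x. ip (g x) (h x) (h x) - ip u (h x) (h x)) \<longlongrightarrow> 0) F"
    by (rule Lim_null_comparison[OF _ tendsto_eq_rhs]) simp
  obtain K where K: "\<And>v. nrm u v \<le> K * norm v" using nrm_le[OF u] by blast
  have lip: "\<bar>nrm u a - nrm u b\<bar> \<le> K * norm (a - b)" for a b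
    using nrm_triangle[OF u, of "a - b" b] nrm_triangle[OF u, of "b - a" a] K[of "a - b"]
      nrm_simps(6)[OF u, of a b] by (auto simp: abs_le_iff)
  have "((\<lambda>x. nrm u (h x) - nrm u v) \<longlongrightarrow> 0) F"
  proof (rule Lim_null_comparison)
    show "eventually (\<lambda>x. norm (nrm u (h x) - nrm u v) \<le> K * norm (h x - v)) F"
      using lip by simp
    have "((\<lambda>x. K * norm (h x - v)) \<longlongrightarrow> K * norm (v - v)) F" by (intro tendsto_intros h)
    then show "((\<lambda>x. K * norm (h x - v)) \<longlongrightarrow> 0) F" by simp
  qed
  then have "((\<lambda>x. nrm u (h x)) \<longlongrightarrow> nrm u v) F" by (simp add: LIM_zero_iff)
  then have "((\<lambda>x. (nrm u (h x))\<^sup>2) \<longlongrightarrow> (nrm u v)\<^sup>2) F" by (intro tendsto_intros)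
  then have "((\<lambda>x. ip u (h x) (h x)) \<longlongrightarrow> ip u v v) F" by (simp add: nrm_simps(5)[OF u])
  from tendsto_add[OF 1 this] have "((\<lambda>x. ip (g x) (h x) (h x)) \<longlongrightarrow> ip u v v) F" by simp
  then show ?thesis unfolding ip_norm_def by (rule tendsto_real_sqrt)
qed

lemma continuous_on_nrm:
  assumes "continuous_on A g" "continuous_on A h" "\<And>x. x \<in> A \<Longrightarrow> g x \<noteq> 0"
  shows "continuous_on A (\<lambda>x. nrm (g x) (h x))"
  unfolding continuous_on_def
proof
  fix x assume x: "x \<in> A"
  show "((\<lambda>x. nrm (g x) (h x)) \<longlongrightarrow> nrm (g x) (h x)) (at x within A)"
    using assms(1,2) x by (intro tendsto_nrm assms(3)) (auto simp: continuous_on_def)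
qed

text \<open>The scalar mean value theorem is applied to the pairing of the curve with its own
  increment e; Cauchy-Schwarz then bounds |e|^2 by L (b - a) |e|, and one factor cancels.\<close>

lemma nrm_increment_le:
  assumes u: "u \<noteq> 0" and ab: "a \<le> b"
    and g: "\<And>s. s \<in> {a..b} \<Longrightarrow> (g has_vector_derivative g' s) (at s within {a..b})"
    and L: "\<And>s. s \<in> {a..b} \<Longrightarrow> nrm u (g' s) \<le> L"
  shows "nrm u (g b - g a) \<le> L * (b - a)"
proof (cases "a = b")
  case True
  then show ?thesis using u by (simp add: nrm_simps)
next
  case False
  with ab have ab: "a < b" by simp
  define e where "e = g b - g a"
  note s = scalar_product_simps[OF sp[OF u]]
  obtain C where C: "\<And>v. nrm u v \<le> C * norm v" using nrm_le[OF u] by blast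
  have d: "((\<lambda>t. ip u (g t) e) has_real_derivative ip u (g' s) e) (at s within {a..b})" if "s \<in> {a..b}" for s
    using C by (intro has_vector_derivative_bilinear_left[OF sp[OF u] _ g[OF that], of C]) (simp add: ip_norm_def)
  have "\<exists>x\<in>{a<..<b}. ip u (g b) e - ip u (g a) e = (b - a) * ip u (g' x) e"
  proof (rule mvt_simple[OF ab, of "\<lambda>t. ip u (g t) e" "\<lambda>x h. h * ip u (g' x) e"])
    fix x assume "a \<le> x" "x \<le> b"
    then show "((\<lambda>t. ip u (g t) e) has_derivative (\<lambda>h. h * ip u (g' x) e)) (at x within {a..b})"
      using d[of x] by (simp add: has_field_derivative_def mult.commute[of _ "ip u (g' x) e"])
  qed
  then obtain x where x: "x \<in> {a<..<b}" "ip u (g b) e - ip u (g a) e = (b - a) * ip u (g' x) e" by blast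
  have "(nrm u e)\<^sup>2 = (b - a) * ip u (g' x) e"
    using x(2) s(3)[of "g b" "g a" e] by (simp add: nrm_simps(5)[OF u]) (simp add: e_def)
  also have "\<dots> \<le> (b - a) * (nrm u (g' x) * nrm u e)"
    using ip_le[OF u, of "g' x" e] ab by (intro mult_left_mono) auto
  also have "\<dots> \<le> (b - a) * (L * nrm u e)"
    using L[of x] x ab nrm_simps(1)[OF u] by (intro mult_left_mono mult_right_mono) auto
  finally have *: "nrm u e * nrm u e \<le> (L * (b - a)) * nrm u e" by (simp add: power2_eq_square mult_ac)
  show ?thesis
  proof (cases "nrm u e = 0")
    case True
    have "0 \<le> L" using L[of a] nrm_simps(1)[OF u, of "g' a"] ab by auto
    then show ?thesis using True ab by (simp add: e_def)
  next
    case False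
    then show ?thesis using * nrm_simps(1)[OF u, of e] by (simp add: e_def less_le)
  qed
qed

section \<open>Length of paths and the path distance\<close>

definition plen :: "(real \<Rightarrow> 'a) \<Rightarrow> (real \<Rightarrow> 'a) \<Rightarrow> real" where
  "plen \<gamma> \<gamma>' = integral {0..1} (\<lambda>s. nrm (\<gamma> s) (\<gamma>' s))"

lemma path_dist_eq:
  "path_dist ip M u v = Inf {ennreal (plen \<gamma> \<gamma>') | \<gamma> \<gamma>'. C1_path M \<gamma> \<gamma>' \<and> \<gamma> 0 = u \<and> \<gamma> 1 = v}"
  unfolding path_dist_def plen_def C1_path_def by (simp add: conj_assoc)

lemma path_dist_le:
  assumes "C1_path M \<gamma> \<gamma>'" "\<gamma> 0 = u" "\<gamma> 1 = v"
  shows "path_dist ip M u v \<le> ennreal (plen \<gamma> \<gamma>')"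
  unfolding path_dist_eq by (rule Inf_lower) (use assms in blast)

lemma path_dist_lessE:
  assumes "path_dist ip M u v < e"
  obtains \<gamma> \<gamma>' where "C1_path M \<gamma> \<gamma>'" "\<gamma> 0 = u" "\<gamma> 1 = v" "ennreal (plen \<gamma> \<gamma>') < e"
  using assms unfolding path_dist_eq by (auto simp: Inf_less_iff)

lemma speed_continuous:
  assumes "C1_path M \<gamma> \<gamma>'" "0 \<notin> M"
  shows "continuous_on {0..1} (\<lambda>s. nrm (\<gamma> s) (\<gamma>' s))"
proof (rule continuous_on_nrm)
  show "continuous_on {0..1} \<gamma>'" using assms by (simp add: C1_path_def)
  show "\<gamma> s \<noteq> 0" if "s \<in> {0..1}" for s using C1_pathD(1)[OF assms(1) that] assms(2) by auto
qed (rule C1_path_continuous[OF assms(1)])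

lemma plen_nonneg:
  assumes "C1_path M \<gamma> \<gamma>'" "0 \<notin> M"
  shows "plen \<gamma> \<gamma>' \<ge> 0"
  unfolding plen_def
proof (intro integral_nonneg integrable_continuous_real speed_continuous[OF assms] nrm_simps(1))
  show "\<gamma> s \<noteq> 0" if "s \<in> {0..1}" for s using C1_pathD(1)[OF assms(1) that] assms(2) by auto
qed

lemma path_dist_le_bound:
  assumes M: "0 \<notin> M" and ab: "a \<le> b"
    and g: "\<And>s. s \<in> {a..b} \<Longrightarrow> g s \<in> M \<and> (g has_vector_derivative g' s) (at s within {a..b})"
    and g'c: "continuous_on {a..b} g'"
    and L: "\<And>s. s \<in> {a..b} \<Longrightarrow> nrm (g s) (g' s) \<le> L"
  shows "path_dist ip M (g a) (g b) \<le> ennreal (L * (b - a))"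
proof -
  define p where "p t = a + t * (b - a)" for t
  have p: "p t \<in> {a..b}" if "t \<in> {0..1}" for t
    using that ab mult_left_le_one_le[of "b - a" t] by (auto simp: p_def)
  have path: "C1_path M (\<lambda>t. g (p t)) (\<lambda>t. (b - a) *\<^sub>R g' (p t))"
    unfolding C1_path_def
  proof (intro conjI ballI)
    fix t :: real assume t: "t \<in> {0..1}"
    show "g (p t) \<in> M" using g p t by blast
    have "(p has_vector_derivative (b - a)) (at t within {0..1})"
      unfolding p_def by (auto intro!: derivative_eq_intros)
    moreover have "(g has_vector_derivative g' (p t)) (at (p t) within p ` {0..1})"
      by (rule has_vector_derivative_within_subset[OF conjunct2[OF g[OF p[OF t]]]]) (use p in auto)
    ultimately show "((\<lambda>t. g (p t)) has_vector_derivative (b - a) *\<^sub>R g' (p t)) (at t within {0..1})"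
      using vector_diff_chain_within[of p "b - a" t "{0..1}" g "g' (p t)"] by (simp add: o_def)
  next
    show "continuous_on {0..1} (\<lambda>t. (b - a) *\<^sub>R g' (p t))"
    proof (intro continuous_intros continuous_on_compose2[OF g'c])
      show "continuous_on {0..1} p" unfolding p_def by (intro continuous_intros)
    qed (use p in auto)
  qed
  have "path_dist ip M (g a) (g b) \<le> ennreal (plen (\<lambda>t. g (p t)) (\<lambda>t. (b - a) *\<^sub>R g' (p t)))"
    by (rule path_dist_le[OF path]) (auto simp: p_def)
  also have "\<dots> \<le> ennreal (L * (b - a))"
  proof (rule ennreal_leI)
    have "plen (\<lambda>t. g (p t)) (\<lambda>t. (b - a) *\<^sub>R g' (p t)) \<le> integral {0..1} (\<lambda>t::real. L * (b - a))"
      unfolding plen_def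
    proof (rule integral_le)
      fix t :: real assume t: "t \<in> {0..1}"
      have "g (p t) \<noteq> 0" using g[OF p[OF t]] M by auto
      then show "nrm (g (p t)) ((b - a) *\<^sub>R g' (p t)) \<le> L * (b - a)"
        using mult_left_mono[OF L[OF p[OF t]], of "b - a"] ab
        by (simp add: nrm_simps(4) mult.commute[of L])
    qed (use speed_continuous[OF path M] in \<open>auto intro: integrable_continuous_real\<close>)
    then show "plen (\<lambda>t. g (p t)) (\<lambda>t. (b - a) *\<^sub>R g' (p t)) \<le> L * (b - a)" by simp
  qed
  finally show ?thesis .
qed

lemma path_dist_refl: "0 \<notin> M \<Longrightarrow> u \<in> M \<Longrightarrow> path_dist ip M u u = 0"
  using path_dist_le_bound[of M 0 1 "\<lambda>_. u" "\<lambda>_. 0" 0] nrm_simps(3)[of u] by (cases "u = 0") auto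

lemma path_dist_commute:
  assumes M: "0 \<notin> M"
  shows "path_dist ip M u v = path_dist ip M v u"
proof -
  have le: "path_dist ip M v u \<le> path_dist ip M u v" for u v
  proof (rule dense_ge)
    fix e assume "path_dist ip M u v < e"
    then obtain \<gamma> \<gamma>' where g: "C1_path M \<gamma> \<gamma>'" "\<gamma> 0 = u" "\<gamma> 1 = v" "ennreal (plen \<gamma> \<gamma>') < e"
      by (rule path_dist_lessE)
    let ?\<delta> = "\<lambda>s. \<gamma> (1 - s)" and ?\<delta>' = "\<lambda>s. - \<gamma>' (1 - s)"
    have path: "C1_path M ?\<delta> ?\<delta>'"
      unfolding C1_path_def
    proof (intro conjI ballI)
      fix t :: real assume t: "t \<in> {0..1}"
      then show "\<gamma> (1 - t) \<in> M" using g(1) by (auto simp: C1_path_def)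
      have "((\<lambda>t. 1 - t) has_vector_derivative - 1) (at t within {0..1})"
        by (auto intro!: derivative_eq_intros)
      moreover have "(\<lambda>t. 1 - t) ` {0..1::real} \<subseteq> {0..1}" by auto
      then have "(\<gamma> has_vector_derivative \<gamma>' (1 - t)) (at (1 - t) within (\<lambda>t. 1 - t) ` {0..1})"
        using t by (intro C1_pathD(2)[OF g(1)]) auto
      ultimately show "(?\<delta> has_vector_derivative ?\<delta>' t) (at t within {0..1})"
        using vector_diff_chain_within[of "\<lambda>t. 1 - t" "- 1" t "{0..1}" \<gamma> "\<gamma>' (1 - t)"] by (simp add: o_def)
    next
      show "continuous_on {0..1} ?\<delta>'"
      proof (rule continuous_on_minus, rule continuous_on_compose2[of "{0..1}" \<gamma>'])
        show "continuous_on {0..1} \<gamma>'" using g(1) by (simp add: C1_path_def)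
        show "continuous_on {0..1::real} (\<lambda>s. 1 - s)" by (intro continuous_intros)
      qed auto
    qed
    have ne: "\<gamma> s \<noteq> 0" if "s \<in> {0..1}" for s using C1_pathD(1)[OF g(1) that] M by auto
    have "((\<lambda>s. nrm (\<gamma> s) (\<gamma>' s)) has_integral plen \<gamma> \<gamma>') (cbox 0 1)"
      unfolding plen_def cbox_interval
      by (intro integrable_integral integrable_continuous_real speed_continuous[OF g(1) M])
    from has_integral_affinity[OF this, of "- 1" 1]
    have "((\<lambda>s. nrm (\<gamma> (1 - s)) (\<gamma>' (1 - s))) has_integral plen \<gamma> \<gamma>') {0..1}"
      by (simp add: image_affinity_atLeastAtMost)
    then have "((\<lambda>s. nrm (?\<delta> s) (?\<delta>' s)) has_integral plen \<gamma> \<gamma>') {0..1}"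
      by (rule has_integral_eq[rotated]) (use ne nrm_simps(2) in auto)
    then have "plen ?\<delta> ?\<delta>' = plen \<gamma> \<gamma>'" unfolding plen_def by (rule integral_unique)
    then show "path_dist ip M v u \<le> e"
      using path_dist_le[OF path, of v u] g by (auto intro: order_trans less_imp_le)
  qed
  show ?thesis by (rule antisym[OF le le])
qed

lemma reparametrize:
  assumes g: "C1_path M \<gamma> \<gamma>'" and M: "0 \<notin> M" and ab: "a \<le> b"
    and q: "\<And>t. t \<in> {a..b} \<Longrightarrow> q t \<in> {0..1} \<and> (q has_real_derivative q' t) (at t within {a..b}) \<and> q' t \<ge> 0"
    and q01: "q a = 0" "q b = 1"
  shows "t \<in> {a..b} \<Longrightarrow> ((\<lambda>t. \<gamma> (q t)) has_vector_derivative q' t *\<^sub>R \<gamma>' (q t)) (at t within {a..b})"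
    and "((\<lambda>t. nrm (\<gamma> (q t)) (q' t *\<^sub>R \<gamma>' (q t))) has_integral plen \<gamma> \<gamma>') {a..b}"
proof -
  show "((\<lambda>t. \<gamma> (q t)) has_vector_derivative q' t *\<^sub>R \<gamma>' (q t)) (at t within {a..b})" if t: "t \<in> {a..b}" for t
  proof -
    have "(\<gamma> has_vector_derivative \<gamma>' (q t)) (at (q t) within q ` {a..b})"
      by (rule C1_pathD(2)[OF g]) (use q t in auto)
    then show ?thesis
      using vector_diff_chain_within[of q "q' t" t "{a..b}" \<gamma> "\<gamma>' (q t)"] q[OF t]
      by (simp add: o_def has_real_derivative_iff_has_vector_derivative)
  qed
  have "((\<lambda>t. q' t *\<^sub>R nrm (\<gamma> (q t)) (\<gamma>' (q t))) has_integral
      integral {q a..q b} (\<lambda>s. nrm (\<gamma> s) (\<gamma>' s))) {a..b}"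
    by (rule has_integral_substitution[OF ab _ _ speed_continuous[OF g M]])
      (use q q01 in auto)
  then have "((\<lambda>t. q' t *\<^sub>R nrm (\<gamma> (q t)) (\<gamma>' (q t))) has_integral plen \<gamma> \<gamma>') {a..b}"
    by (simp add: q01 plen_def)
  then show "((\<lambda>t. nrm (\<gamma> (q t)) (q' t *\<^sub>R \<gamma>' (q t))) has_integral plen \<gamma> \<gamma>') {a..b}"
  proof (rule has_integral_eq[rotated])
    fix t assume t: "t \<in> {a..b}"
    have "\<gamma> (q t) \<in> M" using C1_pathD(1)[OF g] q[OF t] by blast
    then have "\<gamma> (q t) \<noteq> 0" using M by auto
    then show "q' t *\<^sub>R nrm (\<gamma> (q t)) (\<gamma>' (q t)) = nrm (\<gamma> (q t)) (q' t *\<^sub>R \<gamma>' (q t))"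
      using q[OF t] by (simp add: nrm_simps)
  qed
qed

text \<open>The two paths are run through with vanishing velocity at their common end point,
  so that their concatenation is again of class \<open>C\<^sup>1\<close>.\<close>

lemma concatenate:
  assumes g: "C1_path M \<gamma> \<gamma>'" and d: "C1_path M \<delta> \<delta>'" and M: "0 \<notin> M" and gd: "\<gamma> 1 = \<delta> 0"
  shows "\<exists>c c'. C1_path M c c' \<and> c 0 = \<gamma> 0 \<and> c 1 = \<delta> 1 \<and> plen c c' = plen \<gamma> \<gamma>' + plen \<delta> \<delta>'"
proof -
  \<comment> \<open>The cubic that runs from 0 to 1 with zero derivative at both ends.\<close>
  define p where "p t = 3 * t\<^sup>2 - 2 * t ^ 3" for t :: real
  define p' where "p' t = 6 * t * (1 - t)" for t :: real
  have p_deriv: "(p has_real_derivative p' t) (at t within S)" for t S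
    unfolding p_def p'_def
    by (auto intro!: derivative_eq_intros simp: algebra_simps power2_eq_square)
  have p01: "p t \<in> {0..1}" if "t \<in> {0..1}" for t
  proof -
    have p: "p t = t\<^sup>2 * (3 - 2 * t)" "1 - p t = (1 - t)\<^sup>2 * (1 + 2 * t)"
      by (simp_all add: p_def power2_eq_square power3_eq_cube algebra_simps)
    have "t\<^sup>2 * (3 - 2 * t) \<ge> 0" "(1 - t)\<^sup>2 * (1 + 2 * t) \<ge> 0" using that by simp_all
    then show ?thesis using p by (metis atLeastAtMost_iff diff_ge_0_iff_ge)
  qed
  have p'0: "p' t \<ge> 0" if "t \<in> {0..1}" for t using that by (simp add: p'_def)
  define q1 where "q1 t = p (2 * t)" for t
  define q2 where "q2 t = p (2 * t - 1)" for t
  define q1' where "q1' t = 2 * p' (2 * t)" for t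
  define q2' where "q2' t = 2 * p' (2 * t - 1)" for t
  have d1: "(q1 has_real_derivative q1' t) (at t within S)" for t S
    unfolding q1_def q1'_def p_def p'_def
    by (auto intro!: derivative_eq_intros simp: algebra_simps power2_eq_square)
  have d2: "(q2 has_real_derivative q2' t) (at t within S)" for t S
    unfolding q2_def q2'_def p_def p'_def
    by (auto intro!: derivative_eq_intros simp: algebra_simps power2_eq_square)
  have q1: "q1 t \<in> {0..1} \<and> (q1 has_real_derivative q1' t) (at t within {0..1/2}) \<and> q1' t \<ge> 0"
    if "t \<in> {0..1/2}" for t
    using that p01[of "2 * t"] p'0[of "2 * t"] d1 by (simp add: q1_def q1'_def)
  have q2: "q2 t \<in> {0..1} \<and> (q2 has_real_derivative q2' t) (at t within {1/2..1}) \<and> q2' t \<ge> 0"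
    if "t \<in> {1/2..1}" for t
    using that p01[of "2 * t - 1"] p'0[of "2 * t - 1"] d2 by (simp add: q2_def q2'_def)
  have ends: "q1 0 = 0" "q1 (1/2) = 1" "q2 (1/2) = 0" "q2 1 = 1" "q1' (1/2) = 0" "q2' (1/2) = 0"
    by (simp_all add: q1_def q2_def q1'_def q2'_def p_def p'_def)
  have half: "(0::real) \<le> 1/2" "(1/2::real) \<le> 1" by simp_all
  note r1 = reparametrize[OF g M half(1) q1 ends(1,2)]
  note r2 = reparametrize[OF d M half(2) q2 ends(3,4)]
  define c where "c t = (if t \<in> {0..1/2} then \<gamma> (q1 t) else \<delta> (q2 t))" for t
  define c' where "c' t = (if t \<in> {0..1/2} then q1' t *\<^sub>R \<gamma>' (q1 t) else q2' t *\<^sub>R \<delta>' (q2 t))" for t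
  have un: "{0..1/2} \<union> {1/2..1} = {0..1::real}" by auto
  have c2: "c t = \<delta> (q2 t)" "c' t = q2' t *\<^sub>R \<delta>' (q2 t)" if "t \<in> {1/2..1}" for t
  proof -
    have "c t = \<delta> (q2 t) \<and> c' t = q2' t *\<^sub>R \<delta>' (q2 t)"
    proof (cases "t = 1/2")
      case True
      then show ?thesis by (simp only: True c_def c'_def ends gd) simp
    next
      case False
      then have "t \<notin> {0..1/2}" using that by auto
      then show ?thesis by (simp only: c_def c'_def if_False)
    qed
    then show "c t = \<delta> (q2 t)" "c' t = q2' t *\<^sub>R \<delta>' (q2 t)" by blast+
  qed
  have q1c: "continuous_on {0..1/2} q1" and q2c: "continuous_on {1/2..1} q2"
    unfolding q1_def q2_def p_def by (intro continuous_intros)+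
  have "C1_path M c c'"
    unfolding C1_path_def
  proof (intro conjI ballI)
    fix t :: real assume t: "t \<in> {0..1}"
    show "c t \<in> M"
      using C1_pathD(1)[OF g, of "q1 t"] C1_pathD(1)[OF d, of "q2 t"] q1[of t] q2[of t] t
      by (auto simp: c_def)
    show "(c has_vector_derivative c' t) (at t within {0..1})"
      unfolding c_def[abs_def] c'_def
    proof (rule has_vector_derivative_If_within_closures[where S = "{0..1/2}" and T = "{1/2..1}"])
      show "((\<lambda>t. \<gamma> (q1 t)) has_vector_derivative q1' t *\<^sub>R \<gamma>' (q1 t))
          (at t within {0..1/2} \<union> closure {0..1/2} \<inter> closure {1/2..1})"
        if "t \<in> {0..1/2} \<union> closure {0..1/2} \<inter> closure {1/2..1}"
      proof -
        have "{0..1/2} \<union> closure {0..1/2} \<inter> closure {1/2..1} = {0..1/2::real}" by auto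
        then show ?thesis using r1(1)[of t] that by simp
      qed
      show "((\<lambda>t. \<delta> (q2 t)) has_vector_derivative q2' t *\<^sub>R \<delta>' (q2 t))
          (at t within {1/2..1} \<union> closure {0..1/2} \<inter> closure {1/2..1})"
        if "t \<in> {1/2..1} \<union> closure {0..1/2} \<inter> closure {1/2..1}"
      proof -
        have "{1/2..1} \<union> closure {0..1/2} \<inter> closure {1/2..1} = {1/2..1::real}" by auto
        then show ?thesis using r2(1)[of t] that by simp
      qed
      assume "t \<in> closure {0..1/2}" "t \<in> closure {1/2..1}"
      then have t: "t = 1/2" by simp
      show "\<gamma> (q1 t) = \<delta> (q2 t)" "q1' t *\<^sub>R \<gamma>' (q1 t) = q2' t *\<^sub>R \<delta>' (q2 t)"
        by (simp_all only: t ends gd scaleR_zero_left)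
    qed (use t un in auto)
  next
    have "continuous_on {0..1/2} (\<lambda>t. q1' t *\<^sub>R \<gamma>' (q1 t))"
    proof (intro continuous_on_scaleR continuous_on_compose2[of "{0..1}" \<gamma>' "{0..1/2}" q1] q1c)
      show "continuous_on {0..1/2} q1'" unfolding q1'_def p'_def by (intro continuous_intros)
      show "continuous_on {0..1} \<gamma>'" using g by (simp add: C1_path_def)
      show "q1 ` {0..1/2} \<subseteq> {0..1}" using q1 by blast
    qed
    then have "continuous_on {0..1/2} c'" by (rule continuous_on_eq) (simp add: c'_def)
    moreover have "continuous_on {1/2..1} (\<lambda>t. q2' t *\<^sub>R \<delta>' (q2 t))"
    proof (intro continuous_on_scaleR continuous_on_compose2[of "{0..1}" \<delta>' "{1/2..1}" q2] q2c)
      show "continuous_on {1/2..1} q2'" unfolding q2'_def p'_def by (intro continuous_intros)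
      show "continuous_on {0..1} \<delta>'" using d by (simp add: C1_path_def)
      show "q2 ` {1/2..1} \<subseteq> {0..1}" using q2 by blast
    qed
    then have "continuous_on {1/2..1} c'" by (rule continuous_on_eq) (simp add: c2)
    ultimately have "continuous_on ({0..1/2} \<union> {1/2..1}) c'"
      by (intro continuous_on_closed_Un) auto
    then show "continuous_on {0..1} c'" by (simp only: un)
  qed
  moreover have "((\<lambda>t. nrm (c t) (c' t)) has_integral plen \<gamma> \<gamma>' + plen \<delta> \<delta>') {0..1}"
  proof (rule has_integral_combine[OF half])
    show "((\<lambda>t. nrm (c t) (c' t)) has_integral plen \<gamma> \<gamma>') {0..1/2}"
      by (rule has_integral_eq[OF _ r1(2)]) (simp add: c_def c'_def)
    show "((\<lambda>t. nrm (c t) (c' t)) has_integral plen \<delta> \<delta>') {1/2..1}"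
      by (rule has_integral_eq[OF _ r2(2)]) (simp add: c2)
  qed
  then have "plen c c' = plen \<gamma> \<gamma>' + plen \<delta> \<delta>'"
    unfolding plen_def[of c] by (rule integral_unique)
  moreover have "c 0 = \<gamma> 0" "c 1 = \<delta> 1" using ends c2(1)[of 1] by (simp_all add: c_def)
  ultimately show ?thesis by blast
qed

lemma path_dist_triangle:
  assumes M: "0 \<notin> M"
  shows "path_dist ip M u w \<le> path_dist ip M u v + path_dist ip M v w"
proof (rule ennreal_le_epsilon)
  fix e :: real
  assume "path_dist ip M u v + path_dist ip M v w < (Orderings.top :: ennreal)" and e: "0 < e"
  then obtain a b where a: "a \<ge> 0" "path_dist ip M u v = ennreal a"
    and b: "b \<ge> 0" "path_dist ip M v w = ennreal b"
    by (cases "path_dist ip M u v"; cases "path_dist ip M v w") auto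
  have "path_dist ip M u v < ennreal (a + e / 2)" "path_dist ip M v w < ennreal (b + e / 2)"
    using a b e by (simp_all add: ennreal_less_iff)
  then obtain \<gamma> \<gamma>' \<delta> \<delta>' where g: "C1_path M \<gamma> \<gamma>'" "\<gamma> 0 = u" "\<gamma> 1 = v"
      "ennreal (plen \<gamma> \<gamma>') < ennreal (a + e / 2)"
    and d: "C1_path M \<delta> \<delta>'" "\<delta> 0 = v" "\<delta> 1 = w"
      "ennreal (plen \<delta> \<delta>') < ennreal (b + e / 2)"
    by (elim path_dist_lessE)
  obtain c c' where c: "C1_path M c c'" "c 0 = u" "c 1 = w" "plen c c' = plen \<gamma> \<gamma>' + plen \<delta> \<delta>'"
    using concatenate[OF g(1) d(1) M] g d by auto
  have "path_dist ip M u w \<le> ennreal (plen c c')" by (rule path_dist_le[OF c(1-3)])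
  also have "\<dots> \<le> ennreal (a + b + e)"
    using g(4) d(4) plen_nonneg[OF g(1) M] plen_nonneg[OF d(1) M] c(4)
    by (intro ennreal_leI) (simp add: ennreal_less_iff)
  also have "\<dots> = path_dist ip M u v + path_dist ip M v w + ennreal e"
    using a b e by (simp add: ennreal_plus)
  finally show "path_dist ip M u w \<le> path_dist ip M u v + path_dist ip M v w + ennreal e" .
qed

text \<open>The norm comparison of (M1) holds only near \<open>l\<close>, so a short path to
  \<open>l\<close> must first be shown not to leave that neighbourhood: from the last time at which
  it has distance at least r from \<open>l\<close> it would need more length than it has. Then the
  length bounds the norm of the increment.\<close>

lemma path_dist_near:
  assumes M: "0 \<notin> M" and l: "l \<in> M"
  shows "\<exists>C e. C > 0 \<and> e > 0 \<and> (\<forall>u \<epsilon>. \<epsilon> < e \<longrightarrow> path_dist ip M u l < ennreal \<epsilon> \<longrightarrow> norm (u - l) \<le> C * \<epsilon>)"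
proof -
  have "l \<noteq> 0" using M l by metis
  from M1_at[OF this] obtain U C where U: "open U" "l \<in> U" "C > 0"
    and C: "\<And>u' v. u' \<in> U \<Longrightarrow> norm v \<le> C * nrm u' v"
    by blast
  obtain r where r: "r > 0" "ball l r \<subseteq> U" using U openE by blast
  have "norm (u - l) \<le> C * \<epsilon>" if \<epsilon>: "\<epsilon> < r / (2 * C)" and d: "path_dist ip M u l < ennreal \<epsilon>" for u \<epsilon>
  proof -
    obtain \<gamma> \<gamma>' where g: "C1_path M \<gamma> \<gamma>'" "\<gamma> 0 = u" "\<gamma> 1 = l" "ennreal (plen \<gamma> \<gamma>') < ennreal \<epsilon>"
      using d by (rule path_dist_lessE)
    have len: "plen \<gamma> \<gamma>' < \<epsilon>" using g(4) plen_nonneg[OF g(1) M] by (simp add: ennreal_less_iff)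
    have gc: "continuous_on {0..1} \<gamma>" by (rule C1_path_continuous[OF g(1)])
    have bound: "norm (\<gamma> a - l) \<le> C * \<epsilon>"
      \<comment> \<open>The time \<open>a\<close> itself is left out, because at the last time
        outside the ball the point need not lie in \<open>U\<close>; a single time does not affect
        the integral.\<close>
      if a: "a \<in> {0..1}" and inU: "\<And>s. s \<in> {a<..1} \<Longrightarrow> \<gamma> s \<in> U" for a
    proof -
      define e where "e = l - \<gamma> a"
      have d: "((\<lambda>t. \<gamma> t \<bullet> e) has_vector_derivative \<gamma>' s \<bullet> e) (at s within {a..1})" if "s \<in> {a..1}" for s
      proof -
        have "(\<gamma> has_vector_derivative \<gamma>' s) (at s within {a..1})"
          using that a by (intro C1_pathD(2)[OF g(1)]) auto
        then show ?thesis by (rule bounded_linear.has_vector_derivative[OF bounded_linear_inner_left])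
      qed
      \<comment> \<open>Pairing with the increment e reduces the estimate to real integrals: |e|^2
        is at most length times C |e|.\<close>
      have "((\<lambda>s. \<gamma>' s \<bullet> e) has_integral (\<gamma> 1 \<bullet> e - \<gamma> a \<bullet> e)) {a..1}"
        by (rule fundamental_theorem_of_calculus) (use a d in auto)
      then have I: "((\<lambda>s. \<gamma>' s \<bullet> e) has_integral (norm e)\<^sup>2) {a..1}"
        using g(3) by (simp add: e_def power2_norm_eq_inner inner_diff_left)
      have sp1: "(\<lambda>s. nrm (\<gamma> s) (\<gamma>' s)) integrable_on {a..1}"
        by (rule integrable_continuous_real)
          (rule continuous_on_subset[OF speed_continuous[OF g(1) M]], use a in auto)
      have nn: "nrm (\<gamma> s) (\<gamma>' s) \<ge> 0" if "s \<in> {0..1}" for s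
      proof (rule nrm_simps)
        show "\<gamma> s \<noteq> 0" using C1_pathD(1)[OF g(1) that] M by auto
      qed
      have le: "integral {a..1} (\<lambda>s. nrm (\<gamma> s) (\<gamma>' s)) \<le> plen \<gamma> \<gamma>'"
        unfolding plen_def
        by (rule integral_subset_le)
          (use a nn sp1 integrable_continuous_real[OF speed_continuous[OF g(1) M]] in auto)
      have "(norm e)\<^sup>2 \<le> integral {a..1} (\<lambda>s. nrm (\<gamma> s) (\<gamma>' s)) * (C * norm e)"
      proof (rule has_integral_le[OF I[unfolded has_integral_Icc_iff_Ioo]])
        show "((\<lambda>s. nrm (\<gamma> s) (\<gamma>' s) * (C * norm e)) has_integral
            integral {a..1} (\<lambda>s. nrm (\<gamma> s) (\<gamma>' s)) * (C * norm e)) {a<..<1}"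
          unfolding has_integral_Icc_iff_Ioo[symmetric]
          by (intro has_integral_mult_left integrable_integral sp1)
        fix s assume s: "s \<in> {a<..<1}"
        have "\<gamma>' s \<bullet> e \<le> norm (\<gamma>' s) * norm e" by (rule norm_cauchy_schwarz)
        also have "\<dots> \<le> (C * nrm (\<gamma> s) (\<gamma>' s)) * norm e"
          by (intro mult_right_mono C inU) (use s in auto)
        finally show "\<gamma>' s \<bullet> e \<le> nrm (\<gamma> s) (\<gamma>' s) * (C * norm e)" by (simp add: mult_ac)
      qed
      also have "\<dots> \<le> \<epsilon> * (C * norm e)"
        using le len U(3) by (intro mult_right_mono) auto
      finally have "norm e * norm e \<le> (C * \<epsilon>) * norm e" by (simp add: power2_eq_square mult_ac)
      moreover have "0 \<le> \<epsilon>" using plen_nonneg[OF g(1) M] len by simp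
      ultimately have "norm e \<le> C * \<epsilon>" using U(3) by (cases "e = 0") auto
      then show ?thesis by (simp add: e_def norm_minus_commute)
    qed
    have near: "dist (\<gamma> s) l < r" if "s \<in> {0..1}" for s
    proof (rule ccontr)
      assume far: "\<not> ?thesis"
      define A where "A = {t\<in>{0..1}. r \<le> dist (\<gamma> t) l}"
      have "closed A" unfolding A_def
        by (rule continuous_on_closed_Collect_le) (intro continuous_intros gc closed_atLeastAtMost)+
      moreover have "A \<subseteq> {0..1}" "A \<noteq> {}" using far that by (auto simp: A_def)
      moreover from this have bdd: "bdd_above A" using bdd_above_mono[of "{0..1}" A] by simp
      ultimately have top: "Sup A \<in> A" by (intro closed_contains_Sup)
      have top2: "t \<le> Sup A" if "t \<in> A" for t by (rule cSup_upper[OF that bdd])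
      have "norm (\<gamma> (Sup A) - l) \<le> C * \<epsilon>"
      proof (rule bound)
        show "Sup A \<in> {0..1}" using top by (auto simp: A_def)
        show "\<gamma> t \<in> U" if t: "t \<in> {Sup A<..1}" for t
        proof -
          have "t \<notin> A" using top2[of t] t by auto
          then have "dist (\<gamma> t) l < r" using t top by (auto simp: A_def)
          then show ?thesis using r(2) by (auto simp: dist_commute)
        qed
      qed
      moreover have "r \<le> dist (\<gamma> (Sup A)) l" using top by (simp add: A_def)
      moreover have "C * \<epsilon> < r" using \<epsilon> U(3) r(1) by (simp add: field_simps)
      ultimately show False by (simp add: dist_norm)
    qed
    have "\<gamma> s \<in> U" if "s \<in> {0<..1}" for s
    proof -
      have "\<gamma> s \<in> ball l r" using near[of s] that by (simp add: dist_commute)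
      then show ?thesis using r(2) by blast
    qed
    then have "norm (\<gamma> 0 - l) \<le> C * \<epsilon>"
      by (intro bound) simp_all
    then show ?thesis using g(2) by simp
  qed
  moreover have "r / (2 * C) > 0" using U(3) r(1) by simp
  ultimately show ?thesis using U(3) by blast
qed

end

section \<open>Charts and curves\<close>

lemma C11_on_derivative:
  assumes "C11_on U f"
  obtains D where "\<And>x. x \<in> U \<Longrightarrow> (f has_derivative blinfun_apply (D x)) (at x within U)"
    "continuous_on U D"
proof -
  obtain D where D: "\<And>x. x \<in> U \<Longrightarrow> (f has_derivative blinfun_apply (D x)) (at x within U)"
    and L: "\<And>x. x \<in> U \<Longrightarrow> \<exists>e>0. \<exists>L. lipschitz_on L (ball x e \<inter> U) D"
    using assms unfolding C11_on_def by blast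
  have "continuous_on U D"
  proof (rule continuous_on_local)
    fix x assume x: "x \<in> U"
    obtain e L where "e > 0" "lipschitz_on L (ball x e \<inter> U) D" using L[OF x] by blast
    then have "continuous_on (U \<inter> ball x e) D"
      using lipschitz_on_continuous_on by (metis Int_commute)
    then show "\<exists>W. open W \<and> x \<in> W \<and> continuous_on (U \<inter> W) D"
      using \<open>e > 0\<close> by (intro exI[of _ "ball x e"]) simp
  qed
  with D show thesis by (rule that)
qed

lemma has_vector_derivative_compose_within:
  assumes "(c has_vector_derivative c') (at t within S)"
    and "(g has_derivative g') (at (c t) within T)" "c ` S \<subseteq> T"
  shows "((\<lambda>t. g (c t)) has_vector_derivative g' c') (at t within S)"
  using vector_derivative_diff_chain_within[OF assms(1) has_derivative_subset[OF assms(2,3)]]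
  by (simp add: o_def)

lemma has_vector_derivative_at_of_within:
  assumes "(c has_vector_derivative c') (at t within {a<..<b})" "t \<in> {a<..<b}"
  shows "(c has_vector_derivative c') (at t)"
  using assms at_within_open[of t "{a<..<b}"] by simp

lemma has_vector_derivative_in_closed_subspace:
  fixes F :: "'a::real_normed_vector set"
  assumes F: "subspace F" "closed F" and d: "(c has_vector_derivative w) (at t)"
    and e: "e > 0" "\<And>s. \<bar>s - t\<bar> < e \<Longrightarrow> c s \<in> F"
  shows "w \<in> F"
proof -
  have "((\<lambda>h. (1 / h) *\<^sub>R (c (t + h) - c t)) \<longlongrightarrow> w) (at 0)"
  proof -
    have "(c has_derivative (\<lambda>x. x *\<^sub>R w)) (at t)" using d by (simp add: has_vector_derivative_def)
    then have "((\<lambda>h. norm (c (t + h) - c t - h *\<^sub>R w) / norm h) \<longlongrightarrow> 0) (at 0)"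
      by (simp add: has_derivative_at)
    moreover have "norm (c (t + h) - c t - h *\<^sub>R w) / norm h = norm ((1 / h) *\<^sub>R (c (t + h) - c t) - w)"
      if "h \<noteq> 0" for h
    proof -
      have "(1 / h) *\<^sub>R (c (t + h) - c t) - w = (1 / h) *\<^sub>R (c (t + h) - c t - h *\<^sub>R w)"
        using that by (simp add: algebra_simps)
      then show ?thesis by (simp only: norm_scaleR) (simp add: divide_inverse mult.commute)
    qed
    then have "eventually (\<lambda>h. norm (c (t + h) - c t - h *\<^sub>R w) / norm h
        = norm ((1 / h) *\<^sub>R (c (t + h) - c t) - w)) (at 0)"
      by (simp add: eventually_at_filter)
    ultimately have "((\<lambda>h. norm ((1 / h) *\<^sub>R (c (t + h) - c t) - w)) \<longlongrightarrow> 0) (at 0)"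
      by (rule Lim_transform_eventually)
    then show ?thesis by (simp add: tendsto_norm_zero_iff LIM_zero_iff)
  qed
  moreover have "eventually (\<lambda>h. (1 / h) *\<^sub>R (c (t + h) - c t) \<in> F) (at 0)"
    unfolding eventually_at
  proof (intro exI[of _ e] conjI ballI impI e(1))
    fix h :: real assume "h \<noteq> 0 \<and> dist h 0 < e"
    then show "(1 / h) *\<^sub>R (c (t + h) - c t) \<in> F"
      using e by (intro subspace_scale subspace_diff F(1)) auto
  qed
  ultimately show ?thesis using F(2) by (intro Lim_in_closed_set[of F _ "at (0::real)"]) auto
qed

text \<open>The inverse of a straightening chart, restricted to a ball of the model space,
  parametrizes \<open>M\<close>. For a tangent vector, the chart sends a curve with this velocity
  into \<open>F\<close>; since \<open>F\<close> is closed, the velocity there lies in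
  \<open>F\<close>, and the inverse chart maps it back.\<close>

lemma local_parametrization:
  fixes M :: "'a::real_normed_vector set"
  assumes "C11_submanifold Y M" "u0 \<in> M"
  shows "\<exists>F x0 e r \<phi> \<psi> D. subspace F \<and> e > 0 \<and> r > 0 \<and> x0 \<in> F \<and>
    (\<forall>x\<in>F \<inter> ball x0 e. \<psi> x \<in> M \<and> (\<psi> has_derivative blinfun_apply (D x)) (at x within F \<inter> ball x0 e)) \<and>
    continuous_on (F \<inter> ball x0 e) (D :: 'a \<Rightarrow> 'a \<Rightarrow>\<^sub>L 'a) \<and>
    continuous_on (M \<inter> ball u0 r) \<phi> \<and>
    (\<forall>u\<in>M \<inter> ball u0 r. \<phi> u \<in> F \<inter> ball x0 e \<and> \<psi> (\<phi> u) = u) \<and> \<phi> u0 = x0 \<and>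
    (\<forall>v\<in>tangent_space M u0. \<exists>w\<in>F. D x0 w = v)"
proof -
  obtain U V \<phi> \<psi> F where U: "openin (top_of_set Y) U" "u0 \<in> U" and V: "openin (top_of_set Y) V"
    and hom: "homeomorphism U V \<phi> \<psi>" and C: "C11_on U \<phi>" "C11_on V \<psi>"
    and F: "subspace F" "closed F" "F \<subseteq> Y" and img: "\<phi> ` (U \<inter> M) = V \<inter> F" and MY: "M \<subseteq> Y"
    using assms unfolding C11_submanifold_def by blast
  obtain D\<phi> where D\<phi>: "\<And>x. x \<in> U \<Longrightarrow> (\<phi> has_derivative blinfun_apply (D\<phi> x)) (at x within U)"
    using C11_on_derivative[OF C(1)] by blast
  obtain D where D: "\<And>x. x \<in> V \<Longrightarrow> (\<psi> has_derivative blinfun_apply (D x)) (at x within V)"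
    and Dc: "continuous_on V D" by (rule C11_on_derivative[OF C(2)]) (rule that; assumption)
  define x0 where "x0 = \<phi> u0"
  have x0: "x0 \<in> V" "x0 \<in> F" using img U(2) assms(2) by (auto simp: x0_def)
  obtain e where e: "e > 0" "ball x0 e \<inter> Y \<subseteq> V"
    using V x0(1) unfolding openin_contains_ball by blast
  obtain r1 where r1: "r1 > 0" "ball u0 r1 \<inter> Y \<subseteq> U"
    using U unfolding openin_contains_ball by blast
  have \<phi>c: "continuous_on U \<phi>" and inv: "\<And>u. u \<in> U \<Longrightarrow> \<psi> (\<phi> u) = u"
    using hom by (auto simp: homeomorphism_def)
  obtain r2 where r2: "r2 > 0" "\<And>u. u \<in> U \<Longrightarrow> dist u u0 < r2 \<Longrightarrow> dist (\<phi> u) x0 < e"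
    using \<phi>c U(2) e(1) unfolding continuous_on_iff x0_def by blast
  define r where "r = min r1 r2"
  let ?B = "F \<inter> ball x0 e"
  have r: "r > 0" using r1 r2 by (simp add: r_def)
  have BV: "?B \<subseteq> V" using e F(3) by blast
  have MU: "M \<inter> ball u0 r \<subseteq> U" using r1 MY by (auto simp: r_def)
  have \<psi>M: "\<psi> x \<in> M" if x: "x \<in> ?B" for x
  proof -
    obtain m where "m \<in> U \<inter> M" "x = \<phi> m" using img BV x by blast
    then show ?thesis using inv by auto
  qed
  have \<phi>B: "\<phi> u \<in> ?B" if u: "u \<in> M \<inter> ball u0 r" for u
  proof -
    have "u \<in> U" using MU u by blast
    then have "\<phi> u \<in> F" "dist (\<phi> u) x0 < e"
      using img u r2(2)[of u] by (auto simp: r_def dist_commute)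
    then show ?thesis by (simp add: dist_commute)
  qed
  have D': "(\<psi> has_derivative blinfun_apply (D x)) (at x within ?B)" if "x \<in> ?B" for x
    by (rule has_derivative_subset[OF D]) (use BV that in auto)
  have "\<exists>w\<in>F. D x0 w = v" if v: "v \<in> tangent_space M u0" for v
  proof -
    obtain c \<epsilon> where c: "\<epsilon> > 0" "c 0 = u0" "\<And>t. \<bar>t\<bar> < \<epsilon> \<Longrightarrow> c t \<in> M" "(c has_vector_derivative v) (at (0::real))"
      using v unfolding tangent_space_def by blast
    have "isCont c 0" using c(4) by (rule has_vector_derivative_continuous)
    then obtain d where d: "d > 0" "\<And>t. \<bar>t\<bar> < d \<Longrightarrow> dist (c t) u0 < r"
      unfolding continuous_at_eps_delta using r c(2) by (metis diff_zero dist_real_def)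
    define \<delta> where "\<delta> = min d \<epsilon>"
    have \<delta>: "\<delta> > 0" using c d by (simp add: \<delta>_def)
    have cM: "c t \<in> M \<inter> ball u0 r" if "\<bar>t\<bar> < \<delta>" for t
      using c(3) d(2) that by (auto simp: \<delta>_def dist_commute)
    have c0: "(c has_vector_derivative v) (at 0 within {-\<delta><..<\<delta>})"
      using c(4) by (rule has_vector_derivative_at_within)
    have "((\<lambda>t. \<phi> (c t)) has_vector_derivative D\<phi> u0 v) (at 0 within {-\<delta><..<\<delta>})"
    proof (rule has_vector_derivative_compose_within[OF c0])
      show "(\<phi> has_derivative blinfun_apply (D\<phi> u0)) (at (c 0) within U)" using D\<phi>[OF U(2)] c(2) by simp
      show "c ` {-\<delta><..<\<delta>} \<subseteq> U" using cM MU by (force simp: image_subset_iff)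
    qed
    note d1 = this
    then have "((\<lambda>t. \<phi> (c t)) has_vector_derivative D\<phi> u0 v) (at 0)"
      by (rule has_vector_derivative_at_of_within) (use \<delta> in simp)
    then have wF: "D\<phi> u0 v \<in> F"
      by (rule has_vector_derivative_in_closed_subspace[OF F(1,2) _ \<delta>]) (use \<phi>B cM in auto)
    have "((\<lambda>t. \<psi> (\<phi> (c t))) has_vector_derivative D x0 (D\<phi> u0 v)) (at 0 within {-\<delta><..<\<delta>})"
    proof (rule has_vector_derivative_compose_within[OF d1])
      show "(\<psi> has_derivative blinfun_apply (D x0)) (at (\<phi> (c 0)) within ?B)"
        using D'[of x0] x0 e(1) c(2) by (simp add: x0_def)
      show "(\<lambda>t. \<phi> (c t)) ` {-\<delta><..<\<delta>} \<subseteq> ?B" using \<phi>B cM by (force simp: image_subset_iff)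
    qed
    moreover have "((\<lambda>t. \<psi> (\<phi> (c t))) has_vector_derivative v) (at 0 within {-\<delta><..<\<delta>})"
      by (rule has_vector_derivative_transform[OF _ _ c0]) (use \<delta> cM MU inv in force)+
    ultimately have "D x0 (D\<phi> u0 v) = v"
      using \<delta> has_vector_derivative_at_of_within vector_derivative_unique_at
      by (metis (no_types, lifting) greaterThanLessThan_iff neg_less_0_iff_less)
    with wF show ?thesis by blast
  qed
  moreover have "continuous_on (M \<inter> ball u0 r) \<phi>" using \<phi>c MU by (rule continuous_on_subset)
  moreover have "continuous_on ?B D" using Dc BV by (rule continuous_on_subset)
  moreover have "\<psi> (\<phi> u) = u" if "u \<in> M \<inter> ball u0 r" for u using inv MU that by blast
  ultimately show ?thesis
    using F(1) e(1) r x0(2) \<psi>M D' \<phi>B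
    by (intro exI[of _ F] exI[of _ x0] exI[of _ e] exI[of _ r] exI[of _ \<phi>] exI[of _ \<psi>] exI[of _ D])
      (simp add: x0_def)
qed

text \<open>In the chart all curves are straight lines with one common direction, the coordinate
  vector of \<open>v0\<close>. Thus a single tangent vector yields curves from all nearby points,
  with velocities jointly continuous in point and time.\<close>

lemma curves_through_tangent_vector:
  fixes M :: "'a::real_normed_vector set"
  assumes M: "C11_submanifold Y M" "u0 \<in> M" and v: "v0 \<in> tangent_space M u0"
  shows "\<exists>r>0. \<exists>\<tau>>0. \<exists>H W.
    (\<forall>u\<in>M \<inter> ball u0 r. H u 0 = u \<and> (\<forall>t\<in>{-\<tau>..\<tau>}. H u t \<in> M \<and>
        (H u has_vector_derivative W u t) (at t within {-\<tau>..\<tau>}))) \<and>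
    continuous_on ((M \<inter> ball u0 r) \<times> {-\<tau>..\<tau>}) (\<lambda>(u, t). H u t) \<and>
    continuous_on ((M \<inter> ball u0 r) \<times> {-\<tau>..\<tau>}) (\<lambda>(u, t). W u t :: 'a) \<and> W u0 0 = v0"
proof -
  obtain F x0 e r \<phi> \<psi> and D :: "'a \<Rightarrow> 'a \<Rightarrow>\<^sub>L 'a" where F: "subspace F" and e: "e > 0" and r: "r > 0" and x0: "x0 \<in> F"
    and \<psi>: "\<And>x. x \<in> F \<inter> ball x0 e \<Longrightarrow> \<psi> x \<in> M \<and> (\<psi> has_derivative blinfun_apply (D x)) (at x within F \<inter> ball x0 e)"
    and Dc: "continuous_on (F \<inter> ball x0 e) D" and \<phi>c: "continuous_on (M \<inter> ball u0 r) \<phi>"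
    and \<phi>: "\<And>u. u \<in> M \<inter> ball u0 r \<Longrightarrow> \<phi> u \<in> F \<inter> ball x0 e \<and> \<psi> (\<phi> u) = u" and \<phi>0: "\<phi> u0 = x0"
    and T: "\<And>v. v \<in> tangent_space M u0 \<Longrightarrow> \<exists>w\<in>F. D x0 w = v"
    using local_parametrization[OF M] by (elim exE conjE) blast
  obtain w where w: "w \<in> F" "D x0 w = v0" using T[OF v] by blast
  have "u0 \<in> M \<inter> ball u0 r" using M r by simp
  then obtain d where d: "d > 0" "\<And>u. u \<in> M \<inter> ball u0 r \<Longrightarrow> dist u u0 < d \<Longrightarrow> dist (\<phi> u) x0 < e / 2"
    using \<phi>c e \<phi>0 unfolding continuous_on_iff by (metis half_gt_zero)
  define r' where "r' = min r d"
  \<comment> \<open>Half of the radius e is left for the motion and half for the starting point;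
    adding 1 to the norm covers a vanishing direction.\<close>
  define \<tau> where "\<tau> = e / (2 * (norm w + 1))"
  have nw: "norm w + 1 > 0" by (smt (verit) norm_ge_zero)
  have \<tau>w: "\<tau> * (norm w + 1) = e / 2" using nw by (simp add: \<tau>_def del: distrib_left_numeral)
  have r': "r' > 0" and \<tau>: "\<tau> > 0" using r d e nw by (auto simp: r'_def \<tau>_def)
  define p where "p u t = \<phi> u + t *\<^sub>R w" for u and t :: real
  have pB: "p u t \<in> F \<inter> ball x0 e" if u: "u \<in> M \<inter> ball u0 r'" and t: "t \<in> {-\<tau>..\<tau>}" for u t
  proof -
    have u': "u \<in> M \<inter> ball u0 r" "dist u u0 < d" using u by (auto simp: r'_def dist_commute)
    have "\<bar>t\<bar> * norm w \<le> \<tau> * norm w" using t by (intro mult_right_mono) auto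
    also have "\<dots> \<le> \<tau> * (norm w + 1)" using \<tau> by simp
    also have "\<dots> = e / 2" by (rule \<tau>w)
    finally have "norm (t *\<^sub>R w) \<le> e / 2" by simp
    moreover have "norm (\<phi> u - x0) < e / 2" using d(2)[OF u'] by (simp add: dist_norm)
    ultimately have "norm ((\<phi> u - x0) + t *\<^sub>R w) < e"
      using norm_triangle_ineq[of "\<phi> u - x0" "t *\<^sub>R w"] by simp
    then have "dist x0 (p u t) < e" by (simp add: p_def dist_norm norm_minus_commute algebra_simps)
    moreover have "p u t \<in> F"
      unfolding p_def using \<phi>[OF u'(1)] w(1) F by (intro subspace_add subspace_scale) auto
    ultimately show ?thesis by simp
  qed
  have \<psi>c: "continuous_on (F \<inter> ball x0 e) \<psi>"
    by (rule has_derivative_continuous_on) (use \<psi> in blast)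
  have sub: "M \<inter> ball u0 r' \<subseteq> M \<inter> ball u0 r" by (auto simp: r'_def)
  let ?S = "(M \<inter> ball u0 r') \<times> {-\<tau>..\<tau>}"
  have pc: "continuous_on ?S (\<lambda>z. p (fst z) (snd z))"
    unfolding p_def
    by (intro continuous_intros continuous_on_compose2[OF \<phi>c]) (use sub in auto)
  have pS: "(\<lambda>z. p (fst z) (snd z)) ` ?S \<subseteq> F \<inter> ball x0 e" using pB by (auto simp: image_subset_iff)
  show ?thesis
  proof (rule exI[of _ r'], rule conjI[OF r'], rule exI[of _ \<tau>], rule conjI[OF \<tau>],
      rule exI[of _ "\<lambda>u t. \<psi> (p u t)"], rule exI[of _ "\<lambda>u t. D (p u t) w"], intro conjI ballI)
    fix u assume u: "u \<in> M \<inter> ball u0 r'"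
    show "\<psi> (p u 0) = u" using \<phi> u sub by (auto simp: p_def)
    fix t assume t: "t \<in> {-\<tau>..\<tau>}"
    show "\<psi> (p u t) \<in> M" using \<psi> pB[OF u t] by blast
    show "((\<lambda>t. \<psi> (p u t)) has_vector_derivative D (p u t) w) (at t within {-\<tau>..\<tau>})"
    proof (rule has_vector_derivative_compose_within[where c = "p u" and g = \<psi> and g' = "blinfun_apply (D (p u t))"])
      show "(p u has_vector_derivative w) (at t within {-\<tau>..\<tau>})"
        unfolding p_def by (auto intro!: derivative_eq_intros)
      show "(\<psi> has_derivative blinfun_apply (D (p u t))) (at (p u t) within F \<inter> ball x0 e)"
        using \<psi> pB[OF u t] by blast
      show "p u ` {-\<tau>..\<tau>} \<subseteq> F \<inter> ball x0 e" using pB[OF u] by blast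
    qed
  next
    show "continuous_on ?S (\<lambda>(u, t). \<psi> (p u t))"
      using continuous_on_compose2[OF \<psi>c pc pS] by (simp add: case_prod_beta)
    have "continuous_on ?S (\<lambda>z. blinfun_apply (D (p (fst z) (snd z))) w)"
      by (intro continuous_intros continuous_on_compose2[OF Dc pc pS])
    then show "continuous_on ?S (\<lambda>(u, t). D (p u t) w)" by (simp add: case_prod_beta)
    show "D (p u0 0) w = v0" using w by (simp add: p_def \<phi>0)
  qed
qed

text \<open>The direction opposite to \<open>path_dist_near\<close>: the straight segment in the
  chart from \<open>\<phi> u\<close> to the base point becomes a path in \<open>M\<close> whose
  speed is a constant times the length of the segment.\<close>

lemma (in ip_family) path_dist_to_base:
  assumes M: "C11_submanifold Y M" "u0 \<in> M" and nz: "0 \<notin> M" and \<eta>: "\<eta> > 0"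
  shows "\<exists>r>0. \<forall>u\<in>M \<inter> ball u0 r. path_dist ip M u u0 \<le> ennreal \<eta>"
proof -
  obtain F x0 e r \<phi> \<psi> and D :: "'a \<Rightarrow> 'a \<Rightarrow>\<^sub>L 'a" where F: "subspace F" and e: "e > 0" and r: "r > 0" and x0: "x0 \<in> F"
    and \<psi>: "\<And>x. x \<in> F \<inter> ball x0 e \<Longrightarrow> \<psi> x \<in> M \<and> (\<psi> has_derivative blinfun_apply (D x)) (at x within F \<inter> ball x0 e)"
    and Dc: "continuous_on (F \<inter> ball x0 e) D" and \<phi>c: "continuous_on (M \<inter> ball u0 r) \<phi>"
    and \<phi>: "\<And>u. u \<in> M \<inter> ball u0 r \<Longrightarrow> \<phi> u \<in> F \<inter> ball x0 e \<and> \<psi> (\<phi> u) = u" and \<phi>0: "\<phi> u0 = x0"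
    using local_parametrization[OF M] by (elim exE conjE) blast
  have u0: "u0 \<in> M \<inter> ball u0 r" using M r by simp
  have "u0 \<noteq> 0" using M nz by auto
  then obtain U C where U: "open U" "u0 \<in> U" "C > 0" and C: "\<And>u' v. u' \<in> U \<Longrightarrow> nrm u' v \<le> C * norm v"
    using M1_at[of u0] by blast
  obtain s where s: "s > 0" "ball u0 s \<subseteq> U" using U openE by blast
  have \<psi>c: "continuous_on (F \<inter> ball x0 e) \<psi>"
    by (rule has_derivative_continuous_on) (use \<psi> in blast)
  have x0B: "x0 \<in> F \<inter> ball x0 e" using x0 e by simp
  have \<psi>0: "\<psi> x0 = u0" using \<phi>[OF u0] \<phi>0 by simp
  obtain d1 where d1: "d1 > 0" "\<And>x. x \<in> F \<inter> ball x0 e \<Longrightarrow> dist x x0 < d1 \<Longrightarrow> dist (\<psi> x) u0 < s"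
    using \<psi>c x0B s(1) \<psi>0 unfolding continuous_on_iff by metis
  obtain d2 where d2: "d2 > 0" "\<And>x. x \<in> F \<inter> ball x0 e \<Longrightarrow> dist x x0 < d2 \<Longrightarrow> dist (D x) (D x0) < 1"
    using Dc x0B zero_less_one unfolding continuous_on_iff by metis
  \<comment> \<open>This bounds the ratio of speed in \<open>M\<close> to length of the segment:
    \<open>C\<close> from (M1), and one more than the norm of the derivative at the base point as a
    bound for nearby derivatives.\<close>
  define K where "K = C * (norm (D x0) + 1)"
  have K: "K > 0" using U(3) by (simp add: K_def add_nonneg_pos)
  define d3 where "d3 = min (min d1 d2) (\<eta> / K)"
  have "d3 > 0" using d1 d2 \<eta> K by (simp add: d3_def)
  then obtain d where d: "d > 0" "\<And>u. u \<in> M \<inter> ball u0 r \<Longrightarrow> dist u u0 < d \<Longrightarrow> dist (\<phi> u) x0 < d3"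
    using \<phi>c u0 \<phi>0 unfolding continuous_on_iff by metis
  have "path_dist ip M u u0 \<le> ennreal \<eta>" if u: "u \<in> M \<inter> ball u0 (min r d)" for u
  proof -
    define w where "w = x0 - \<phi> u"
    define p where "p t = \<phi> u + t *\<^sub>R w" for t :: real
    have ub: "u \<in> M \<inter> ball u0 r" "dist u u0 < d" using u by (auto simp: dist_commute)
    have nw: "norm w < d3" using d(2)[OF ub] by (simp add: w_def dist_norm norm_minus_commute)
    have pt: "p t \<in> F \<inter> ball x0 e" "dist (p t) x0 < d3" if t: "t \<in> {0..1}" for t
    proof -
      have eq: "p t - x0 = (1 - t) *\<^sub>R (\<phi> u - x0)" by (simp add: p_def w_def algebra_simps)
      have "norm (p t - x0) \<le> norm (\<phi> u - x0)"
        unfolding eq norm_scaleR using t by (intro mult_left_le_one_le) auto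
      then have "norm (p t - x0) \<le> norm w" "norm (p t - x0) < e"
        using \<phi>[OF ub(1)] by (auto simp: w_def dist_norm norm_minus_commute)
      moreover have "p t \<in> F"
        unfolding p_def w_def using \<phi>[OF ub(1)] x0 F by (intro subspace_add subspace_scale subspace_diff) auto
      ultimately show "p t \<in> F \<inter> ball x0 e" "dist (p t) x0 < d3"
        using nw by (auto simp: dist_norm norm_minus_commute)
    qed
    have "path_dist ip M (\<psi> (p 0)) (\<psi> (p 1)) \<le> ennreal (\<eta> * (1 - 0))"
    proof (rule path_dist_le_bound[where g' = "\<lambda>t. D (p t) w", OF nz])
      fix t :: real assume t: "t \<in> {0..1}"
      have "((\<lambda>t. \<psi> (p t)) has_vector_derivative D (p t) w) (at t within {0..1})"
      proof (rule has_vector_derivative_compose_within[where c = p and g = \<psi> and g' = "blinfun_apply (D (p t))"])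
        show "(p has_vector_derivative w) (at t within {0..1})"
          unfolding p_def by (auto intro!: derivative_eq_intros)
        show "(\<psi> has_derivative blinfun_apply (D (p t))) (at (p t) within F \<inter> ball x0 e)"
          using \<psi> pt[OF t] by blast
        show "p ` {0..1} \<subseteq> F \<inter> ball x0 e" using pt by blast
      qed
      then show "\<psi> (p t) \<in> M \<and> ((\<lambda>t. \<psi> (p t)) has_vector_derivative D (p t) w) (at t within {0..1})"
        using \<psi> pt[OF t] by blast
    next
      fix t :: real assume t: "t \<in> {0..1}"
      have "dist (\<psi> (p t)) u0 < s" using d1(2) pt[OF t] by (simp add: d3_def)
      then have "\<psi> (p t) \<in> U" using s(2) by (auto simp: dist_commute)
      then have "nrm (\<psi> (p t)) (D (p t) w) \<le> C * norm (D (p t) w)" by (rule C)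
      also have "\<dots> \<le> C * (norm (D (p t)) * norm w)"
        using U(3) by (intro mult_left_mono norm_blinfun) auto
      also have "\<dots> \<le> C * ((norm (D x0) + 1) * (\<eta> / K))"
      proof (intro mult_left_mono mult_mono)
        have "dist (D (p t)) (D x0) < 1" using d2(2) pt[OF t] by (simp add: d3_def)
        then show "norm (D (p t)) \<le> norm (D x0) + 1"
          using norm_triangle_ineq2[of "D (p t)" "D x0"] by (simp add: dist_norm)
        show "norm w \<le> \<eta> / K" using nw by (simp add: d3_def)
      qed (use U(3) \<eta> K in auto)
      also have "\<dots> = K * (\<eta> / K)" by (simp add: K_def)
      also have "\<dots> = \<eta>" using K by simp
      finally show "nrm (\<psi> (p t)) (D (p t) w) \<le> \<eta>" .
    next
      have pc: "continuous_on {0..1} p" unfolding p_def by (intro continuous_intros)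
      show "continuous_on {0..1} (\<lambda>t. D (p t) w)"
        by (intro continuous_intros continuous_on_compose2[OF Dc pc]) (use pt in blast)
    qed simp
    then show ?thesis using \<phi>[OF ub(1)] \<psi>0 by (simp add: p_def w_def)
  qed
  then show ?thesis using r d(1) by (intro exI[of _ "min r d"]) simp
qed

section \<open>Derivative, slope and local descent\<close>

lemma tangent_space_scale:
  assumes "v \<in> tangent_space M u"
  shows "a *\<^sub>R v \<in> tangent_space M u"
proof -
  obtain c \<epsilon> where c: "\<epsilon> > 0" "c 0 = u" "\<And>t. \<bar>t\<bar> < \<epsilon> \<Longrightarrow> c t \<in> M" "(c has_vector_derivative v) (at (0::real))"
    using assms unfolding tangent_space_def by blast
  have "((\<lambda>t. a * t) has_vector_derivative a) (at 0)" by (auto intro!: derivative_eq_intros)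
  moreover have "(c has_vector_derivative v) (at (a * 0))" using c(4) by simp
  ultimately have "((\<lambda>t. c (a * t)) has_vector_derivative a *\<^sub>R v) (at 0)"
    using vector_diff_chain_at[of "\<lambda>t. a * t" a 0 c v] by (simp add: o_def)
  moreover have "c (a * t) \<in> M" if "\<bar>t\<bar> < \<epsilon> / (\<bar>a\<bar> + 1)" for t
  proof (rule c(3))
    have "\<bar>a * t\<bar> \<le> (\<bar>a\<bar> + 1) * \<bar>t\<bar>" by (simp add: abs_mult distrib_right)
    also have "\<dots> < \<epsilon>" using that by (simp add: field_simps)
    finally show "\<bar>a * t\<bar> < \<epsilon>" .
  qed
  moreover have "\<epsilon> / (\<bar>a\<bar> + 1) > 0" using c(1) by simp
  ultimately show ?thesis
    unfolding tangent_space_def using c(2)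
    by (intro CollectI exI[of _ "\<lambda>t. c (a * t)"] exI[of _ "\<epsilon> / (\<bar>a\<bar> + 1)"]) auto
qed

lemma C11_function_local:
  fixes \<Phi> :: "'a::real_normed_vector \<Rightarrow> real"
  assumes "C11_function M \<Phi>" "u0 \<in> M"
  shows "\<exists>r>0. \<exists>f D. continuous_on (ball u0 r) D \<and>
    (\<forall>x\<in>ball u0 r. (f has_derivative blinfun_apply (D x)) (at x)) \<and> (\<forall>x\<in>ball u0 r \<inter> M. f x = \<Phi> x)"
proof -
  obtain U f where U: "open U" "u0 \<in> U" and f: "C11_on U f" "\<And>x. x \<in> U \<inter> M \<Longrightarrow> f x = \<Phi> x"
    using bspec[OF assms(1)[unfolded C11_function_def] assms(2)] by (elim exE conjE) blast
  obtain r where r: "r > 0" "ball u0 r \<subseteq> U" using U openE by blast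
  obtain D where D: "\<And>x. x \<in> U \<Longrightarrow> (f has_derivative blinfun_apply (D x)) (at x within U)"
    "continuous_on U D" by (rule C11_on_derivative[OF f(1)]) (rule that; assumption)
  have "(f has_derivative blinfun_apply (D x)) (at x)" if "x \<in> ball u0 r" for x
    using D(1)[of x] at_within_open[of x U] U r that by auto
  moreover have "continuous_on (ball u0 r) D" using D(2) r(2) by (rule continuous_on_subset)
  ultimately show ?thesis using f(2) r by blast
qed

locale ip_manifold = ip_family ip for ip :: "'a::real_inner \<Rightarrow> 'a \<Rightarrow> 'a \<Rightarrow> real" +
  fixes Y M M0 :: "'a set" and \<Phi> :: "'a \<Rightarrow> real"
  assumes nz: "0 \<notin> M0" and sub: "M0 \<subseteq> M" and C11: "C11_function M \<Phi>"
    and submanifold: "C11_submanifold Y M0"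
begin

lemma ne0: "u \<in> M0 \<Longrightarrow> u \<noteq> 0" using nz by auto

text \<open>A derivative within \<open>M0\<close> need not be unique, so \<open>mderiv\<close> is
  only some choice among them. A local extension of \<open>\<Phi>\<close> shows that one exists, and
  along curves in \<open>M0\<close> its value is then forced.\<close>

lemma mderiv_has_derivative:
  assumes u: "u \<in> M0"
  shows "(\<Phi> has_derivative mderiv M0 \<Phi> u) (at u within M0)"
proof -
  have "u \<in> M" using u sub by blast
  then obtain r f D where r: "r > 0"
    "\<And>x. x \<in> ball u r \<Longrightarrow> (f has_derivative blinfun_apply (D x)) (at x)"
    "\<And>x. x \<in> ball u r \<inter> M \<Longrightarrow> f x = \<Phi> x"
    using C11_function_local[OF C11 \<open>u \<in> M\<close>] by (elim exE conjE) blast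
  have "(f has_derivative blinfun_apply (D u)) (at u within M0)"
    using r(1) r(2)[of u] by (simp add: has_derivative_at_withinI)
  then have "(\<Phi> has_derivative blinfun_apply (D u)) (at u within M0)"
    by (rule has_derivative_transform_within[OF _ r(1) u]) (use r(3) sub in \<open>auto simp: dist_commute\<close>)
  then have "\<Phi> differentiable (at u within M0)" by (auto simp: differentiable_def)
  then show ?thesis unfolding mderiv_def by (simp add: frechet_derivative_works)
qed

lemma mderiv_linear: "u \<in> M0 \<Longrightarrow> linear (mderiv M0 \<Phi> u)"
  using mderiv_has_derivative has_derivative_linear by blast

lemma \<Phi>_continuous: "continuous_on M0 \<Phi>"
  by (rule has_derivative_continuous_on) (rule mderiv_has_derivative)

lemma mderiv_curve:
  assumes u: "c 0 = u" and c: "(c has_vector_derivative v) (at 0)"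
    and \<epsilon>: "\<epsilon> > 0" "\<And>t. \<bar>t\<bar> < \<epsilon> \<Longrightarrow> c t \<in> M0"
  shows "((\<lambda>t. \<Phi> (c t)) has_real_derivative mderiv M0 \<Phi> u v) (at 0)"
proof -
  have "u \<in> M0" using u \<epsilon>(1) \<epsilon>(2)[of 0] by simp
  have "((\<lambda>t. \<Phi> (c t)) has_vector_derivative mderiv M0 \<Phi> u v) (at 0 within {-\<epsilon><..<\<epsilon>})"
  proof (rule has_vector_derivative_compose_within[where T = M0])
    show "(c has_vector_derivative v) (at 0 within {-\<epsilon><..<\<epsilon>})"
      using c by (rule has_vector_derivative_at_within)
    show "(\<Phi> has_derivative mderiv M0 \<Phi> u) (at (c 0) within M0)"
      using mderiv_has_derivative[OF \<open>u \<in> M0\<close>] u by simp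
    show "c ` {-\<epsilon><..<\<epsilon>} \<subseteq> M0" using \<epsilon> by (auto intro!: \<epsilon>(2))
  qed
  then have "((\<lambda>t. \<Phi> (c t)) has_vector_derivative mderiv M0 \<Phi> u v) (at 0)"
    by (rule has_vector_derivative_at_of_within) (use \<epsilon> in simp)
  then show ?thesis by (simp add: has_real_derivative_iff_has_vector_derivative)
qed

text \<open>Speed at most 1 and slope below \<open>- \<eta>\<close> hold at the base point. By
  continuity, speed at most 2 and slope below the same \<open>- \<eta>\<close> persist along the
  curves of the chart, and integration gives the estimates. The last clause serves to show that
  slopes stay away from 0 near a noncritical point.\<close>

lemma local_descent:
  assumes u0: "u0 \<in> M0" and v0: "v0 \<in> tangent_space M0 u0" "nrm u0 v0 \<le> 1"
    and \<eta>: "mderiv M0 \<Phi> u0 v0 < - \<eta>"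
  shows "\<exists>r>0. \<exists>\<tau>>0. \<exists>H.
    continuous_on ((M0 \<inter> ball u0 r) \<times> {0..\<tau>}) (\<lambda>(u, t). H u t) \<and>
    (\<forall>u\<in>M0 \<inter> ball u0 r. H u 0 = u \<and>
      (\<forall>t\<in>{0..\<tau>}. H u t \<in> M0 \<and> path_dist ip M0 u (H u t) \<le> ennreal (2 * t) \<and>
        \<Phi> (H u t) \<le> \<Phi> u - \<eta> * t \<and> nrm (H u t) (H u t - u) \<le> 2 * t) \<and>
      (\<exists>w\<in>tangent_space M0 u. nrm u w \<le> 2 \<and> mderiv M0 \<Phi> u w \<le> - \<eta>))"
proof -
  obtain r1 \<tau>1 H W where r1: "r1 > 0" and \<tau>1: "\<tau>1 > (0::real)"
    and H: "\<And>u. u \<in> M0 \<inter> ball u0 r1 \<Longrightarrow> H u 0 = u \<and> (\<forall>t\<in>{-\<tau>1..\<tau>1}. H u t \<in> M0 \<and>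
        (H u has_vector_derivative W u t) (at t within {-\<tau>1..\<tau>1}))"
    and Hc: "continuous_on ((M0 \<inter> ball u0 r1) \<times> {-\<tau>1..\<tau>1}) (\<lambda>(u, t). H u t)"
    and Wc: "continuous_on ((M0 \<inter> ball u0 r1) \<times> {-\<tau>1..\<tau>1}) (\<lambda>(u, t). W u t :: 'a)"
    and W0: "W u0 0 = v0"
    using curves_through_tangent_vector[OF submanifold u0 v0(1)] by (elim exE conjE) blast
  have "u0 \<in> M" using u0 sub by blast
  then obtain r2 f D where r2: "r2 > 0" "continuous_on (ball u0 r2) D"
    and f: "\<And>x. x \<in> ball u0 r2 \<Longrightarrow> (f has_derivative blinfun_apply (D x)) (at x)"
      "\<And>x. x \<in> ball u0 r2 \<inter> M \<Longrightarrow> f x = \<Phi> x"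
    using C11_function_local[OF C11 \<open>u0 \<in> M\<close>] by (elim exE conjE) blast
  \<comment> \<open>The extension and \<open>\<Phi>\<close> agree along curves in \<open>M0\<close>,
    so the chosen derivative equals the continuous derivative of the extension on their
    velocities.\<close>
  have curve: "mderiv M0 \<Phi> u w = D u w"
    if u: "u \<in> M0" "u \<in> ball u0 r2" and c: "c 0 = u" "(c has_vector_derivative w) (at 0)"
      "\<epsilon> > 0" "\<And>t. \<bar>t\<bar> < \<epsilon> \<Longrightarrow> c t \<in> M0" for u w c \<epsilon>
  proof -
    have "((\<lambda>t. f (c t)) has_vector_derivative D u w) (at 0)"
      using has_vector_derivative_compose_within[of c w 0 UNIV f "blinfun_apply (D u)" UNIV] c f(1)[OF u(2)] by simp
    then have d: "((\<lambda>t. f (c t)) has_real_derivative D u w) (at 0)"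
      by (simp add: has_real_derivative_iff_has_vector_derivative)
    have "isCont c 0" using c(2) by (rule has_vector_derivative_continuous)
    then have "eventually (\<lambda>t. c t \<in> ball u0 r2) (nhds 0)"
    proof -
      have "(c \<longlongrightarrow> c 0) (nhds 0)"
        using \<open>isCont c 0\<close> by (simp only: continuous_at tendsto_at_iff_tendsto_nhds)
      then show ?thesis using u(2) c(1) by (intro topological_tendstoD) auto
    qed
    moreover have "eventually (\<lambda>t. c t \<in> M0) (nhds 0)"
      unfolding eventually_nhds_metric using c(3,4) by (intro exI[of _ \<epsilon>]) (auto simp: dist_real_def)
    ultimately have ev: "eventually (\<lambda>t. f (c t) = \<Phi> (c t)) (nhds 0)"
      by eventually_elim (use f(2) sub in blast)
    then have "((\<lambda>t. \<Phi> (c t)) has_real_derivative D u w) (at 0)"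
      using d DERIV_cong_ev[OF refl ev refl] by simp
    with mderiv_curve[OF c] show ?thesis by (rule DERIV_unique)
  qed
  have u0B: "u0 \<in> ball u0 r2" "u0 \<in> M0 \<inter> ball u0 r1" using r2 r1 u0 by auto
  have curve_u: "mderiv M0 \<Phi> u (W u 0) = D u (W u 0) \<and> W u 0 \<in> tangent_space M0 u"
    if u: "u \<in> M0 \<inter> ball u0 r1" "u \<in> ball u0 r2" for u
  proof
    have "(H u has_vector_derivative W u 0) (at 0 within {-\<tau>1<..<\<tau>1})"
    proof (rule has_vector_derivative_within_subset)
      show "(H u has_vector_derivative W u 0) (at 0 within {-\<tau>1..\<tau>1})"
        using H[OF u(1)] \<tau>1 by simp
    qed auto
    then have d: "(H u has_vector_derivative W u 0) (at 0)"
      by (rule has_vector_derivative_at_of_within) (use \<tau>1 in simp)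
    have in_M: "H u t \<in> M0" if "\<bar>t\<bar> < \<tau>1" for t
    proof -
      have "t \<in> {-\<tau>1..\<tau>1}" using that by auto
      then show ?thesis using H[OF u(1)] by blast
    qed
    show "mderiv M0 \<Phi> u (W u 0) = D u (W u 0)"
      by (rule curve[of u "H u" "W u 0" \<tau>1]) (use u H[OF u(1)] d in_M \<tau>1 in blast)+
    show "W u 0 \<in> tangent_space M0 u"
      unfolding tangent_space_def
      by (intro CollectI exI[of _ "H u"] exI[of _ \<tau>1]) (use d in_M \<tau>1 H[OF u(1)] in blast)
  qed
  have D0: "D u0 v0 < - \<eta>" using curve_u[OF u0B(2,1)] W0 \<eta> by simp
  have "eventually (\<lambda>z. nrm (fst z) (snd z) < 2) (nhds (u0, v0))"
  proof (rule order_tendstoD(2))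
    show "((\<lambda>z. nrm (fst z) (snd z)) \<longlongrightarrow> nrm u0 v0) (nhds (u0, v0))"
      using ne0[OF u0] tendsto_fst[OF filterlim_ident, of "(u0, v0)"] tendsto_snd[OF filterlim_ident, of "(u0, v0)"]
      by (intro tendsto_nrm) auto
  qed (use v0(2) in simp)
  moreover have "eventually (\<lambda>z. blinfun_apply (D (fst z)) (snd z) < - \<eta>) (nhds (u0, v0))"
  proof (rule order_tendstoD(2)[OF _ D0])
    have "isCont D u0" using r2 u0B(1) by (simp add: continuous_on_eq_continuous_at)
    then have "(D \<longlongrightarrow> D u0) (nhds u0)" by (simp only: continuous_at tendsto_at_iff_tendsto_nhds)
    moreover have "filterlim fst (nhds u0) (nhds (u0, v0))"
      using tendsto_fst[OF filterlim_ident, of "(u0, v0)"] by simp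
    ultimately have "((\<lambda>z. D (fst z)) \<longlongrightarrow> D u0) (nhds (u0, v0))" by (rule filterlim_compose)
    moreover have "(snd \<longlongrightarrow> v0) (nhds (u0, v0))"
      using tendsto_snd[OF filterlim_ident, of "(u0, v0)"] by simp
    ultimately show "((\<lambda>z. blinfun_apply (D (fst z)) (snd z)) \<longlongrightarrow> D u0 v0) (nhds (u0, v0))"
      by (rule blinfun.tendsto)
  qed
  moreover have "eventually (\<lambda>z. fst z \<in> ball u0 r2) (nhds (u0, v0))"
    using tendsto_fst[OF filterlim_ident, of "(u0, v0)"] u0B(1) by (intro topological_tendstoD) auto
  ultimately have "eventually (\<lambda>z. nrm (fst z) (snd z) < 2 \<and> blinfun_apply (D (fst z)) (snd z) < - \<eta> \<and> fst z \<in> ball u0 r2)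
      (nhds (u0, v0))" by eventually_elim simp
  then obtain B where B: "open B" "(u0, v0) \<in> B" and B':
      "\<And>x w. (x, w) \<in> B \<Longrightarrow> nrm x w < 2 \<and> D x w < - \<eta> \<and> x \<in> ball u0 r2"
    unfolding eventually_nhds by force
  \<comment> \<open>A product neighbourhood is taken because the bound for the increment pairs the
    index at time t with velocities at all earlier times s.\<close>
  obtain B1 B2 where B12: "open B1" "open B2" "u0 \<in> B1" "v0 \<in> B2" "B1 \<times> B2 \<subseteq> B"
    using bspec[OF B(1)[unfolded open_prod_def] B(2)] by (elim exE conjE) (rule that; blast)
  let ?S = "(M0 \<inter> ball u0 r1) \<times> {-\<tau>1..\<tau>1}"
  have S0: "(u0, 0) \<in> ?S" using u0B \<tau>1 by simp
  obtain A1 where A1: "open A1" "(u0, 0) \<in> A1" "\<And>z. z \<in> ?S \<Longrightarrow> z \<in> A1 \<Longrightarrow> (\<lambda>(u, t). H u t) z \<in> B1"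
    using Hc[unfolded continuous_on_topological, rule_format, OF S0 B12(1)] B12(3) H[OF u0B(2)] by auto
  obtain A2 where A2: "open A2" "(u0, 0) \<in> A2" "\<And>z. z \<in> ?S \<Longrightarrow> z \<in> A2 \<Longrightarrow> (\<lambda>(u, t). W u t) z \<in> B2"
    using Wc[unfolded continuous_on_topological, rule_format, OF S0 B12(2)] B12(4) W0 by auto
  have A12: "open (A1 \<inter> A2)" "(u0, 0) \<in> A1 \<inter> A2" using A1 A2 by auto
  obtain C1 C2 where C12: "open C1" "open C2" "u0 \<in> C1" "(0::real) \<in> C2" "C1 \<times> C2 \<subseteq> A1 \<inter> A2"
    using bspec[OF A12(1)[unfolded open_prod_def] A12(2)] by (elim exE conjE) (rule that; blast)
  obtain r3 where r3: "r3 > 0" "ball u0 r3 \<subseteq> C1" using C12 openE by blast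
  obtain \<tau>3 where \<tau>3: "\<tau>3 > 0" "ball 0 \<tau>3 \<subseteq> C2" using C12 openE by blast
  define r where "r = min r1 r3"
  define \<tau> where "\<tau> = min \<tau>1 (\<tau>3 / 2)"
  have r: "r > 0" "ball u0 r \<subseteq> ball u0 r1" using r1 r3 by (auto simp: r_def)
  have \<tau>: "\<tau> > 0" "{0..\<tau>} \<subseteq> {-\<tau>1..\<tau>1}" using \<tau>1 \<tau>3 by (auto simp: \<tau>_def)
  have HW_box: "(H u t, W u t) \<in> B1 \<times> B2" if "u \<in> M0 \<inter> ball u0 r" "t \<in> {0..\<tau>}" for u t
  proof -
    have S: "(u, t) \<in> ?S" using that r(2) \<tau>(2) by blast
    have "t \<in> ball 0 \<tau>3" using that \<tau>3 by (auto simp: \<tau>_def)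
    then have "t \<in> C2" using \<tau>3(2) by blast
    moreover have "u \<in> C1" using r3(2) that by (auto simp: r_def)
    ultimately have "(u, t) \<in> A1 \<inter> A2" using C12(5) by blast
    then show ?thesis using S A1(3)[of "(u, t)"] A2(3)[of "(u, t)"] by auto
  qed
  then have HW: "(H u t, W u t) \<in> B" if "u \<in> M0 \<inter> ball u0 r" "t \<in> {0..\<tau>}" for u t
    using that B12(5) by blast
  show ?thesis
  proof (rule exI[of _ r], rule conjI[OF r(1)], rule exI[of _ \<tau>], rule conjI[OF \<tau>(1)],
      rule exI[of _ H], intro conjI ballI)
    show "continuous_on ((M0 \<inter> ball u0 r) \<times> {0..\<tau>}) (\<lambda>(u, t). H u t)"
      by (rule continuous_on_subset[OF Hc]) (use r(2) \<tau>(2) in blast)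
    fix u assume u: "u \<in> M0 \<inter> ball u0 r"
    then have u1: "u \<in> M0 \<inter> ball u0 r1" using r(2) by blast
    show H0: "H u 0 = u" using H[OF u1] by blast
    have d: "(H u has_vector_derivative W u s) (at s within {0..t})" if "s \<in> {0..t}" "t \<in> {0..\<tau>}" for s t
      by (rule has_vector_derivative_within_subset[of _ _ _ "{-\<tau>1..\<tau>1}"])
        (use H[OF u1] that \<tau>(2) in \<open>auto simp: subset_iff\<close>)
    have 0: "(0::real) \<in> {0..\<tau>}" using \<tau> by simp
    show "\<exists>w\<in>tangent_space M0 u. nrm u w \<le> 2 \<and> mderiv M0 \<Phi> u w \<le> - \<eta>"
    proof (rule bexI[of _ "W u 0"])
      have b: "nrm u (W u 0) < 2 \<and> D u (W u 0) < - \<eta> \<and> u \<in> ball u0 r2"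
        using B'[OF HW[OF u 0]] H0 by simp
      then show "nrm u (W u 0) \<le> 2 \<and> mderiv M0 \<Phi> u (W u 0) \<le> - \<eta>"
        and "W u 0 \<in> tangent_space M0 u" using curve_u[OF u1] by auto
    qed
    fix t assume t: "t \<in> {0..\<tau>}"
    have t0: "0 \<le> t" using t by simp
    have st: "s \<in> {0..\<tau>}" if "s \<in> {0..t}" for s using that t by simp
    show HM: "H u t \<in> M0" using H[OF u1] t \<tau>(2) by blast
    have Wct: "continuous_on {0..t} (W u)"
    proof -
      have "continuous_on {0..t} (\<lambda>s. (\<lambda>(u, t). W u t) (u, s))"
      proof (rule continuous_on_compose2[OF Wc])
        have "(u, s) \<in> ?S" if "s \<in> {0..t}" for s using u1 st[OF that] \<tau>(2) by blast
        then show "Pair u ` {0..t} \<subseteq> ?S" by blast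
      qed (intro continuous_intros)
      then show ?thesis by simp
    qed
    have "path_dist ip M0 (H u 0) (H u t) \<le> ennreal (2 * (t - 0))"
    proof (rule path_dist_le_bound[OF nz t0 _ Wct])
      fix s assume s: "s \<in> {0..t}"
      show "H u s \<in> M0 \<and> (H u has_vector_derivative W u s) (at s within {0..t})"
        using H[OF u1] st[OF s] \<tau>(2) d[OF s t] by blast
      show "nrm (H u s) (W u s) \<le> 2" using B'[OF HW[OF u st[OF s]]] by simp
    qed
    then show "path_dist ip M0 u (H u t) \<le> ennreal (2 * t)" by (simp add: H0)
    show "nrm (H u t) (H u t - u) \<le> 2 * t"
    proof -
      have "nrm (H u t) (H u t - H u 0) \<le> 2 * (t - 0)"
      proof (rule nrm_increment_le[OF ne0[OF HM] t0])
        fix s assume s: "s \<in> {0..t}"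
        show "(H u has_vector_derivative W u s) (at s within {0..t})" by (rule d[OF s t])
        have "(H u t, W u s) \<in> B"
        proof -
          have "(H u t, W u t) \<in> B1 \<times> B2" "(H u s, W u s) \<in> B1 \<times> B2"
            using HW_box[OF u t] HW_box[OF u st[OF s]] by auto
          then show ?thesis using B12(5) by auto
        qed
        then show "nrm (H u t) (W u s) \<le> 2" using B' by fastforce
      qed
      then show ?thesis by (simp add: H0)
    qed
    show "\<Phi> (H u t) \<le> \<Phi> u - \<eta> * t"
    proof -
      have fH: "f (H u s) = \<Phi> (H u s)" if "s \<in> {0..t}" for s
        using B'[OF HW[OF u st[OF that]]] f(2) H[OF u1] st[OF that] \<tau>(2) sub by blast
      have df: "((\<lambda>s. f (H u s)) has_real_derivative D (H u s) (W u s)) (at s within {0..t})" if s: "s \<in> {0..t}" for s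
        unfolding has_real_derivative_iff_has_vector_derivative
      proof (rule has_vector_derivative_compose_within[OF d[OF s t], where T = UNIV])
        show "(f has_derivative blinfun_apply (D (H u s))) (at (H u s) within UNIV)"
          using f(1) B'[OF HW[OF u st[OF s]]] by simp
      qed simp
      show ?thesis
      proof (cases "t = 0")
        case False
        with t0 have "0 < t" by simp
        have "\<exists>x\<in>{0<..<t}. f (H u t) - f (H u 0) = (t - 0) * D (H u x) (W u x)"
        proof (rule mvt_simple[OF \<open>0 < t\<close>, of "\<lambda>s. f (H u s)" "\<lambda>x h. h * D (H u x) (W u x)"])
          fix x assume "0 \<le> x" "x \<le> t"
          then show "((\<lambda>s. f (H u s)) has_derivative (\<lambda>h. h * D (H u x) (W u x))) (at x within {0..t})"
            using df[of x] by (simp add: has_field_derivative_def mult.commute[of _ "D (H u x) (W u x)"])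
        qed
        then obtain x where x: "x \<in> {0<..<t}" "f (H u t) - f (H u 0) = t * D (H u x) (W u x)" by auto
        have "D (H u x) (W u x) < - \<eta>" using B'[OF HW[OF u st]] x(1) by auto
        then have "t * D (H u x) (W u x) \<le> t * (- \<eta>)" using t0 by (intro mult_left_mono) auto
        then show ?thesis using x(2) fH[of 0] fH[of t] t0 H0 by (simp add: mult.commute)
      qed (simp add: H0)
    qed
  qed
qed

section \<open>The slope of \<open>\<Phi>\<close> and the function N\<close>

lemma deriv_norm_greater:
  assumes u: "u \<in> M0" and "0 \<le> \<eta>" "ennreal \<eta> < deriv_norm ip M0 \<Phi> u"
  shows "\<exists>v\<in>tangent_space M0 u. nrm u v \<le> 1 \<and> mderiv M0 \<Phi> u v < - \<eta>"
proof -
  obtain v where v: "v \<in> tangent_space M0 u" "nrm u v \<le> 1" "ennreal \<eta> < ennreal \<bar>mderiv M0 \<Phi> u v\<bar>"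
    using assms(3) unfolding deriv_norm_def less_SUP_iff by blast
  have less: "\<eta> < \<bar>mderiv M0 \<Phi> u v\<bar>" using v(3) assms(2) by (simp add: ennreal_less_iff)
  show ?thesis
  proof (cases "mderiv M0 \<Phi> u v < 0")
    case True
    then show ?thesis using v less by (intro bexI[of _ v]) auto
  next
    case False
    have "mderiv M0 \<Phi> u (- v) = - mderiv M0 \<Phi> u v" by (rule linear_neg[OF mderiv_linear[OF u]])
    moreover have "- v \<in> tangent_space M0 u" using tangent_space_scale[OF v(1), of "- 1"] by simp
    moreover have "nrm u (- v) \<le> 1" using v(2) nrm_simps(2)[OF ne0[OF u]] by simp
    ultimately show ?thesis using less False by (intro bexI[of _ "- v"]) auto
  qed
qed

lemma mderiv_le_deriv_norm:
  assumes u: "u \<in> M0" and v: "v \<in> tangent_space M0 u" "nrm u v \<le> c" "c > 0"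
  shows "ennreal (\<bar>mderiv M0 \<Phi> u v\<bar> / c) \<le> deriv_norm ip M0 \<Phi> u"
proof -
  let ?w = "(1 / c) *\<^sub>R v"
  have "ennreal \<bar>mderiv M0 \<Phi> u ?w\<bar> \<le> deriv_norm ip M0 \<Phi> u"
    unfolding deriv_norm_def
  proof (rule SUP_upper, intro CollectI conjI tangent_space_scale v(1))
    show "nrm u ?w \<le> 1" using v(2,3) nrm_simps(4)[OF ne0[OF u], of "1 / c" v] by simp
  qed
  moreover have "mderiv M0 \<Phi> u ?w = mderiv M0 \<Phi> u v / c"
    using linear_scale[OF mderiv_linear[OF u], of "1 / c" v] by simp
  ultimately show ?thesis using v(3) by (simp add: abs_divide)
qed

lemma critical_point_iff: "critical_point M0 \<Phi> u \<longleftrightarrow> u \<in> M0 \<and> deriv_norm ip M0 \<Phi> u = 0"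
proof
  assume "critical_point M0 \<Phi> u"
  then show "u \<in> M0 \<and> deriv_norm ip M0 \<Phi> u = 0"
    by (auto simp: critical_point_def deriv_norm_def SUP_eq_iff intro!: antisym SUP_least)
next
  assume u: "u \<in> M0 \<and> deriv_norm ip M0 \<Phi> u = 0"
  show "critical_point M0 \<Phi> u"
    unfolding critical_point_def
  proof (intro conjI ballI)
    fix v assume v: "v \<in> tangent_space M0 u"
    have "nrm u v \<ge> 0" using u ne0 nrm_simps(1) by blast
    then have "ennreal (\<bar>mderiv M0 \<Phi> u v\<bar> / (nrm u v + 1)) \<le> 0"
      using mderiv_le_deriv_norm[of u v "nrm u v + 1"] u v by simp
    then have "\<bar>mderiv M0 \<Phi> u v\<bar> / (nrm u v + 1) \<le> 0" by (simp add: ennreal_eq_0_iff)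
    then show "mderiv M0 \<Phi> u v = 0" using \<open>nrm u v \<ge> 0\<close> by (simp add: divide_le_0_iff)
  qed (use u in simp)
qed

text \<open>Near a noncritical point local descent provides tangent vectors of norm at most 2 and
  slope at most \<open>- \<eta>\<close>, so the dual norm is at least half of \<open>\<eta>\<close>
  on a whole neighbourhood and cannot tend to 0.\<close>

lemma critical_point_limit:
  assumes x: "\<And>n. x n \<in> M0" "x \<longlonglongrightarrow> u" "u \<in> M0" and d: "(\<lambda>n. deriv_norm ip M0 \<Phi> (x n)) \<longlonglongrightarrow> 0"
  shows "critical_point M0 \<Phi> u"
proof (rule ccontr)
  assume "\<not> ?thesis"
  then have "0 < deriv_norm ip M0 \<Phi> u" using x(3) by (simp add: critical_point_iff zero_less_iff_neq_zero)
  then obtain q where "0 < q" "q < deriv_norm ip M0 \<Phi> u" using dense by blast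
  then obtain \<eta> where \<eta>: "\<eta> > 0" "ennreal \<eta> < deriv_norm ip M0 \<Phi> u"
    by (cases q) (auto simp: ennreal_less_zero_iff)
  obtain v where v: "v \<in> tangent_space M0 u" "nrm u v \<le> 1" "mderiv M0 \<Phi> u v < - \<eta>"
    using deriv_norm_greater[OF x(3) _ \<eta>(2)] \<eta>(1) by auto
  obtain r where r: "r > 0" "\<And>y. y \<in> M0 \<inter> ball u r \<Longrightarrow> \<exists>w\<in>tangent_space M0 y. nrm y w \<le> 2 \<and> mderiv M0 \<Phi> y w \<le> - \<eta>"
    using local_descent[OF x(3) v] by blast
  have le: "ennreal (\<eta> / 2) \<le> deriv_norm ip M0 \<Phi> y" if y: "y \<in> M0 \<inter> ball u r" for y
  proof -
    obtain w where w: "w \<in> tangent_space M0 y" "nrm y w \<le> 2" "mderiv M0 \<Phi> y w \<le> - \<eta>" using r(2)[OF y] by blast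
    have "ennreal (\<eta> / 2) \<le> ennreal (\<bar>mderiv M0 \<Phi> y w\<bar> / 2)" using w(3) by (intro ennreal_leI) auto
    also have "\<dots> \<le> deriv_norm ip M0 \<Phi> y" by (rule mderiv_le_deriv_norm) (use y w in auto)
    finally show ?thesis .
  qed
  have "eventually (\<lambda>n. x n \<in> ball u r) sequentially"
    using x(2) r(1) by (intro topological_tendstoD) auto
  moreover have "eventually (\<lambda>n. deriv_norm ip M0 \<Phi> (x n) < ennreal (\<eta> / 2)) sequentially"
    using d \<eta>(1) by (intro order_tendstoD(2)) auto
  ultimately have "eventually (\<lambda>n. False) sequentially"
    by eventually_elim (use le x(1) in \<open>fastforce simp: not_less[symmetric]\<close>)
  then show False by simp
qed

lemma N_fun_le: "u \<in> M0 \<Longrightarrow> N_fun ip M0 u \<le> ennreal (nrm u u)"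
  unfolding N_fun_def using path_dist_refl[OF nz, of u] by (intro INF_lower2[of u]) auto

text \<open>N is an infimum of functions that are 1-Lipschitz for the path distance, by the triangle
  inequality. An additive error replaces a minimizer.\<close>

lemma N_fun_lipschitz: "N_fun ip M0 w \<le> N_fun ip M0 v + path_dist ip M0 v w"
proof (cases "M0 = {}")
  case False
  show ?thesis
  proof (rule ennreal_le_epsilon)
    fix e :: real assume fin: "N_fun ip M0 v + path_dist ip M0 v w < (Orderings.top :: ennreal)" and e: "0 < e"
    have "N_fun ip M0 v < N_fun ip M0 v + ennreal e"
      using fin e by (cases "N_fun ip M0 v") (auto simp flip: ennreal_plus simp: ennreal_less_iff)
    then obtain u where u: "u \<in> M0"
      "ennreal (nrm u u) + path_dist ip M0 u v < N_fun ip M0 v + ennreal e"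
      unfolding N_fun_def[of _ _ v] INF_less_iff by blast
    have "N_fun ip M0 w \<le> ennreal (nrm u u) + path_dist ip M0 u w"
      unfolding N_fun_def using u(1) by (rule INF_lower)
    also have "\<dots> \<le> ennreal (nrm u u) + (path_dist ip M0 u v + path_dist ip M0 v w)"
      by (intro add_left_mono path_dist_triangle[OF nz])
    also have "\<dots> = (ennreal (nrm u u) + path_dist ip M0 u v) + path_dist ip M0 v w"
      by (simp only: add.assoc)
    also have "\<dots> \<le> (N_fun ip M0 v + ennreal e) + path_dist ip M0 v w"
      using u(2) by (intro add_right_mono) simp
    finally show "N_fun ip M0 w \<le> N_fun ip M0 v + path_dist ip M0 v w + ennreal e"
      by (simp only: ac_simps)
  qed
qed (simp add: N_fun_def)

end

section \<open>Critical points and the group action\<close>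

lemma DERIV_unique_locally:
  assumes "(f has_real_derivative a) (at x)" "(g has_real_derivative b) (at x)"
    and "eventually (\<lambda>t. f t = g t) (nhds x)"
  shows "a = b"
  using assms(1) DERIV_cong_ev[OF refl assms(3) refl, of a] DERIV_unique[OF _ assms(2)] by simp

lemma tendsto_0_ennreal_le:
  fixes f g :: "nat \<Rightarrow> ennreal"
  assumes "g \<longlonglongrightarrow> 0" "\<And>n. f n \<le> g n"
  shows "f \<longlonglongrightarrow> 0"
proof (rule tendsto_sandwich[where f = "\<lambda>_. 0" and h = g])
  show "eventually (\<lambda>n. f n \<le> g n) sequentially" using assms(2) by simp
qed (use assms(1) in simp_all)

locale equivariant = ip_manifold ip Y M M0 \<Phi>
  for ip :: "'a::real_inner \<Rightarrow> 'a \<Rightarrow> 'a \<Rightarrow> real" and Y M M0 :: "'a set" and \<Phi> :: "'a \<Rightarrow> real" +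
  fixes G :: "('g, 'm) monoid_scheme" and act :: "'g \<Rightarrow> 'a \<Rightarrow> 'a"
  assumes action: "group_action G UNIV act"
    and act_linear: "g \<in> carrier G \<Longrightarrow> linear (act g)"
    and M3: "cond_M3 G act ip"
    and act_M0: "g \<in> carrier G \<Longrightarrow> u \<in> M0 \<Longrightarrow> act g u \<in> M0"
    and act_\<Phi>: "g \<in> carrier G \<Longrightarrow> u \<in> M0 \<Longrightarrow> \<Phi> (act g u) = \<Phi> u"
    and sym: "u \<in> M0 \<Longrightarrow> - u \<in> M0"
    and even: "u \<in> M0 \<Longrightarrow> \<Phi> (- u) = \<Phi> u"
    and G_star: "cond_G_star G act"
begin

section \<open>Invariance of norms, slopes and critical points\<close>

lemma group_G: "group G"
  using action by (simp add: group_action_def group_hom_def)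

lemma inv_G: "g \<in> carrier G \<Longrightarrow> inv\<^bsub>G\<^esub> g \<in> carrier G"
  using group.inv_closed[OF group_G] .

lemma act_mult: "g \<in> carrier G \<Longrightarrow> h \<in> carrier G \<Longrightarrow> act (g \<otimes>\<^bsub>G\<^esub> h) u = act g (act h u)"
  using group_action.composition_rule[OF action, of u g h] by simp

lemma act_inv:
  assumes g: "g \<in> carrier G"
  shows "act (inv\<^bsub>G\<^esub> g) (act g u) = u" "act g (act (inv\<^bsub>G\<^esub> g) u) = u"
proof -
  have one: "act \<one>\<^bsub>G\<^esub> u = u" for u
    using group_action.id_eq_one[OF action] by (metis UNIV_I restrict_apply')
  show "act (inv\<^bsub>G\<^esub> g) (act g u) = u" "act g (act (inv\<^bsub>G\<^esub> g) u) = u"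
    using act_mult[OF inv_G[OF g] g, of u] act_mult[OF g inv_G[OF g], of u] one[of u]
      group.l_inv[OF group_G g] group.r_inv[OF group_G g] by simp_all
qed

lemma act_simps:
  assumes "g \<in> carrier G"
  shows "act g (x - y) = act g x - act g y" "act g (- x) = - act g x" "act g 0 = 0"
  using act_linear[OF assms] by (simp_all add: linear_diff linear_neg linear_0)

lemma act_nonzero: "g \<in> carrier G \<Longrightarrow> u \<noteq> 0 \<Longrightarrow> act g u \<noteq> 0"
  using act_inv(1)[of g u] act_simps(3)[OF inv_G, of g] by auto

lemma nrm_act:
  assumes g: "g \<in> carrier G" and u: "u \<noteq> 0"
  shows "nrm (act g u) (act g v) = nrm u v"
\<comment> \<open>The zero vector is separated because (M3) speaks of nonzero vectors only.\<close>
proof (cases "v = 0")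
  case True
  then show ?thesis using act_simps(3)[OF g] nrm_simps(3) u act_nonzero[OF g u] by simp
next
  case False
  then show ?thesis using M3 g u unfolding cond_M3_def ip_norm_def by simp
qed

text \<open>A group element is an isometry from the norm indexed by u to the norm indexed by its
  image of u, and (M1) compares both with the given norm.\<close>

lemma act_bounded:
  assumes g: "g \<in> carrier G" and u: "(u::'a) \<noteq> 0"
  shows "bounded_linear (act g)"
proof -
  obtain C where C: "C > 0" "\<And>v. nrm u v \<le> C * norm v" using nrm_le[OF u] by blast
  obtain C' where C': "C' > 0" "\<And>v. norm v \<le> C' * nrm (act g u) v" using nrm_le[OF act_nonzero[OF g u]] by blast
  show ?thesis
  proof (rule bounded_linear_intro[where K = "C' * C"])
    fix v
    have "norm (act g v) \<le> C' * nrm u v" using C'(2)[of "act g v"] nrm_act[OF g u] by simp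
    also have "\<dots> \<le> C' * (C * norm v)" using C' C by (intro mult_left_mono) auto
    finally show "norm (act g v) \<le> norm v * (C' * C)" by (simp add: mult_ac)
  qed (use act_linear[OF g] in \<open>simp_all add: linear_add linear_scale\<close>)
qed

text \<open>The inverse element carries a tangent vector at the moved point to one at u, with the
  same indexed norm and, by invariance of \<open>\<Phi>\<close> along curves, the same
  derivative.\<close>

lemma deriv_norm_act_le:
  assumes g: "g \<in> carrier G" and u: "u \<in> M0"
  shows "deriv_norm ip M0 \<Phi> (act g u) \<le> deriv_norm ip M0 \<Phi> u"
  unfolding deriv_norm_def[of _ _ _ "act g u"]
proof (rule SUP_least)
  fix w assume "w \<in> {v \<in> tangent_space M0 (act g u). nrm (act g u) v \<le> 1}"
  then have w: "w \<in> tangent_space M0 (act g u)" "nrm (act g u) w \<le> 1" by auto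
  let ?h = "inv\<^bsub>G\<^esub> g"
  have h: "?h \<in> carrier G" by (rule inv_G[OF g])
  obtain c \<epsilon> where c: "\<epsilon> > 0" "c 0 = act g u" "\<And>t. \<bar>t\<bar> < \<epsilon> \<Longrightarrow> c t \<in> M0" "(c has_vector_derivative w) (at (0::real))"
    using w(1) unfolding tangent_space_def by blast
  have d: "((\<lambda>t. act ?h (c t)) has_vector_derivative act ?h w) (at 0)"
    by (rule bounded_linear.has_vector_derivative[OF act_bounded[OF h ne0[OF u]] c(4)])
  have c0: "act ?h (c 0) = u" using c(2) act_inv(1)[OF g] by simp
  have cM: "act ?h (c t) \<in> M0" if "\<bar>t\<bar> < \<epsilon>" for t by (rule act_M0[OF h c(3)[OF that]])
  have T: "act ?h w \<in> tangent_space M0 u"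
    unfolding tangent_space_def
    by (intro CollectI exI[of _ "\<lambda>t. act ?h (c t)"] exI[of _ \<epsilon>]) (use c(1) c0 cM d in blast)
  have n: "nrm u (act ?h w) \<le> 1"
    using nrm_act[OF h act_nonzero[OF g ne0[OF u]], of w] act_inv(1)[OF g, of u] w(2) by simp
  have "((\<lambda>t. \<Phi> (act ?h (c t))) has_real_derivative mderiv M0 \<Phi> u (act ?h w)) (at 0)"
    by (rule mderiv_curve[of "\<lambda>t. act ?h (c t)", OF c0 d c(1) cM])
  moreover have "((\<lambda>t. \<Phi> (c t)) has_real_derivative mderiv M0 \<Phi> (act g u) w) (at 0)"
    by (rule mderiv_curve[OF c(2,4,1,3)])
  moreover have "eventually (\<lambda>t. \<Phi> (act ?h (c t)) = \<Phi> (c t)) (nhds 0)"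
    unfolding eventually_nhds_metric
    using c(1) act_\<Phi>[OF h c(3)] by (intro exI[of _ \<epsilon>]) (auto simp: dist_real_def)
  ultimately have "mderiv M0 \<Phi> u (act ?h w) = mderiv M0 \<Phi> (act g u) w"
    by (rule DERIV_unique_locally)
  moreover have "ennreal \<bar>mderiv M0 \<Phi> u (act ?h w)\<bar> \<le> deriv_norm ip M0 \<Phi> u"
    unfolding deriv_norm_def using T n by (intro SUP_upper) auto
  ultimately show "ennreal \<bar>mderiv M0 \<Phi> (act g u) w\<bar> \<le> deriv_norm ip M0 \<Phi> u" by simp
qed

lemma critical_point_act:
  "g \<in> carrier G \<Longrightarrow> critical_point M0 \<Phi> u \<Longrightarrow> critical_point M0 \<Phi> (act g u)"
  using deriv_norm_act_le[of g u] act_M0[of g u] by (simp add: critical_point_iff)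

text \<open>The argument reflects curves instead of comparing slopes: the norms indexed by u and -u
  may differ, but vanishing of the derivative on all tangent vectors does not depend on
  them.\<close>

lemma critical_point_minus:
  assumes "critical_point M0 \<Phi> u"
  shows "critical_point M0 \<Phi> (- u)"
  unfolding critical_point_def
proof (intro conjI ballI)
  have u: "u \<in> M0" using assms by (simp add: critical_point_def)
  show "- u \<in> M0" by (rule sym[OF u])
  fix v assume "v \<in> tangent_space M0 (- u)"
  then obtain c \<epsilon> where c: "\<epsilon> > 0" "c 0 = - u" "\<And>t. \<bar>t\<bar> < \<epsilon> \<Longrightarrow> c t \<in> M0" "(c has_vector_derivative v) (at (0::real))"
    unfolding tangent_space_def by blast
  have d: "((\<lambda>t. - c t) has_vector_derivative - v) (at 0)" using c(4) by (rule has_vector_derivative_minus)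
  have c0: "- c 0 = u" using c(2) by simp
  have cM: "- c t \<in> M0" if "\<bar>t\<bar> < \<epsilon>" for t by (rule sym[OF c(3)[OF that]])
  have "- v \<in> tangent_space M0 u"
    unfolding tangent_space_def
    by (intro CollectI exI[of _ "\<lambda>t. - c t"] exI[of _ \<epsilon>]) (use c(1) c0 cM d in blast)
  then have "mderiv M0 \<Phi> u (- v) = 0" using assms by (simp add: critical_point_def)
  then have "((\<lambda>t. \<Phi> (- c t)) has_real_derivative 0) (at 0)"
    using mderiv_curve[of "\<lambda>t. - c t", OF c0 d c(1) cM] by simp
  moreover have "eventually (\<lambda>t. \<Phi> (- c t) = \<Phi> (c t)) (nhds 0)"
    unfolding eventually_nhds_metric
    using c(1) even[OF c(3)] by (intro exI[of _ \<epsilon>]) (auto simp: dist_real_def)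
  moreover note mderiv_curve[OF c(2,4,1,3)]
  ultimately show "mderiv M0 \<Phi> (- u) v = 0" using DERIV_unique_locally by metis
qed

end

section \<open>The critical set at one level, modulo the group\<close>

locale critical_level = equivariant ip Y M M0 \<Phi> G act
  for ip :: "'a::real_inner \<Rightarrow> 'a \<Rightarrow> 'a \<Rightarrow> real" and Y M M0 :: "'a set" and \<Phi> :: "'a \<Rightarrow> real"
    and G :: "('g, 'm) monoid_scheme" and act :: "'g \<Rightarrow> 'a \<Rightarrow> 'a" +
  fixes c :: real
  assumes NCG: "NCG G act ip M0 \<Phi> c"
    and no_antipode: "u \<in> critical_set M0 \<Phi> c \<Longrightarrow> g \<in> carrier G \<Longrightarrow> act g u \<noteq> - u"
begin

abbreviation "K \<equiv> critical_set M0 \<Phi> c"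

lemma K_M0: "k \<in> K \<Longrightarrow> k \<in> M0" and K_ne0: "k \<in> K \<Longrightarrow> k \<noteq> 0"
  using ne0 by (auto simp: critical_set_def critical_point_def)

lemma K_act: "k \<in> K \<Longrightarrow> g \<in> carrier G \<Longrightarrow> act g k \<in> K"
  using critical_point_act act_\<Phi> by (auto simp: critical_set_def critical_point_def)

text \<open>The slopes themselves tend to 0 because 1 + N is at least 1, and the group does not
  increase them. So the limit of the translated points is critical, and its level is c by invariance
  and continuity of \<open>\<Phi>\<close>.\<close>

lemma NCG_critical:
  assumes x: "\<And>n. x n \<in> M0" "(\<lambda>n. \<Phi> (x n)) \<longlonglongrightarrow> c"
    and d: "(\<lambda>n. deriv_norm ip M0 \<Phi> (x n) * (1 + N_fun ip M0 (x n))) \<longlonglongrightarrow> 0"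
  shows "\<exists>r gs u. strict_mono (r :: nat \<Rightarrow> nat) \<and> (\<forall>n. gs n \<in> carrier G) \<and> u \<in> K \<and>
    (\<lambda>n. act (gs n) (x (r n))) \<longlonglongrightarrow> u"
proof -
  obtain r :: "nat \<Rightarrow> nat" and gs u where r: "strict_mono r" and gs: "\<And>n. gs n \<in> carrier G" and u: "u \<in> M0"
    and lim: "(\<lambda>n. act (gs n) (x (r n))) \<longlonglongrightarrow> u"
    using NCG[unfolded NCG_def, rule_format, OF x d] by blast
  have yM: "act (gs n) (x (r n)) \<in> M0" for n using act_M0[OF gs x(1)] .
  have "critical_point M0 \<Phi> u"
  proof (rule critical_point_limit[OF yM lim u])
    have lim0: "(\<lambda>n. deriv_norm ip M0 \<Phi> (x (r n)) * (1 + N_fun ip M0 (x (r n)))) \<longlonglongrightarrow> 0"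
      using LIMSEQ_subseq_LIMSEQ[OF d r] by (simp add: o_def)
    have "deriv_norm ip M0 \<Phi> (act (gs n) (x (r n)))
        \<le> deriv_norm ip M0 \<Phi> (x (r n)) * (1 + N_fun ip M0 (x (r n)))" for n
    proof -
      have "deriv_norm ip M0 \<Phi> (x (r n)) * 1 \<le> deriv_norm ip M0 \<Phi> (x (r n)) * (1 + N_fun ip M0 (x (r n)))"
        by (rule mult_left_mono) auto
      with deriv_norm_act_le[OF gs x(1), of n "r n"] show ?thesis by simp
    qed
    with lim0 show "(\<lambda>n. deriv_norm ip M0 \<Phi> (act (gs n) (x (r n)))) \<longlonglongrightarrow> 0"
      by (rule tendsto_0_ennreal_le)
  qed
  moreover have "\<Phi> u = c"
  proof (rule LIMSEQ_unique)
    show "(\<lambda>n. \<Phi> (act (gs n) (x (r n)))) \<longlonglongrightarrow> \<Phi> u"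
      using continuous_on_tendsto_compose[OF \<Phi>_continuous lim u] yM by simp
    show "(\<lambda>n. \<Phi> (act (gs n) (x (r n)))) \<longlonglongrightarrow> c"
      using LIMSEQ_subseq_LIMSEQ[OF x(2) r] act_\<Phi>[OF gs x(1)] by (simp add: o_def)
  qed
  ultimately have "u \<in> K" by (simp add: critical_set_def)
  with r gs lim show ?thesis by blast
qed

text \<open>Critical points have slope 0, so every sequence in \<open>K\<close> satisfies the
  hypothesis of the compactness condition. The accompanying points converge to the same limit
  because the group preserves the indexed distance between \<open>v n\<close> and
  \<open>k n\<close>, which controls the norm distance near the limit.\<close>

lemma K_compact_mod_G:
  assumes k: "\<And>n. k n \<in> K" and v: "\<And>n. nrm (k n) (v n - k n) < 1 / Suc n"
  shows "\<exists>r gs l. strict_mono (r :: nat \<Rightarrow> nat) \<and> (\<forall>n. gs n \<in> carrier G) \<and> l \<in> K \<and>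
    (\<lambda>n. act (gs n) (k (r n))) \<longlonglongrightarrow> l \<and> (\<lambda>n. act (gs n) (v (r n))) \<longlonglongrightarrow> l"
proof -
  have "\<exists>r gs l. strict_mono (r :: nat \<Rightarrow> nat) \<and> (\<forall>n. gs n \<in> carrier G) \<and> l \<in> K \<and>
      (\<lambda>n. act (gs n) (k (r n))) \<longlonglongrightarrow> l"
  proof (rule NCG_critical)
    show "k n \<in> M0" for n using K_M0[OF k] .
    show "(\<lambda>n. \<Phi> (k n)) \<longlonglongrightarrow> c" using k by (simp add: critical_set_def)
    have "deriv_norm ip M0 \<Phi> (k n) = 0" for n
      using k[of n] by (simp add: critical_set_def critical_point_iff)
    then show "(\<lambda>n. deriv_norm ip M0 \<Phi> (k n) * (1 + N_fun ip M0 (k n))) \<longlonglongrightarrow> 0" by simp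
  qed
  then obtain r :: "nat \<Rightarrow> nat" and gs l where r: "strict_mono r" and gs: "\<And>n. gs n \<in> carrier G" and l: "l \<in> K"
    and lim: "(\<lambda>n. act (gs n) (k (r n))) \<longlonglongrightarrow> l" by blast
  obtain U C where U: "open U" "l \<in> U" "C > 0" and C: "\<And>u' v. u' \<in> U \<Longrightarrow> norm v \<le> C * nrm u' v"
    using M1_at[OF K_ne0[OF l]] by blast
  have "eventually (\<lambda>n. act (gs n) (k (r n)) \<in> U) sequentially"
    using topological_tendstoD[OF lim U(1,2)] .
  then have "eventually (\<lambda>n. norm (act (gs n) (v (r n)) - act (gs n) (k (r n))) \<le> C * (1 / Suc n)) sequentially"
  proof eventually_elim
    case (elim n)
    have "nrm (act (gs n) (k (r n))) (act (gs n) (v (r n)) - act (gs n) (k (r n))) = nrm (k (r n)) (v (r n) - k (r n))"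
      using nrm_act[OF gs K_ne0[OF k], of n "r n" "v (r n) - k (r n)"] by (simp add: act_simps(1)[OF gs])
    also have "\<dots> < 1 / Suc (r n)" by (rule v)
    also have "\<dots> \<le> 1 / Suc n" using seq_suble[OF r, of n] by (simp add: frac_le)
    finally show ?case
      using C[OF elim, of "act (gs n) (v (r n)) - act (gs n) (k (r n))"] U(3)
      by (meson less_imp_le mult_left_mono order_trans)
  qed
  moreover have "(\<lambda>n. C * (1 / Suc n)) \<longlonglongrightarrow> C * 0"
    by (intro tendsto_mult tendsto_const LIMSEQ_inverse_real_of_nat[unfolded inverse_eq_divide])
  then have "(\<lambda>n. C * (1 / Suc n)) \<longlonglongrightarrow> 0" by simp
  ultimately have "(\<lambda>n. act (gs n) (v (r n)) - act (gs n) (k (r n))) \<longlonglongrightarrow> 0"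
    by (rule Lim_null_comparison)
  from tendsto_add[OF this lim] have "(\<lambda>n. act (gs n) (v (r n))) \<longlonglongrightarrow> l" by simp
  with r gs l lim show ?thesis by blast
qed

text \<open>The constants of (M1) depend on the point. Counterexamples to uniformity could be
  translated by the group to a convergent sequence, where the constants at the limit apply. The
  index -v appears because reflected points are measured as well.\<close>

lemma uniform_constants:
  "\<exists>r>0. \<exists>C>0. \<forall>k\<in>K. \<forall>v. nrm k (v - k) < r \<longrightarrow> v \<noteq> 0 \<and> nrm v v \<le> C \<and> nrm (- v) v \<le> C \<and>
    (\<forall>w. nrm k w \<le> C * nrm v w \<and> nrm k w \<le> C * nrm (- v) w)"
proof (rule ccontr)
  define good where "good C k v \<longleftrightarrow> v \<noteq> 0 \<and> nrm v v \<le> C \<and> nrm (- v) v \<le> C \<and>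
    (\<forall>w. nrm k w \<le> C * nrm v w \<and> nrm k w \<le> C * nrm (- v) w)" for C k v
  assume "\<not> ?thesis"
  \<comment> \<open>Taking radius \<open>1 / Suc n\<close> and constant \<open>Suc n\<close>
    together lets one sequence contradict every fixed pair of constants.\<close>
  then have "\<exists>k\<in>K. \<exists>v. nrm k (v - k) < 1 / Suc n \<and> \<not> good (Suc n) k v" for n
    unfolding good_def by (metis (no_types, lifting) of_nat_0_less_iff zero_less_Suc zero_less_divide_1_iff)
  then obtain k v where k: "\<And>n. k n \<in> K" and v: "\<And>n. nrm (k n) (v n - k n) < 1 / Suc n"
    and bad: "\<And>n. \<not> good (Suc n) (k n) (v n)" by metis
  obtain r :: "nat \<Rightarrow> nat" and gs l where r: "strict_mono r" and gs: "\<And>n. gs n \<in> carrier G" and l: "l \<in> K"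
    and lk: "(\<lambda>n. act (gs n) (k (r n))) \<longlonglongrightarrow> l" and lv: "(\<lambda>n. act (gs n) (v (r n))) \<longlonglongrightarrow> l"
    using K_compact_mod_G[of k v, OF k v] by blast
  have lne: "l \<noteq> 0" by (rule K_ne0[OF l])
  obtain U C where U: "open U" "l \<in> U" "0 \<notin> U" "C > 0"
    and C: "\<And>u' v. u' \<in> U \<Longrightarrow> norm v \<le> C * nrm u' v \<and> nrm u' v \<le> C * norm v"
    using M1_at[OF lne] by blast
  obtain U' C' where U': "open U'" "- l \<in> U'" "C' > 0"
    and C': "\<And>u' v. u' \<in> U' \<Longrightarrow> norm v \<le> C' * nrm u' v \<and> nrm u' v \<le> C' * norm v"
    using M1_at[of "- l"] lne by auto
  \<comment> \<open>The products compare the norm at \<open>k\<close> with those at v and -v through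
    the given norm; the last two terms bound the norms of v itself.\<close>
  define B where "B = max (max (C * C) (C * C')) (max (C * (norm l + 1)) (C' * (norm l + 1)))"
  obtain m where m: "B \<le> real m" using real_arch_simple by blast
  have "eventually (\<lambda>n. act (gs n) (k (r n)) \<in> U) sequentially"
    using topological_tendstoD[OF lk U(1,2)] .
  moreover have "eventually (\<lambda>n. act (gs n) (v (r n)) \<in> U) sequentially"
    using topological_tendstoD[OF lv U(1,2)] .
  moreover have "eventually (\<lambda>n. - act (gs n) (v (r n)) \<in> U') sequentially"
    using topological_tendstoD[OF tendsto_minus[OF lv] U'(1,2)] .
  moreover have "eventually (\<lambda>n. norm (act (gs n) (v (r n))) < norm l + 1) sequentially"
    using order_tendstoD(2)[OF tendsto_norm[OF lv], of "norm l + 1"] by simp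
  moreover have "eventually (\<lambda>n. n \<ge> m) sequentially" by (rule eventually_ge_at_top)
  ultimately have "eventually (\<lambda>n. False) sequentially"
  proof eventually_elim
    case (elim n)
    let ?g = "act (gs n)" and ?k = "k (r n)" and ?v = "v (r n)"
    have "real m \<le> Suc (r n)" using elim(5) seq_suble[OF r, of n] by simp
    then have BR: "B \<le> Suc (r n)" using m by linarith
    have vne: "?v \<noteq> 0" using elim(2) U(3) act_simps(3)[OF gs] by metis
    note inv_k = nrm_act[OF gs[of n] K_ne0[OF k[of "r n"]]]
    note inv_v = nrm_act[OF gs[of n] vne]
    have inv_mv: "nrm (- ?g ?v) (?g w) = nrm (- ?v) w" for w
      using nrm_act[OF gs[of n], of "- ?v" w] vne by (simp add: act_simps(2)[OF gs])
    have nn: "nrm (?g ?v) w \<ge> 0" "nrm (- ?g ?v) w \<ge> 0" for w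
      using nrm_simps(1)[of "?g ?v" w] nrm_simps(1)[of "- ?g ?v" w] act_nonzero[OF gs vne] by auto
    have "nrm (?g ?k) w \<le> Suc (r n) * nrm (?g ?v) w" for w
    proof -
      have "nrm (?g ?k) w \<le> C * norm w" using C[OF elim(1)] by blast
      also have "\<dots> \<le> C * (C * nrm (?g ?v) w)" using C[OF elim(2)] U(4) by (intro mult_left_mono) auto
      also have "\<dots> = (C * C) * nrm (?g ?v) w" by simp
      also have "\<dots> \<le> Suc (r n) * nrm (?g ?v) w" using BR nn by (intro mult_right_mono) (auto simp: B_def)
      finally show ?thesis .
    qed
    then have 1: "nrm ?k w \<le> Suc (r n) * nrm ?v w" for w using inv_k[of w] inv_v[of w] by metis
    have "nrm (?g ?k) w \<le> Suc (r n) * nrm (- ?g ?v) w" for w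
    proof -
      have "nrm (?g ?k) w \<le> C * norm w" using C[OF elim(1)] by blast
      also have "\<dots> \<le> C * (C' * nrm (- ?g ?v) w)" using C'[OF elim(3)] U(4) by (intro mult_left_mono) auto
      also have "\<dots> = (C * C') * nrm (- ?g ?v) w" by simp
      also have "\<dots> \<le> Suc (r n) * nrm (- ?g ?v) w" using BR nn by (intro mult_right_mono) (auto simp: B_def)
      finally show ?thesis .
    qed
    then have 2: "nrm ?k w \<le> Suc (r n) * nrm (- ?v) w" for w using inv_k[of w] inv_mv[of w] by metis
    have "nrm (?g ?v) (?g ?v) \<le> C * norm (?g ?v)" using C[OF elim(2)] by blast
    also have "\<dots> \<le> C * (norm l + 1)" using elim(4) U(4) by (intro mult_left_mono) auto
    also have "\<dots> \<le> Suc (r n)" using BR by (simp add: B_def)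
    finally have 3: "nrm ?v ?v \<le> Suc (r n)" by (simp add: inv_v)
    have "nrm (- ?g ?v) (?g ?v) \<le> C' * norm (?g ?v)" using C'[OF elim(3)] by blast
    also have "\<dots> \<le> C' * (norm l + 1)" using elim(4) U'(3) by (intro mult_left_mono) auto
    also have "\<dots> \<le> Suc (r n)" using BR by (simp add: B_def)
    finally have 4: "nrm (- ?v) ?v \<le> Suc (r n)" by (simp add: inv_mv)
    show False using bad[of "r n"] vne 1 2 3 4 by (simp add: good_def)
  qed
  then show False by simp
qed

end

text \<open>Below, the distance to each point \<open>k\<close> is measured in the norm with index \<open>k\<close>; this makes the distance
  to an invariant set invariant.\<close>

locale critical_level_radius = critical_level ip Y M M0 \<Phi> G act c
  for ip :: "'a::real_inner \<Rightarrow> 'a \<Rightarrow> 'a \<Rightarrow> real" and Y M M0 :: "'a set" and \<Phi> :: "'a \<Rightarrow> real"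
    and G :: "('g, 'm) monoid_scheme" and act :: "'g \<Rightarrow> 'a \<Rightarrow> 'a" and c :: real +
  fixes R C :: real
  assumes R: "R > 0" and C: "C > 0"
    and RC: "k \<in> critical_set M0 \<Phi> c \<Longrightarrow> nrm k (v - k) < R \<Longrightarrow> v \<noteq> 0 \<and> nrm v v \<le> C \<and> nrm (- v) v \<le> C \<and>
    (\<forall>w. nrm k w \<le> C * nrm v w \<and> nrm k w \<le> C * nrm (- v) w)"
begin

section \<open>Truncated invariant distances\<close>

text \<open>The inserted \<open>R\<close> truncates the distance, so only points with uniform
  constants contribute, and it gives the value \<open>R\<close> when the set is empty, as happens
  for an empty critical set.\<close>

definition rho :: "'a set \<Rightarrow> 'a \<Rightarrow> real" where
  "rho S x = Inf (insert R ((\<lambda>k. nrm k (x - k)) ` S))"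

lemma rho_bdd: "S \<subseteq> K \<Longrightarrow> bdd_below (insert R ((\<lambda>k. nrm k (x - k)) ` S))"
  using R K_ne0 nrm_simps(1) by (intro bdd_belowI[of _ 0]) auto

lemma rho_le_R: "S \<subseteq> K \<Longrightarrow> rho S x \<le> R"
  unfolding rho_def by (intro cInf_lower rho_bdd) auto

lemma rho_le: "S \<subseteq> K \<Longrightarrow> k \<in> S \<Longrightarrow> rho S x \<le> nrm k (x - k)"
  unfolding rho_def by (intro cInf_lower rho_bdd) auto

lemma rho_less:
  assumes "S \<subseteq> K" "rho S x < q" "q \<le> R"
  shows "\<exists>k\<in>S. nrm k (x - k) < q"
proof -
  obtain y where "y \<in> insert R ((\<lambda>k. nrm k (x - k)) ` S)" "y < q"
    using assms(2) cInf_less_iff[OF _ rho_bdd[OF assms(1)]] unfolding rho_def by blast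
  then show ?thesis using assms(3) by auto
qed

text \<open>If the truncation is active at x there is nothing to show; otherwise nearly optimal
  points k lie within \<open>R\<close> of x, and only for those is a bound on the increment
  required.\<close>

lemma rho_lipschitz_aux:
  assumes S: "S \<subseteq> K" and b: "0 \<le> b"
    and w: "\<And>k. k \<in> S \<Longrightarrow> nrm k (x - k) < R \<Longrightarrow> nrm k (y - x) \<le> b"
  shows "rho S y \<le> rho S x + b"
proof (cases "rho S x < R")
  case True
  show ?thesis
  proof (rule field_le_epsilon)
    fix e :: real assume "0 < e"
    then have "rho S x < min R (rho S x + e)" using True by simp
    from rho_less[OF S this] obtain k where k: "k \<in> S" "nrm k (x - k) < min R (rho S x + e)" by auto
    have "rho S y \<le> nrm k (y - k)" by (rule rho_le[OF S k(1)])
    also have "\<dots> \<le> nrm k (y - x) + nrm k (x - k)" using K_ne0 S k(1) by (intro nrm_triangle_diff) auto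
    finally show "rho S y \<le> rho S x + b + e" using w[OF k(1)] k(2) by simp
  qed
qed (use rho_le_R[OF S, of y] b in simp)

text \<open>The increment is measured in the norm at the moving point v, which is what
  \<open>local_descent\<close> controls. In the reflected version the norm at -(-v) enters, whence
  the second comparison among the constants.\<close>

lemma rho_lipschitz:
  assumes S: "S \<subseteq> K" and v: "v \<noteq> 0"
  shows "rho S v' \<le> rho S v + C * nrm v (v' - v)" "rho S (- v') \<le> rho S (- v) + C * nrm v (v' - v)"
proof -
  have b: "0 \<le> C * nrm v (v' - v)" using C nrm_simps(1)[OF v] by simp
  show "rho S v' \<le> rho S v + C * nrm v (v' - v)"
    by (rule rho_lipschitz_aux[OF S b]) (use RC S in blast)
  show "rho S (- v') \<le> rho S (- v) + C * nrm v (v' - v)"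
  proof (rule rho_lipschitz_aux[OF S b])
    fix k assume k: "k \<in> S" "nrm k (- v - k) < R"
    then have "nrm k (- v' - (- v)) \<le> C * nrm (- (- v)) (- v' - (- v))" using RC[of k "- v"] S by blast
    also have "- v' - (- v) = v - v'" by simp
    finally show "nrm k (- v' - (- v)) \<le> C * nrm v (v' - v)" using nrm_simps(6)[OF v, of v v'] by simp
  qed
qed

text \<open>The Lipschitz bound uses the norm at the first of two points. It is applied from v to x
  and from x to v; the second application has a varying index, handled by joint continuity of the
  norms.\<close>

lemma rho_continuous:
  assumes S: "S \<subseteq> K"
  shows "continuous_on (- {0}) (rho S)"
  unfolding continuous_on_def
proof
  fix v :: 'a assume "v \<in> - {0}"
  then have v: "v \<noteq> 0" by simp
  have id: "((\<lambda>x. x) \<longlongrightarrow> v) (at v within - {0})" by (rule tendsto_ident_at)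
  have t1: "((\<lambda>x. C * nrm v (x - v)) \<longlongrightarrow> C * nrm v (v - v)) (at v within - {0})"
    by (intro tendsto_mult tendsto_const tendsto_nrm tendsto_diff id v)
  have t2: "((\<lambda>x. C * nrm x (v - x)) \<longlongrightarrow> C * nrm v (v - v)) (at v within - {0})"
    by (intro tendsto_mult tendsto_const tendsto_nrm tendsto_diff id v)
  have "((\<lambda>x. rho S x - rho S v) \<longlongrightarrow> 0) (at v within - {0})"
  proof (rule tendsto_sandwich)
    show "eventually (\<lambda>x. - (C * nrm x (v - x)) \<le> rho S x - rho S v) (at v within - {0})"
      unfolding eventually_at_filter using rho_lipschitz(1)[OF S, of _ v] by (intro always_eventually) force
    show "eventually (\<lambda>x. rho S x - rho S v \<le> C * nrm v (x - v)) (at v within - {0})"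
      using rho_lipschitz(1)[OF S v] by (simp add: algebra_simps)
    show "((\<lambda>x. - (C * nrm x (v - x))) \<longlongrightarrow> 0) (at v within - {0})"
      using tendsto_minus[OF t2] nrm_simps(3)[OF v] by simp
    show "((\<lambda>x. C * nrm v (x - v)) \<longlongrightarrow> 0) (at v within - {0})"
      using t1 nrm_simps(3)[OF v] by simp
  qed
  then show "(rho S \<longlongrightarrow> rho S v) (at v within - {0})" by (simp add: LIM_zero_iff)
qed

lemma rho_minus_continuous: "S \<subseteq> K \<Longrightarrow> continuous_on (- {0}) (\<lambda>x. rho S (- x))"
  by (rule continuous_on_compose2[OF rho_continuous]) (auto intro!: continuous_intros)

lemma rho_act_le:
  assumes S: "S \<subseteq> K" "\<And>k g. k \<in> S \<Longrightarrow> g \<in> carrier G \<Longrightarrow> act g k \<in> S" and g: "g \<in> carrier G"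
  shows "rho S (act g x) \<le> rho S x"
  unfolding rho_def[of S x]
proof (rule cInf_greatest)
  fix y assume "y \<in> insert R ((\<lambda>k. nrm k (x - k)) ` S)"
  then consider "y = R" | k where "k \<in> S" "y = nrm k (x - k)" by blast
  then show "rho S (act g x) \<le> y"
  proof cases
    case 2
    have "rho S (act g x) \<le> nrm (act g k) (act g x - act g k)"
      by (rule rho_le[OF S(1) S(2)[OF 2(1) g]])
    also have "\<dots> = nrm k (x - k)"
      using nrm_act[OF g, of k "x - k"] K_ne0[of k] S(1) 2(1) by (auto simp: act_simps(1)[OF g])
    finally show ?thesis using 2 by simp
  qed (use rho_le_R[OF S(1)] in simp)
qed simp

lemma rho_act:
  assumes S: "S \<subseteq> K" "\<And>k g. k \<in> S \<Longrightarrow> g \<in> carrier G \<Longrightarrow> act g k \<in> S" and g: "g \<in> carrier G"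
  shows "rho S (act g x) = rho S x"
  using rho_act_le[OF S g, of x] rho_act_le[OF S inv_G[OF g], of "act g x"] act_inv(1)[OF g, of x] by simp

section \<open>Odd separating functions and the even distance to the critical set\<close>

definition orb :: "'a \<Rightarrow> 'a set" where
  "orb k = (\<lambda>g. act g k) ` carrier G"

lemma orb_K: "k \<in> K \<Longrightarrow> orb k \<subseteq> K"
  using K_act by (auto simp: orb_def)

lemma orb_act: "l \<in> orb k \<Longrightarrow> g \<in> carrier G \<Longrightarrow> act g l \<in> orb k"
  unfolding orb_def using act_mult[of g] group.is_monoid[OF group_G] monoid.m_closed
  by (smt (verit, ccfv_threshold) image_iff)

text \<open>Positive where x is closer than -x to the orbit of k. Using the whole orbit makes this
  odd function invariant, so finitely many orbits can suffice even if \<open>K\<close> is not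
  compact.\<close>

definition sep :: "'a \<Rightarrow> 'a \<Rightarrow> real" where
  "sep k x = rho (orb k) (- x) - rho (orb k) x"

lemma sep_odd: "sep k (- x) = - sep k x" by (simp add: sep_def)

lemma sep_continuous: "k \<in> K \<Longrightarrow> continuous_on (- {0}) (sep k)"
  unfolding sep_def[abs_def]
  by (intro continuous_on_diff rho_continuous rho_minus_continuous orb_K)

lemma sep_act: "k \<in> K \<Longrightarrow> g \<in> carrier G \<Longrightarrow> sep k (act g x) = sep k x"
  unfolding sep_def using rho_act[OF orb_K orb_act, of k g] act_simps(2)[of g x] by metis

text \<open>The minimum is what makes the distance even: although the reflection of a critical point
  is critical, distances to k and -k are measured in different norms.\<close>

definition P :: "'a \<Rightarrow> real" where
  "P x = min (rho K x) (rho K (- x))"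

lemma P_even: "P (- x) = P x" by (simp add: P_def min.commute)

lemma P_continuous: "continuous_on (- {0}) P"
  unfolding P_def[abs_def] by (intro continuous_on_min rho_continuous rho_minus_continuous order_refl)

lemma P_lipschitz: "v \<noteq> 0 \<Longrightarrow> P v' \<le> P v + C * nrm v (v' - v)"
  using rho_lipschitz[OF order_refl, of v v'] by (auto simp: P_def min_def)

text \<open>This bounds N, hence the weight 1 + N, near the critical set and its reflection, and so
  relates speed to descent there.\<close>

lemma P_nrm_le:
  assumes "P x < R"
  shows "nrm x x \<le> C"
proof -
  consider "rho K x < R" | "rho K (- x) < R" using assms by (auto simp: P_def min_def split: if_splits)
  then show ?thesis
  proof cases
    case 1
    then obtain k where "k \<in> K" "nrm k (x - k) < R" using rho_less[OF order_refl 1] by blast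
    then show ?thesis using RC by blast
  next
    case 2
    then obtain k where k: "k \<in> K" "nrm k (- x - k) < R" using rho_less[OF order_refl 2] by blast
    then have "- x \<noteq> 0" "nrm (- (- x)) (- x) \<le> C" using RC[OF k] by blast+
    then show ?thesis using nrm_simps(2)[of x x] by simp
  qed
qed

text \<open>Otherwise the compactness condition would yield translates converging to a point of
  \<open>K\<close>; by invariance of the distance the original points would come closer to
  \<open>K\<close> than \<open>q\<close>.\<close>

lemma P_gradient_bound:
  assumes "q > 0"
  shows "\<exists>\<beta>>0. \<exists>e>0. \<forall>u\<in>M0. \<bar>\<Phi> u - c\<bar> \<le> e \<longrightarrow> q \<le> P u \<longrightarrow>
    ennreal \<beta> \<le> deriv_norm ip M0 \<Phi> u * (1 + N_fun ip M0 u)"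
proof (rule ccontr)
  let ?p = "\<lambda>u. deriv_norm ip M0 \<Phi> u * (1 + N_fun ip M0 u)"
  assume contr: "\<not> ?thesis"
  have "\<exists>u\<in>M0. \<bar>\<Phi> u - c\<bar> \<le> 1 / Suc n \<and> q \<le> P u \<and> ?p u < ennreal (1 / Suc n)" for n
  proof -
    have "1 / Suc n > (0::real)" by simp
    with contr show ?thesis by (meson not_le)
  qed
  then obtain x where x: "\<And>n. x n \<in> M0" "\<And>n. \<bar>\<Phi> (x n) - c\<bar> \<le> 1 / Suc n" "\<And>n. q \<le> P (x n)"
    "\<And>n. ?p (x n) < ennreal (1 / Suc n)" by metis
  have lim0: "(\<lambda>n. 1 / Suc n) \<longlonglongrightarrow> (0::real)"
    using LIMSEQ_inverse_real_of_nat by (simp add: inverse_eq_divide)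
  have "\<exists>r gs u. strict_mono (r :: nat \<Rightarrow> nat) \<and> (\<forall>n. gs n \<in> carrier G) \<and> u \<in> K \<and>
    (\<lambda>n. act (gs n) (x (r n))) \<longlonglongrightarrow> u"
  proof (rule NCG_critical[OF x(1)])
    have "(\<lambda>n. \<Phi> (x n) - c) \<longlonglongrightarrow> 0"
      by (rule Lim_null_comparison[OF _ lim0]) (use x(2) in simp)
    then show "(\<lambda>n. \<Phi> (x n)) \<longlonglongrightarrow> c" by (simp add: LIM_zero_iff)
    have "(\<lambda>n. ennreal (1 / Suc n)) \<longlonglongrightarrow> ennreal 0" using lim0 by (rule tendsto_ennrealI)
    then have "(\<lambda>n. ennreal (1 / Suc n)) \<longlonglongrightarrow> 0" by simp
    then show "(\<lambda>n. ?p (x n)) \<longlonglongrightarrow> 0"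
      by (rule tendsto_0_ennreal_le) (rule less_imp_le[OF x(4)])
  qed
  then obtain r :: "nat \<Rightarrow> nat" and gs u where r: "strict_mono r" and gs: "\<And>n. gs n \<in> carrier G" and u: "u \<in> K"
    and lim: "(\<lambda>n. act (gs n) (x (r n))) \<longlonglongrightarrow> u" by blast
  have une: "u \<noteq> 0" by (rule K_ne0[OF u])
  have "(\<lambda>n. nrm u (act (gs n) (x (r n)) - u)) \<longlonglongrightarrow> nrm u (u - u)"
    by (intro tendsto_nrm tendsto_diff lim tendsto_const une)
  then have "(\<lambda>n. nrm u (act (gs n) (x (r n)) - u)) \<longlonglongrightarrow> 0" using nrm_simps(3)[OF une] by simp
  then have "eventually (\<lambda>n. nrm u (act (gs n) (x (r n)) - u) < q) sequentially"
    using assms by (rule order_tendstoD(2))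
  then have "eventually (\<lambda>n. False) sequentially"
  proof eventually_elim
    case (elim n)
    have "P (x (r n)) \<le> rho K (x (r n))" by (simp add: P_def)
    also have "\<dots> = rho K (act (gs n) (x (r n)))" using rho_act[OF order_refl K_act gs] by simp
    also have "\<dots> \<le> nrm u (act (gs n) (x (r n)) - u)" by (rule rho_le[OF order_refl u])
    finally show False using elim x(3)[of "r n"] by simp
  qed
  then show False by simp
qed

text \<open>Compactness of \<open>K\<close> modulo the group enters here, and the condition \<open>(G\<^sub>*)\<close> excludes that a common zero
  in the limit comes from an orbit accumulating at its own antipode.\<close>

lemma finite_separation:
  "\<exists>E q. finite E \<and> E \<subseteq> K \<and> 0 < q \<and> q \<le> R \<and> (\<forall>x. P x < q \<longrightarrow> (\<exists>k\<in>E. sep k x \<noteq> 0))"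
proof (rule ccontr)
  assume contr: "\<not> ?thesis"
  have ex: "\<exists>x k. k \<in> K \<and> nrm k (x - k) < 1 / Suc n \<and> (\<forall>l\<in>E. sep l x = 0)"
    if E: "finite E" "E \<subseteq> K" for E and n :: nat
  proof -
    define q where "q = min R (1 / Suc n)"
    have q: "0 < q" "q \<le> R" using R by (auto simp: q_def)
    then obtain x where x: "P x < q" "\<And>l. l \<in> E \<Longrightarrow> sep l x = 0" using contr E by meson
    consider "rho K x < q" | "rho K (- x) < q" using x(1) by (auto simp: P_def min_def split: if_splits)
    then show ?thesis
    proof cases
      case 1
      then obtain k where "k \<in> K" "nrm k (x - k) < q" using rho_less[OF order_refl 1 q(2)] by blast
      then show ?thesis using x(2) by (intro exI[of _ x] exI[of _ k]) (auto simp: q_def)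
    next
      case 2
      then obtain k where "k \<in> K" "nrm k (- x - k) < q" using rho_less[OF order_refl 2 q(2)] by blast
      then show ?thesis using x(2) by (intro exI[of _ "- x"] exI[of _ k]) (auto simp: q_def sep_odd)
    qed
  qed
  define good where "good E n z \<longleftrightarrow>
      snd z \<in> K \<and> nrm (snd z) (fst z - snd z) < 1 / Suc n \<and> (\<forall>l\<in>E. sep l (fst z) = 0)"
    for E and n :: nat and z :: "'a \<times> 'a"
  define Z where "Z E n = (SOME z. good E n z)" for E n
  define X where "X E n = fst (Z E n)" for E n
  define Kf where "Kf E n = snd (Z E n)" for E n
  have XK: "Kf E n \<in> K \<and> nrm (Kf E n) (X E n - Kf E n) < 1 / Suc n \<and> (\<forall>l\<in>E. sep l (X E n) = 0)"
    if E: "finite E" "E \<subseteq> K" for E n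
  proof -
    obtain x k where "good E n (x, k)" using ex[OF E, of n] unfolding good_def by auto
    then have "good E n (Z E n)" unfolding Z_def by (rule someI)
    then show ?thesis by (simp add: good_def X_def Kf_def)
  qed
  \<comment> \<open>A greedy choice: at each step all separators chosen so far vanish at some point
    \<open>x n\<close> arbitrarily close to \<open>k n\<close>, and the separator of
    \<open>k n\<close> is added to the list.\<close>
  define E where "E = rec_nat {} (\<lambda>n En. insert (Kf En n) En)"
  have E0: "E 0 = {}" and ES: "E (Suc n) = insert (Kf (E n) n) (E n)" for n by (simp_all add: E_def)
  have Efin: "finite (E n) \<and> E n \<subseteq> K" for n
    by (induction n) (use XK in \<open>auto simp: E0 ES\<close>)
  have Emono: "E m \<subseteq> E n" if "m \<le> n" for m n
    using that by (induction n rule: dec_induct) (auto simp: ES)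
  define k where "k n = Kf (E n) n" for n
  define x where "x n = X (E n) n" for n
  have k: "k n \<in> K" and kx: "nrm (k n) (x n - k n) < 1 / Suc n" for n
    using XK[of "E n" n] Efin by (auto simp: k_def x_def)
  have sep0: "sep (k j) (x n) = 0" if "j < n" for j n
  proof -
    have "k j \<in> E (Suc j)" by (simp add: ES k_def)
    then have "k j \<in> E n" using Emono[of "Suc j" n] that by auto
    then show ?thesis using XK[of "E n" n] Efin by (auto simp: x_def)
  qed
  obtain r :: "nat \<Rightarrow> nat" and gs l where r: "strict_mono r" and gs: "\<And>n. gs n \<in> carrier G" and l: "l \<in> K"
    and lk: "(\<lambda>n. act (gs n) (k (r n))) \<longlonglongrightarrow> l" and lx: "(\<lambda>n. act (gs n) (x (r n))) \<longlonglongrightarrow> l"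
    using K_compact_mod_G[of k x, OF k kx] by blast
  have lne: "l \<noteq> 0" by (rule K_ne0[OF l])
  define y where "y n = act (gs n) (k (r n))" for n
  have yK: "y n \<in> K" for n unfolding y_def by (rule K_act[OF k gs])
  have ylim: "y \<longlonglongrightarrow> l" using lk by (simp add: y_def[abs_def])
  \<comment> \<open>The separator of \<open>k (r j)\<close> vanishes at all later points of the
    sequence, by invariance also at their translates, and by continuity at the limit.\<close>
  have sep_l: "sep (k (r j)) l = 0" for j
  proof (rule LIMSEQ_unique)
    have "isCont (sep (k (r j))) l"
      using sep_continuous[OF k] lne by (simp add: continuous_on_eq_continuous_at open_Compl)
    then show "(\<lambda>n. sep (k (r j)) (act (gs n) (x (r n)))) \<longlonglongrightarrow> sep (k (r j)) l"
      using lx by (rule isCont_tendsto_compose)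
    have "eventually (\<lambda>n. sep (k (r j)) (act (gs n) (x (r n))) = 0) sequentially"
      using eventually_gt_at_top[of j]
      by eventually_elim (use sep_act[OF k gs] sep0 r in \<open>auto simp: strict_mono_def\<close>)
    then show "(\<lambda>n. sep (k (r j)) (act (gs n) (x (r n)))) \<longlonglongrightarrow> 0" by (rule tendsto_eventually)
  qed
  \<comment> \<open>The added term makes \<open>b j\<close> strictly larger than the distance from
    \<open>l\<close> to the orbit point \<open>y j\<close>.\<close>
  define b where "b j = nrm (y j) (l - y j) + 1 / Suc j" for j
  have blim: "b \<longlonglongrightarrow> 0"
  proof -
    have "(\<lambda>j. nrm (y j) (l - y j) + 1 / Suc j) \<longlonglongrightarrow> nrm l (l - l) + 0"
      by (intro tendsto_add tendsto_nrm tendsto_diff tendsto_const ylim lne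
          LIMSEQ_inverse_real_of_nat[unfolded inverse_eq_divide])
    then show ?thesis using nrm_simps(3)[OF lne] by (simp add: b_def[abs_def])
  qed
  then have "eventually (\<lambda>j. b j < R) sequentially" using R by (rule order_tendstoD(2))
  \<comment> \<open>Below \<open>R\<close> the truncation in \<open>rho\<close> is inactive, so a
    small value is witnessed by an actual orbit point.\<close>
  then obtain J where J: "\<And>j. j \<ge> J \<Longrightarrow> b j < R" unfolding eventually_sequentially by blast
  \<comment> \<open>Since the separator vanishes at \<open>l\<close>, the point -l is as close to
    the orbit as \<open>l\<close> is. The nearby orbit point is moved to \<open>y (J + j)\<close> by
    a group element, which carries -l along; so translates of \<open>l\<close> converge to
    -l.\<close>
  have "\<exists>h\<in>carrier G. nrm (y (J + j)) (- act h l - y (J + j)) < b (J + j)" for j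
  proof -
    let ?i = "J + j"
    have yorb: "y ?i \<in> orb (k (r ?i))" using gs by (auto simp: y_def orb_def)
    have "rho (orb (k (r ?i))) (- l) = rho (orb (k (r ?i))) l" using sep_l[of ?i] by (simp add: sep_def)
    also have "\<dots> \<le> nrm (y ?i) (l - y ?i)" by (rule rho_le[OF orb_K[OF k] yorb])
    also have "\<dots> < b ?i" by (simp add: b_def)
    finally have "rho (orb (k (r ?i))) (- l) < b ?i" .
    from rho_less[OF orb_K[OF k] this] obtain z where z: "z \<in> orb (k (r ?i))" "nrm z (- l - z) < b ?i"
      using J[of ?i] by auto
    obtain h where h: "h \<in> carrier G" "z = act h (k (r ?i))" using z(1) by (auto simp: orb_def)
    define f where "f = gs ?i \<otimes>\<^bsub>G\<^esub> inv\<^bsub>G\<^esub> h"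
    have f: "f \<in> carrier G"
      unfolding f_def using gs inv_G[OF h(1)] group.is_monoid[OF group_G] by (intro monoid.m_closed) auto
    have fz: "act f z = y ?i"
      using act_mult[OF gs inv_G[OF h(1)]] act_inv(1)[OF h(1)] by (simp add: f_def h(2) y_def)
    have "z \<noteq> 0" using z(1) orb_K[OF k] K_ne0 by blast
    then have "nrm (y ?i) (- act f l - y ?i) = nrm z (- l - z)"
      using nrm_act[OF f, of z "- l - z"] by (simp add: act_simps[OF f] fz)
    then have "nrm (y ?i) (- act f l - y ?i) < b ?i" using z(2) by simp
    with f show ?thesis by blast
  qed
  then obtain h where h: "\<And>j. h j \<in> carrier G" "\<And>j. nrm (y (J + j)) (- act (h j) l - y (J + j)) < b (J + j)"
    by metis
  obtain U B where U: "open U" "l \<in> U" "B > 0" and B: "\<And>u' v. u' \<in> U \<Longrightarrow> norm v \<le> B * nrm u' v"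
    using M1_at[OF lne] by blast
  have yJ: "(\<lambda>j. y (J + j)) \<longlonglongrightarrow> l" using LIMSEQ_ignore_initial_segment[OF ylim, of J] by (simp add: add.commute)
  have bJ: "(\<lambda>j. B * b (J + j)) \<longlonglongrightarrow> B * 0"
    using LIMSEQ_ignore_initial_segment[OF blim, of J] by (intro tendsto_mult tendsto_const) (simp add: add.commute)
  have "eventually (\<lambda>j. norm (- act (h j) l - y (J + j)) \<le> B * b (J + j)) sequentially"
    using topological_tendstoD[OF yJ U(1,2)]
  proof eventually_elim
    case (elim j)
    show ?case
      using B[OF elim, of "- act (h j) l - y (J + j)"] mult_left_mono[OF less_imp_le[OF h(2)[of j]], of B] U(3)
      by linarith
  qed
  then have "(\<lambda>j. - act (h j) l - y (J + j)) \<longlonglongrightarrow> 0"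
    by (rule Lim_null_comparison) (use bJ in simp)
  from tendsto_add[OF this yJ] have "(\<lambda>j. - act (h j) l) \<longlonglongrightarrow> l" by simp
  from tendsto_minus[OF this] have hl: "(\<lambda>j. act (h j) l) \<longlonglongrightarrow> - l" by simp
  obtain g where "g \<in> carrier G" "act g l = - l"
    using G_star[unfolded cond_G_star_def, rule_format, OF h(1) hl] by blast
  with no_antipode[OF l] show False by blast
qed

end

section \<open>Crossing a level\<close>

context critical_level_radius
begin

section \<open>The descent preorder\<close>

definition nn :: "'a \<Rightarrow> real" where
  "nn u = enn2real (N_fun ip M0 u)"

lemma nn: "u \<in> M0 \<Longrightarrow> N_fun ip M0 u = ennreal (nn u)" "0 \<le> nn u"
  using le_less_trans[OF N_fun_le ennreal_less_top, of u] by (simp_all add: nn_def ennreal_enn2real)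

lemma nn_le_nrm: "u \<in> M0 \<Longrightarrow> nn u \<le> nrm u u"
proof -
  assume u: "u \<in> M0"
  then have "ennreal (nn u) \<le> ennreal (nrm u u)" using N_fun_le[OF u] nn(1)[OF u] by simp
  then show ?thesis using nrm_simps(1)[OF ne0[OF u], of u] by simp
qed

lemma nn_lipschitz:
  assumes "u \<in> M0" "v \<in> M0" "path_dist ip M0 v u \<le> ennreal s" "0 \<le> s"
  shows "nn u \<le> nn v + s"
proof -
  have "ennreal (nn u) \<le> ennreal (nn v) + ennreal s"
  proof -
    have "N_fun ip M0 u \<le> N_fun ip M0 v + path_dist ip M0 v u" by (rule N_fun_lipschitz)
    also have "\<dots> \<le> N_fun ip M0 v + ennreal s" by (rule add_left_mono[OF assms(3)])
    finally show ?thesis by (simp only: nn(1) assms(1,2))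
  qed
  then show ?thesis using nn(2)[of v] assms(4) by (simp flip: ennreal_plus)
qed

text \<open>Along a descent path \<open>\<Phi>\<close> drops at least by \<open>\<beta>\<close> times the increase of \<open>ln (1 + N)\<close>; integrated, this is the last
  clause, which is stable under concatenation.\<close>

definition descends :: "real \<Rightarrow> real \<Rightarrow> real \<Rightarrow> 'a \<Rightarrow> 'a \<Rightarrow> bool" where
  "descends \<beta> \<kappa> \<delta> v w \<longleftrightarrow> w \<in> M0 \<and> \<Phi> w \<le> \<Phi> v \<and>
     \<Phi> w - \<kappa> * min \<delta> (P w) \<le> \<Phi> v - \<kappa> * min \<delta> (P v) \<and>
     path_dist ip M0 v w \<le> ennreal ((1 + nn v) * (exp ((\<Phi> v - \<Phi> w) / \<beta>) - 1))"

lemma descends_refl: "v \<in> M0 \<Longrightarrow> descends \<beta> \<kappa> \<delta> v v"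
  by (simp add: descends_def path_dist_refl[OF nz])

text \<open>N is 1-Lipschitz, so adding the distance bound of \<open>descends\<close> to N at v
  leaves exactly the exponential factor. This growth bound is what transitivity needs.\<close>

lemma descends_nn:
  assumes \<beta>: "\<beta> > 0" and v: "v \<in> M0" and d: "descends \<beta> \<kappa> \<delta> v w"
  shows "1 + nn w \<le> (1 + nn v) * exp ((\<Phi> v - \<Phi> w) / \<beta>)"
proof -
  have "nn w \<le> nn v + (1 + nn v) * (exp ((\<Phi> v - \<Phi> w) / \<beta>) - 1)"
    using d v \<beta> nn(2)[of v] by (intro nn_lipschitz) (auto simp: descends_def)
  then show ?thesis by (simp add: algebra_simps)
qed

text \<open>With exponential factors a and b of the two parts, 1 + N has grown by at most the factor
  a in between, and (a - 1) + a (b - 1) = a b - 1.\<close>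

lemma descends_trans:
  assumes \<beta>: "\<beta> > 0" and v: "v \<in> M0" and vw: "descends \<beta> \<kappa> \<delta> v w" and wx: "descends \<beta> \<kappa> \<delta> w x"
  shows "descends \<beta> \<kappa> \<delta> v x"
proof -
  define a where "a = exp ((\<Phi> v - \<Phi> w) / \<beta>)"
  define b where "b = exp ((\<Phi> w - \<Phi> x) / \<beta>)"
  have "a \<ge> 1" "b \<ge> 1" using vw wx \<beta> by (auto simp: a_def b_def descends_def)
  have ab: "exp ((\<Phi> v - \<Phi> x) / \<beta>) = a * b"
    by (simp add: a_def b_def diff_divide_distrib flip: exp_add)
  have pos: "0 \<le> (1 + nn v) * (a - 1)" "0 \<le> (1 + nn w) * (b - 1)"
    using nn(2)[of v] nn(2)[of w] \<open>a \<ge> 1\<close> \<open>b \<ge> 1\<close> by simp_all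
  have "path_dist ip M0 v x \<le> path_dist ip M0 v w + path_dist ip M0 w x"
    by (rule path_dist_triangle[OF nz])
  also have "\<dots> \<le> ennreal ((1 + nn v) * (a - 1)) + ennreal ((1 + nn w) * (b - 1))"
    using vw wx by (intro add_mono) (auto simp: descends_def a_def b_def)
  also have "\<dots> = ennreal ((1 + nn v) * (a - 1) + (1 + nn w) * (b - 1))"
    using pos by (simp add: ennreal_plus)
  also have "\<dots> \<le> ennreal ((1 + nn v) * (a * b - 1))"
  proof (rule ennreal_leI)
    have "(1 + nn w) * (b - 1) \<le> ((1 + nn v) * a) * (b - 1)"
      using descends_nn[OF \<beta> v vw] \<open>b \<ge> 1\<close> by (intro mult_right_mono) (auto simp: a_def)
    then show "(1 + nn v) * (a - 1) + (1 + nn w) * (b - 1) \<le> (1 + nn v) * (a * b - 1)"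
      by (simp add: algebra_simps)
  qed
  finally show ?thesis using vw wx by (auto simp: descends_def ab)
qed

text \<open>The 8 is a product of three factors 2: the speed, the halved slope
  \<open>\<eta>\<close>, and the comparison of 1 + N at u and v. In the other constant, 4 comes from
  speed and slope, \<open>C\<close> is the Lipschitz constant of \<open>P\<close>, and C + 4 bounds
  1 + N at u when the path ends near the critical set.\<close>

lemma local_deformation:
  assumes u: "u \<in> M0" and \<beta>: "\<beta> > 0" and b: "ennreal \<beta> \<le> deriv_norm ip M0 \<Phi> u * (1 + N_fun ip M0 u)"
    and \<delta>: "\<delta> \<le> R"
  shows "\<exists>r>0. \<exists>H :: 'a \<Rightarrow> real \<Rightarrow> 'a. continuous_on ((M0 \<inter> ball u r) \<times> {0..1}) (\<lambda>(v, t). H v t) \<and>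
    (\<forall>v\<in>M0 \<inter> ball u r. H v 0 = v \<and> \<Phi> (H v 1) < \<Phi> v \<and>
      (\<forall>t\<in>{0..1}. descends (\<beta> / 8) (\<beta> / (4 * C * (C + 4))) \<delta> v (H v t)))"
proof -
  define \<kappa> where "\<kappa> = \<beta> / (4 * C * (C + 4))"
  \<comment> \<open>Half of the guaranteed slope, so that the dual norm exceeds it strictly and a
    suitable tangent vector exists.\<close>
  define \<eta> where "\<eta> = \<beta> / (2 * (1 + nn u))"
  have nu: "1 + nn u > 0" using nn(2)[of u] by simp
  have \<eta>: "\<eta> > 0" using \<beta> nu by (simp add: \<eta>_def)
  have "ennreal \<eta> < deriv_norm ip M0 \<Phi> u"
  proof (rule ccontr)
    assume "\<not> ?thesis"
    then have "deriv_norm ip M0 \<Phi> u * (1 + N_fun ip M0 u) \<le> ennreal \<eta> * (1 + N_fun ip M0 u)"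
      by (intro mult_right_mono) auto
    with b have "ennreal \<beta> \<le> ennreal \<eta> * (1 + N_fun ip M0 u)" by (rule order_trans)
    also have "1 + N_fun ip M0 u = ennreal (1 + nn u)"
      using nn[of u] u by (simp add: ennreal_plus)
    also have "ennreal \<eta> * ennreal (1 + nn u) = ennreal (\<eta> * (1 + nn u))"
      using \<eta> nu by (simp add: ennreal_mult)
    also have "\<eta> * (1 + nn u) = \<beta> / 2" using nu by (simp add: \<eta>_def field_simps)
    finally have "ennreal \<beta> \<le> ennreal (\<beta> / 2)" .
    then show False using \<beta> by (simp add: ennreal_le_iff)
  qed
  from deriv_norm_greater[OF u less_imp_le[OF \<eta>] this]
  obtain v0 where v0: "v0 \<in> tangent_space M0 u" "nrm u v0 \<le> 1" "mderiv M0 \<Phi> u v0 < - \<eta>" by blast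
  obtain r1 \<tau>1 and H :: "'a \<Rightarrow> real \<Rightarrow> 'a" where r1: "r1 > 0" and \<tau>1: "\<tau>1 > 0"
    and Hc: "continuous_on ((M0 \<inter> ball u r1) \<times> {0..\<tau>1}) (\<lambda>(u, t). H u t)"
    and H: "\<And>v. v \<in> M0 \<inter> ball u r1 \<Longrightarrow> H v 0 = v"
      "\<And>v t. v \<in> M0 \<inter> ball u r1 \<Longrightarrow> t \<in> {0..\<tau>1} \<Longrightarrow> H v t \<in> M0 \<and> path_dist ip M0 v (H v t) \<le> ennreal (2 * t) \<and>
        \<Phi> (H v t) \<le> \<Phi> v - \<eta> * t \<and> nrm (H v t) (H v t - v) \<le> 2 * t"
    using local_descent[OF u v0] by (elim exE conjE) blast
  \<comment> \<open>Points at path distance at most 1 from u have N at least N u - 1, hence 1 + N u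
    is at most twice 1 + N v.\<close>
  obtain r2 where r2: "r2 > 0" "\<And>v. v \<in> M0 \<inter> ball u r2 \<Longrightarrow> path_dist ip M0 v u \<le> ennreal 1"
    using path_dist_to_base[OF submanifold u nz zero_less_one] by blast
  define r where "r = min r1 r2"
  \<comment> \<open>Times at most 1 limit the change of N along a path to 2, which enters the
    constant C + 4.\<close>
  define \<tau> where "\<tau> = min \<tau>1 1"
  have \<tau>: "\<tau> > 0" "\<tau> \<le> 1" "\<tau> \<le> \<tau>1" using \<tau>1 by (auto simp: \<tau>_def)
  have desc: "descends (\<beta> / 8) \<kappa> \<delta> v (H v t)" if v: "v \<in> M0 \<inter> ball u r" and t: "t \<in> {0..\<tau>}" for v t
  proof -
    have v1: "v \<in> M0 \<inter> ball u r1" "v \<in> M0 \<inter> ball u r2" and vM: "v \<in> M0" using v by (auto simp: r_def)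
    have t1: "t \<in> {0..\<tau>1}" using t \<tau> by auto
    let ?w = "H v t"
    have w: "?w \<in> M0" "path_dist ip M0 v ?w \<le> ennreal (2 * t)" "\<Phi> ?w \<le> \<Phi> v - \<eta> * t" "nrm ?w (?w - v) \<le> 2 * t"
      using H(2)[OF v1(1) t1] by blast+
    have t0: "0 \<le> t" using t by simp
    have nuv: "nn u \<le> nn v + 1" by (rule nn_lipschitz[OF u vM r2(2)[OF v1(2)]]) simp
    have tle: "t \<le> (\<Phi> v - \<Phi> ?w) / \<eta>" using w(3) \<eta> by (simp add: field_simps)
    have drop: "0 \<le> \<Phi> v - \<Phi> ?w" using w(3) mult_nonneg_nonneg[OF less_imp_le[OF \<eta>] t0] by linarith
    define X where "X = \<Phi> v - \<Phi> ?w"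
    have X: "0 \<le> X" "t \<le> X / \<eta>" using drop tle by (simp_all add: X_def)
    have "2 * t \<le> (1 + nn v) * (exp (X / (\<beta> / 8)) - 1)"
    proof -
      have "2 * t \<le> 2 * (X / \<eta>)" using X(2) by linarith
      also have "\<dots> = (1 + nn u) * (4 * X / \<beta>)" using \<beta> nu by (simp add: \<eta>_def field_simps)
      also have "\<dots> \<le> (2 * (1 + nn v)) * (4 * X / \<beta>)"
        using nuv nn(2)[of v] X(1) \<beta> by (intro mult_right_mono) auto
      also have "\<dots> = (1 + nn v) * (X / (\<beta> / 8))" by (simp add: field_simps)
      also have "\<dots> \<le> (1 + nn v) * (exp (X / (\<beta> / 8)) - 1)"
      proof (rule mult_left_mono)
        show "X / (\<beta> / 8) \<le> exp (X / (\<beta> / 8)) - 1" using exp_ge_add_one_self[of "X / (\<beta> / 8)"] by linarith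
      qed (use nn(2)[of v] in simp)
      finally show ?thesis .
    qed
    then have "2 * t \<le> (1 + nn v) * (exp ((\<Phi> v - \<Phi> ?w) / (\<beta> / 8)) - 1)" by (simp only: X_def)
    then have dist: "path_dist ip M0 v ?w \<le> ennreal ((1 + nn v) * (exp ((\<Phi> v - \<Phi> ?w) / (\<beta> / 8)) - 1))"
      using w(2) ennreal_leI order_trans by blast
    have "\<kappa> * min \<delta> (P v) - \<kappa> * min \<delta> (P ?w) \<le> \<Phi> v - \<Phi> ?w"
    \<comment> \<open>Only an end point close to the critical set matters here; otherwise the
      truncated distance at the end is already maximal.\<close>
    proof (cases "P ?w < \<delta>")
      case True
      then have "P ?w < R" using \<delta> by simp
      then have "nn ?w \<le> C" using nn_le_nrm[OF w(1)] P_nrm_le by (meson order_trans)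
      moreover have "path_dist ip M0 ?w v \<le> ennreal (2 * t)"
        using w(2) path_dist_commute[OF nz] by simp
      then have "nn v \<le> nn ?w + 2 * t" by (rule nn_lipschitz[OF vM w(1)]) (use t0 in simp)
      ultimately have nuC: "1 + nn u \<le> C + 4" using nuv t \<tau>(2) by auto
      have "min \<delta> (P v) - min \<delta> (P ?w) \<le> P v - P ?w" using True by simp
      also have "\<dots> \<le> C * nrm ?w (v - ?w)" using P_lipschitz[OF ne0[OF w(1)], of v] by simp
      also have "\<dots> \<le> C * (2 * t)"
        using w(4) C nrm_simps(6)[OF ne0[OF w(1)], of v ?w] by (intro mult_left_mono) auto
      also have "\<dots> \<le> C * (2 * (X / \<eta>))" using X(2) C by (intro mult_left_mono) linarith+
      also have "\<dots> = (4 * C / \<beta>) * X * (1 + nn u)" using \<beta> nu by (simp add: \<eta>_def field_simps)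
      also have "\<dots> \<le> (4 * C / \<beta>) * X * (C + 4)"
        using nuC X(1) \<beta> C by (intro mult_left_mono) auto
      also have "\<dots> = X / \<kappa>" using \<beta> C by (simp add: \<kappa>_def field_simps)
      finally have "min \<delta> (P v) - min \<delta> (P ?w) \<le> (\<Phi> v - \<Phi> ?w) / \<kappa>" by (simp only: X_def)
      moreover have "\<kappa> > 0" using \<beta> C by (simp add: \<kappa>_def)
      ultimately have "\<kappa> * (min \<delta> (P v) - min \<delta> (P ?w)) \<le> \<Phi> v - \<Phi> ?w"
        by (simp add: pos_le_divide_eq mult.commute)
      then show ?thesis by (simp add: right_diff_distrib)
    next
      case False
      then have "\<kappa> * min \<delta> (P v) \<le> \<kappa> * min \<delta> (P ?w)"
        using \<beta> C by (intro mult_left_mono) (auto simp: \<kappa>_def)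
      then show ?thesis using drop by simp
    qed
    then show ?thesis using w(1) drop dist by (simp add: descends_def)
  qed
  show ?thesis
  proof (rule exI[of _ r], rule conjI, use r1 r2 in \<open>simp add: r_def\<close>,
      rule exI[of _ "\<lambda>v t. H v (\<tau> * t)"], intro conjI ballI)
    have "continuous_on ((M0 \<inter> ball u r) \<times> {0..1}) (\<lambda>z. (\<lambda>(v, t). H v t) (fst z, \<tau> * snd z))"
    proof (rule continuous_on_compose2[OF Hc])
      have "\<tau> * t \<in> {0..\<tau>1}" if "t \<in> {0..1}" for t
      proof -
        have "\<tau> * t \<le> \<tau>" "0 \<le> \<tau> * t" using that \<tau>(1) mult_left_le[of t \<tau>] by simp_all
        then show ?thesis using \<tau>(3) by simp
      qed
      then show "(\<lambda>z. (fst z, \<tau> * snd z)) ` ((M0 \<inter> ball u r) \<times> {0..1}) \<subseteq> (M0 \<inter> ball u r1) \<times> {0..\<tau>1}"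
        by (auto simp: r_def)
    qed (intro continuous_intros)
    then show "continuous_on ((M0 \<inter> ball u r) \<times> {0..1}) (\<lambda>(v, t). H v (\<tau> * t))"
      by (simp add: case_prod_beta)
    fix v assume v: "v \<in> M0 \<inter> ball u r"
    then have v1: "v \<in> M0 \<inter> ball u r1" by (simp add: r_def)
    show "H v (\<tau> * 0) = v" using H(1)[OF v1] by simp
    have "\<Phi> (H v \<tau>) \<le> \<Phi> v - \<eta> * \<tau>" using H(2)[OF v1, of \<tau>] \<tau> by simp
    moreover have "\<eta> * \<tau> > 0" using \<eta> \<tau> by simp
    ultimately show "\<Phi> (H v (\<tau> * 1)) < \<Phi> v" by simp
    fix t :: real assume t: "t \<in> {0..1}"
    have "\<tau> * t \<in> {0..\<tau>}" using t \<tau> mult_left_le[of t \<tau>] by auto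
    from desc[OF v this] show "descends (\<beta> / 8) (\<beta> / (4 * C * (C + 4))) \<delta> v (H v (\<tau> * t))"
      by (simp add: \<kappa>_def)
  qed
qed

text \<open>N stays bounded along the chain because \<open>\<Phi>\<close> stays in a bounded
  interval, so the exponential bound turns convergence of the values of \<open>\<Phi>\<close> into a
  Cauchy property for the path distance. Near the limit, path distance controls the norm.\<close>

lemma descends_chain_converges:
  assumes \<beta>: "\<beta> > 0"
    and complete: "complete_wrt (path_dist ip M0) S" and SM: "S \<subseteq> M0"
    and xS: "\<And>n. x n \<in> S \<and> a \<le> \<Phi> (x n) \<and> \<Phi> (x n) \<le> b"
    and d: "\<And>m n. m \<le> n \<Longrightarrow> descends \<beta> \<kappa> \<delta> (x m) (x n)"
  shows "\<exists>l\<in>M0. x \<longlonglongrightarrow> l"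
proof -
  have x: "x n \<in> M0 \<and> a \<le> \<Phi> (x n) \<and> \<Phi> (x n) \<le> b" for n using xS SM by blast
  define L where "L = (1 + nn (x 0)) * exp ((b - a) / \<beta>)"
  have L: "L > 0" using nn(2)[of "x 0"] by (simp add: L_def)
  have nnL: "1 + nn (x n) \<le> L" for n
  proof -
    have "1 + nn (x n) \<le> (1 + nn (x 0)) * exp ((\<Phi> (x 0) - \<Phi> (x n)) / \<beta>)"
      using descends_nn[OF \<beta> _ d[of 0 n]] x by simp
    also have "\<dots> \<le> L"
      unfolding L_def
    proof (intro mult_left_mono)
      have "\<Phi> (x 0) - \<Phi> (x n) \<le> b - a" using x[of 0] x[of n] by linarith
      then show "exp ((\<Phi> (x 0) - \<Phi> (x n)) / \<beta>) \<le> exp ((b - a) / \<beta>)" using \<beta> by (simp add: divide_right_mono)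
    qed (use nn(2)[of "x 0"] in simp)
    finally show ?thesis .
  qed
  have dec: "decseq (\<lambda>n. \<Phi> (x n))" using d by (simp add: decseq_def descends_def)
  have "convergent (\<lambda>n. \<Phi> (x n))"
  proof (rule Bseq_monoseq_convergent)
    show "Bseq (\<lambda>n. \<Phi> (x n))"
    proof (rule BseqI')
      show "norm (\<Phi> (x n)) \<le> \<bar>a\<bar> + \<bar>b\<bar>" for n using x[of n] by (auto simp: abs_if)
    qed
    show "monoseq (\<lambda>n. \<Phi> (x n))" using dec by (simp add: decseq_imp_monoseq)
  qed
  then have cauchy: "Cauchy (\<lambda>n. \<Phi> (x n))" by (simp add: Cauchy_convergent_iff)
  have "\<exists>n0. \<forall>m\<ge>n0. \<forall>n\<ge>n0. path_dist ip M0 (x m) (x n) < e" if e: "e > 0" for e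
  proof -
    obtain q where q: "0 < q" "q < e" using e dense by blast
    then obtain s where s: "s > 0" "q = ennreal s" by (cases q) (auto simp: ennreal_less_zero_iff)
    \<comment> \<open>The solution of L (exp (h / \<open>\<beta>\<close>) - 1) = s.\<close>
    define h where "h = \<beta> * ln (1 + s / L)"
    have "1 < 1 + s / L" using s(1) L by simp
    then have h: "h > 0" using \<beta> unfolding h_def by (intro mult_pos_pos ln_gt_zero)
    obtain n0 where n0: "\<And>m n. m \<ge> n0 \<Longrightarrow> n \<ge> n0 \<Longrightarrow> dist (\<Phi> (x m)) (\<Phi> (x n)) < h"
      using cauchy h unfolding Cauchy_def by blast
    have le: "path_dist ip M0 (x m) (x n) \<le> q" if mn: "n0 \<le> m" "m \<le> n" for m n
    proof -
      have "\<Phi> (x m) - \<Phi> (x n) < h" using n0[of m n] mn by (simp add: dist_real_def)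
      then have "(\<Phi> (x m) - \<Phi> (x n)) / \<beta> \<le> ln (1 + s / L)" using \<beta> by (simp add: h_def field_simps)
      then have "exp ((\<Phi> (x m) - \<Phi> (x n)) / \<beta>) \<le> exp (ln (1 + s / L))" by simp
      also have "\<dots> = 1 + s / L" using s L by (intro exp_ln) (simp add: add_pos_pos)
      finally have E: "exp ((\<Phi> (x m) - \<Phi> (x n)) / \<beta>) - 1 \<le> s / L" by simp
      have "(1 + nn (x m)) * (exp ((\<Phi> (x m) - \<Phi> (x n)) / \<beta>) - 1) \<le> L * (s / L)"
        using nnL[of m] E nn(2)[of "x m"] L s d[OF mn(2)] \<beta>
        by (intro mult_mono) (auto simp: descends_def)
      also have "\<dots> = s" using L by simp
      finally show ?thesis
        using d[OF mn(2)] s(2) unfolding descends_def by (metis ennreal_leI order_trans)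
    qed
    have "path_dist ip M0 (x m) (x n) \<le> q" if "m \<ge> n0" "n \<ge> n0" for m n
      using le[of m n] le[of n m] that path_dist_commute[OF nz, of "x m" "x n"] by (cases "m \<le> n") auto
    then show ?thesis using q(2) by (meson le_less_trans)
  qed
  then obtain l where l: "l \<in> M0" "(\<lambda>n. path_dist ip M0 (x n) l) \<longlonglongrightarrow> 0"
    using complete[unfolded complete_wrt_def, rule_format, of x] xS SM by blast
  obtain B e where B: "B > 0" "e > 0" "\<And>u \<epsilon>. \<epsilon> < e \<Longrightarrow> path_dist ip M0 u l < ennreal \<epsilon> \<Longrightarrow> norm (u - l) \<le> B * \<epsilon>"
    using path_dist_near[OF nz l(1)] by blast
  have "x \<longlonglongrightarrow> l"
  proof (rule metric_LIMSEQ_I)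
    fix \<epsilon> :: real assume \<epsilon>: "0 < \<epsilon>"
    define q where "q = min (e / 2) (\<epsilon> / (2 * B))"
    have q: "q > 0" "q < e" using B \<epsilon> by (auto simp: q_def)
    have "B * q \<le> B * (\<epsilon> / (2 * B))" using B by (intro mult_left_mono) (auto simp: q_def)
    then have Bq: "B * q < \<epsilon>" using B \<epsilon> by simp
    have "eventually (\<lambda>n. path_dist ip M0 (x n) l < ennreal q) sequentially"
      using l(2) q(1) by (intro order_tendstoD(2)) auto
    then obtain N where "\<And>n. n \<ge> N \<Longrightarrow> path_dist ip M0 (x n) l < ennreal q"
      unfolding eventually_sequentially by blast
    then have "dist (x n) l < \<epsilon>" if "n \<ge> N" for n
      using B(3)[OF q(2), of "x n"] that Bq by (force simp: dist_norm)
    then show "\<exists>N. \<forall>n\<ge>N. dist (x n) l < \<epsilon>" by blast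
  qed
  with l(1) show ?thesis by blast
qed

text \<open>The higher sublevel set is covered by a part away from the critical set, which an odd
  map takes into the lower sublevel set, and a part near it, on which finitely many separators have
  no common zero. Their number is the gain.\<close>

lemma genus_bound_crossing:
  assumes \<epsilon>0: "\<epsilon>0 > 0"
    and complete: "complete_wrt (path_dist ip M0) S" "S \<subseteq> M0"
    and S: "\<And>u. u \<in> M0 \<Longrightarrow> c - \<epsilon>0 \<le> \<Phi> u \<Longrightarrow> \<Phi> u \<le> c + \<epsilon>0 \<Longrightarrow> u \<in> S"
  shows "\<exists>\<epsilon>>0. \<exists>m. (K = {} \<longrightarrow> m = 0) \<and> (\<forall>n. genus_bound {u \<in> M0. \<Phi> u \<le> c - \<epsilon>} n \<longrightarrow>
    genus_bound {u \<in> M0. \<Phi> u \<le> c + \<epsilon>} (n + m))"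
proof -
  obtain E q where E: "finite E" "E \<subseteq> K" and q: "0 < q" "q \<le> R"
    and sep_E: "\<And>x. P x < q \<Longrightarrow> \<exists>k\<in>E. sep k x \<noteq> 0"
    using finite_separation by blast
  define \<delta> where "\<delta> = q / 2"
  have \<delta>: "\<delta> > 0" "\<delta> < q" "\<delta> \<le> R" using q by (auto simp: \<delta>_def)
  obtain \<beta> e where \<beta>: "\<beta> > 0" and e: "e > 0"
    and grad: "\<And>u. u \<in> M0 \<Longrightarrow> \<bar>\<Phi> u - c\<bar> \<le> e \<Longrightarrow> \<delta> / 2 \<le> P u \<Longrightarrow>
      ennreal \<beta> \<le> deriv_norm ip M0 \<Phi> u * (1 + N_fun ip M0 u)"
    using P_gradient_bound[of "\<delta> / 2"] \<delta> by auto
  define \<kappa> where "\<kappa> = \<beta> / (4 * C * (C + 4))"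
  have \<kappa>: "\<kappa> > 0" using \<beta> C by (simp add: \<kappa>_def)
  \<comment> \<open>The first two bounds keep the slab from c - 2\<open>\<epsilon>\<close> to c +
    \<open>\<epsilon>\<close> inside the range of the gradient estimate and of completeness. The
    third ensures that a point with \<open>P\<close> below half of \<open>\<delta>\<close>
    satisfying the second inequality of \<open>Z\<close> lies below c -
    3\<open>\<epsilon>\<close>.\<close>
  define \<epsilon> where "\<epsilon> = min (min (e / 2) (\<epsilon>0 / 2)) (\<kappa> * \<delta> / 8)"
  have \<epsilon>: "\<epsilon> > 0" "2 * \<epsilon> \<le> e" "2 * \<epsilon> \<le> \<epsilon>0" "8 * \<epsilon> \<le> \<kappa> * \<delta>"
    using e \<epsilon>0 \<kappa> \<delta> by (auto simp: \<epsilon>_def)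
  \<comment> \<open>This set contains every point of the sublevel set with \<open>P\<close> at least
    \<open>\<delta>\<close>, is symmetric, and is stable under descent since both bounded quantities
    decrease. So the deformation meets the critical neighbourhood only below the relevant
    slab.\<close>
  define Z where "Z = {u \<in> M0. \<Phi> u \<le> c + \<epsilon> \<and> \<Phi> u - \<kappa> * min \<delta> (P u) \<le> c + \<epsilon> - \<kappa> * \<delta>}"
  define D where "D = descends (\<beta> / 8) \<kappa> \<delta>"
  have ZM: "u \<in> M0" if "u \<in> Z" for u using that by (simp add: Z_def)
  have DZ: "w \<in> Z \<and> \<Phi> w \<le> \<Phi> v" if "v \<in> Z" "D v w" for v w
    using that by (auto simp: Z_def D_def descends_def)
  have Z_high: "\<delta> / 2 \<le> P u" if u: "u \<in> Z" "\<Phi> u > c - 2 * \<epsilon>" for u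
  proof (rule ccontr)
    assume "\<not> ?thesis"
    then have "\<kappa> * min \<delta> (P u) \<le> \<kappa> * (\<delta> / 2)" using \<kappa> by (intro mult_left_mono) auto
    moreover have "\<Phi> u - \<kappa> * min \<delta> (P u) \<le> c + \<epsilon> - \<kappa> * \<delta>" using u(1) by (simp add: Z_def)
    moreover have "\<kappa> * (\<delta> / 2) = \<kappa> * \<delta> / 2" by simp
    ultimately show False using u(2) \<epsilon>(1,4) by linarith
  qed
  have Z_closed: "l \<in> Z" if l: "l \<in> M0" and y: "\<And>n. y n \<in> Z" "y \<longlonglongrightarrow> l" for l y
  proof -
    have f: "(\<lambda>n. \<Phi> (y n)) \<longlonglongrightarrow> \<Phi> l"
      by (rule continuous_on_tendsto_compose[OF \<Phi>_continuous y(2) l]) (use y(1) ZM in simp)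
    have p: "(\<lambda>n. P (y n)) \<longlonglongrightarrow> P l"
      by (rule continuous_on_tendsto_compose[OF P_continuous y(2)]) (use l y(1) ZM ne0 in auto)
    have "(\<lambda>n. \<Phi> (y n) - \<kappa> * min \<delta> (P (y n))) \<longlonglongrightarrow> \<Phi> l - \<kappa> * min \<delta> (P l)"
      by (intro tendsto_intros f tendsto_min p)
    then have "\<Phi> l - \<kappa> * min \<delta> (P l) \<le> c + \<epsilon> - \<kappa> * \<delta>"
      by (rule LIMSEQ_le_const2) (use y(1) in \<open>auto simp: Z_def\<close>)
    moreover have "\<Phi> l \<le> c + \<epsilon>" by (rule LIMSEQ_le_const2[OF f]) (use y(1) in \<open>auto simp: Z_def\<close>)
    ultimately show ?thesis using l by (simp add: Z_def)
  qed
  obtain F :: "'a \<Rightarrow> real \<Rightarrow> 'a" where F: "continuous_on (Z \<times> {0..1}) (\<lambda>(v, t). F v t)"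
    "\<And>v. v \<in> Z \<Longrightarrow> F v 0 = v" "\<And>v t. v \<in> Z \<Longrightarrow> t \<in> {0..1} \<Longrightarrow> F v t \<in> Z \<and> \<Phi> (F v t) \<le> \<Phi> v"
    "\<And>v. v \<in> Z \<Longrightarrow> \<Phi> (F v 1) \<le> c - \<epsilon>"
  proof (rule deformation[of Z \<Phi> "c - 2 * \<epsilon>" "c - \<epsilon>" D])
    show "continuous_on Z \<Phi>" by (rule continuous_on_subset[OF \<Phi>_continuous]) (use ZM in auto)
    show "c - 2 * \<epsilon> < c - \<epsilon>" using \<epsilon> by simp
    show "D x x" if "x \<in> Z" for x unfolding D_def by (rule descends_refl[OF ZM[OF that]])
    show "D x z" if "x \<in> Z" "y \<in> Z" "z \<in> Z" "D x y" "D y z" for x y z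
      using descends_trans[of "\<beta> / 8" x] \<beta> ZM that unfolding D_def by simp
    show "y \<in> Z \<and> \<Phi> y \<le> \<Phi> x" if "x \<in> Z" "D x y" for x y using DZ that by blast
    show "\<exists>l\<in>Z. x \<longlonglongrightarrow> l"
      if x: "\<And>n. x n \<in> Z \<and> c - 2 * \<epsilon> < \<Phi> (x n)" "\<And>m n. m \<le> n \<Longrightarrow> D (x m) (x n)" for x
    proof -
      have "\<exists>l\<in>M0. x \<longlonglongrightarrow> l"
      proof (rule descends_chain_converges[OF _ complete])
        show "\<beta> / 8 > 0" using \<beta> by simp
        show "x n \<in> S \<and> c - \<epsilon>0 \<le> \<Phi> (x n) \<and> \<Phi> (x n) \<le> c + \<epsilon>0" for n
        proof -
          have "x n \<in> M0" "c - \<epsilon>0 \<le> \<Phi> (x n)" "\<Phi> (x n) \<le> c + \<epsilon>0"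
            using x(1)[of n] \<epsilon> by (auto simp: Z_def)
          then show ?thesis using S by blast
        qed
        show "descends (\<beta> / 8) \<kappa> \<delta> (x m) (x n)" if "m \<le> n" for m n using x(2)[OF that] by (simp add: D_def)
      qed
      then show ?thesis using Z_closed x(1) by blast
    qed
    show "\<exists>r>0. \<exists>H :: 'a \<Rightarrow> real \<Rightarrow> 'a. continuous_on ((Z \<inter> ball u r) \<times> {0..1}) (\<lambda>(v, t). H v t) \<and>
      (\<forall>v\<in>Z \<inter> ball u r. H v 0 = v \<and> (\<forall>t\<in>{0..1}. D v (H v t)) \<and> \<Phi> (H v 1) < \<Phi> v)"
      if u: "u \<in> Z" "c - 2 * \<epsilon> < \<Phi> u" for u
    proof -
      have "\<bar>\<Phi> u - c\<bar> \<le> e" using u \<epsilon> by (auto simp: Z_def)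
      then have "ennreal \<beta> \<le> deriv_norm ip M0 \<Phi> u * (1 + N_fun ip M0 u)"
        using grad[OF ZM[OF u(1)]] Z_high[OF u] by blast
      from local_deformation[OF ZM[OF u(1)] \<beta> this \<delta>(3)]
      obtain r and H :: "'a \<Rightarrow> real \<Rightarrow> 'a" where r: "r > 0"
        and Hc: "continuous_on ((M0 \<inter> ball u r) \<times> {0..1}) (\<lambda>(v, t). H v t)"
        and H: "\<And>v. v \<in> M0 \<inter> ball u r \<Longrightarrow> H v 0 = v \<and> \<Phi> (H v 1) < \<Phi> v \<and>
          (\<forall>t\<in>{0..1}. descends (\<beta> / 8) \<kappa> \<delta> v (H v t))"
        unfolding \<kappa>_def[symmetric] by (elim exE conjE) blast
      have sub: "Z \<inter> ball u r \<subseteq> M0 \<inter> ball u r" using ZM by blast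
      show ?thesis
      proof (rule exI[of _ r], rule conjI[OF r], rule exI[of _ H], intro conjI ballI)
        show "continuous_on ((Z \<inter> ball u r) \<times> {0..1}) (\<lambda>(v, t). H v t)"
          by (rule continuous_on_subset[OF Hc]) (use sub in blast)
      qed (use H sub in \<open>unfold D_def, blast+\<close>)
    qed
  qed (rule that)
  have Zsym: "- x \<in> Z" if "x \<in> Z" for x
    using that sym[of x] even[of x] P_even[of x] by (simp add: Z_def)
  have nzZ: "0 \<notin> Z" using ZM nz by blast
  have evenZ: "\<Phi> (- x) = \<Phi> x" if "x \<in> Z" for x by (rule even[OF ZM[OF that]])
  obtain Q where Q: "continuous_on Z Q" "\<And>x. x \<in> Z \<Longrightarrow> Q x \<in> Z \<and> \<Phi> (Q x) \<le> c - \<epsilon>"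
    "\<And>x. x \<in> Z \<Longrightarrow> Q (- x) = - Q x"
    by (rule odd_deformation[OF Zsym nzZ evenZ F]) (assumption+, (rule that; assumption))
  let ?W = "{u \<in> M0. \<Phi> u \<le> c + \<epsilon>}"
  have Wne: "?W \<subseteq> - {0}" using ne0 by auto
  have Pc: "continuous_on ?W P" using P_continuous Wne by (rule continuous_on_subset)
  \<comment> \<open>Since \<open>\<delta>\<close> is less than \<open>q\<close>, the regions where
    \<open>P\<close> exceeds \<open>\<delta>\<close> and where it is below \<open>q\<close> overlap
    and cover everything.\<close>
  define l where "l x = max 0 (P x - \<delta>)" for x
  define m where "m x = max 0 (q - P x)" for x
  obtain f where f: "bij_betw f {..<card E} E" using ex_bij_betw_nat_finite[OF E(1)] by (auto simp: atLeast0LessThan)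
  have "genus_bound ?W (n + card E)" if n: "genus_bound {u \<in> M0. \<Phi> u \<le> c - \<epsilon>} n" for n
  proof (rule genus_bound_cover[where l = l and m = m])
    show "- x \<in> ?W" if "x \<in> ?W" for x using that sym even by auto
    show "continuous_on ?W l" "continuous_on ?W m"
      unfolding l_def m_def by (intro continuous_intros Pc)+
    show "l x > 0 \<or> m x > 0" for x using \<delta>(2) by (auto simp: l_def m_def)
    have lZ: "{x \<in> ?W. l x > 0} \<subseteq> Z" by (auto simp: l_def Z_def)
    show "genus_bound {x \<in> ?W. l x > 0} n"
    proof (rule genus_bound_odd_map[OF n])
      show "continuous_on {x \<in> ?W. l x > 0} Q" using Q(1) lZ by (rule continuous_on_subset)
      show "Q ` {x \<in> ?W. l x > 0} \<subseteq> {u \<in> M0. \<Phi> u \<le> c - \<epsilon>}" using Q(2) lZ ZM by blast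
      show "Q (- x) = - Q x" if "x \<in> {x \<in> ?W. l x > 0}" for x using Q(3) lZ that by blast
    qed
    show "genus_bound {x \<in> ?W. m x > 0} (card E)"
      unfolding genus_bound_def
    proof (intro exI[of _ "\<lambda>i. sep (f i)"] conjI allI impI ballI)
      fix i assume "i < card E"
      then have "f i \<in> K" using f E(2) by (auto simp: bij_betw_def)
      then show "continuous_on {x \<in> ?W. m x > 0} (sep (f i))"
        by (rule continuous_on_subset[OF sep_continuous]) (use Wne in auto)
    next
      fix x assume "x \<in> {x \<in> ?W. m x > 0}"
      then have "P x < q" by (simp add: m_def max_def split: if_splits)
      then obtain k where k: "k \<in> E" "sep k x \<noteq> 0" using sep_E by blast
      then have "k \<in> f ` {..<card E}" using f by (simp add: bij_betw_def)
      then show "\<exists>i<card E. sep (f i) x \<noteq> 0" using k(2) by blast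
    qed (rule sep_odd)
  qed (auto simp: l_def m_def P_even)
  moreover have "K = {} \<longrightarrow> card E = 0" using E by auto
  ultimately show ?thesis using \<epsilon>(1) by blast
qed

end

lemma (in critical_level) genus_bound_crossing_level:
  assumes "\<epsilon>0 > 0" "complete_wrt (path_dist ip M0) S" "S \<subseteq> M0"
    and "\<And>u. u \<in> M0 \<Longrightarrow> c - \<epsilon>0 \<le> \<Phi> u \<Longrightarrow> \<Phi> u \<le> c + \<epsilon>0 \<Longrightarrow> u \<in> S"
  shows "\<exists>\<epsilon>>0. \<exists>m. (K = {} \<longrightarrow> m = 0) \<and> (\<forall>n. genus_bound {u \<in> M0. \<Phi> u \<le> c - \<epsilon>} n \<longrightarrow>
    genus_bound {u \<in> M0. \<Phi> u \<le> c + \<epsilon>} (n + m))"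
proof -
  obtain R C where "R > 0" "C > 0" "\<forall>k\<in>K. \<forall>v. nrm k (v - k) < R \<longrightarrow> v \<noteq> 0 \<and> nrm v v \<le> C \<and> nrm (- v) v \<le> C \<and>
    (\<forall>w. nrm k w \<le> C * nrm v w \<and> nrm k w \<le> C * nrm (- v) w)"
    using uniform_constants by blast
  then interpret critical_level_radius ip Y M M0 \<Phi> G act c R C
    by unfold_locales blast+
  show ?thesis by (rule genus_bound_crossing[OF assms])
qed

section \<open>The Ljusternik-Schnirelmann theorem\<close>

theorem theorem2p12:
  fixes ip :: "'a::{real_inner, complete_space} \<Rightarrow> 'a \<Rightarrow> 'a \<Rightarrow> real"
    and G :: "('g, 'm) monoid_scheme" and T :: "'g topology"
    and act :: "'g \<Rightarrow> 'a \<Rightarrow> 'a"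
    and M :: "'a set" and \<Phi> :: "'a \<Rightarrow> real"
    and G0 :: "'g set" and M0 :: "'a set"
    and cstar cinf :: ereal and kstar :: nat
  assumes scalar_products: "\<forall>u. u \<noteq> 0 \<longrightarrow> is_scalar_product (ip u)"
    and top_group: "topological_group G T"
    and action: "linear_group_action G T act"
    and M1: "cond_M1 ip"
    and M2: "cond_M2 ip"
    and M3: "cond_M3 G act ip"
    and M_submanifold: "C11_submanifold UNIV M"
    and M_nonzero: "0 \<notin> M"
    and M_symmetric: "uminus ` M = M"
    and \<Phi>_C11: "C11_function M \<Phi>"
    and \<Phi>_even: "\<forall>u\<in>M. \<Phi> (- u) = \<Phi> u"
    and M_invariant: "\<forall>g\<in>carrier G. \<forall>u\<in>M. act g u \<in> M"
    and \<Phi>_invariant: "\<forall>g\<in>carrier G. \<forall>u\<in>M. \<Phi> (act g u) = \<Phi> u"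
    and G0_normal: "G0 \<lhd> G"
    and G0_closed: "closedin T G0"
    and M0_eq: "M0 = M \<inter> fixed_space act G0"
    and M0_submanifold: "C11_submanifold (fixed_space act G0) M0"
    and G_star: "cond_G_star G act"
    and c_range: "cstar \<noteq> -\<infinity>" "cinf \<noteq> -\<infinity>" "cstar < cinf"
    and i: "\<forall>c :: real. ereal c < cinf \<longrightarrow>
              complete_wrt (path_dist ip M0) {u\<in>M0. cstar \<le> ereal (\<Phi> u) \<and> \<Phi> u \<le> c}"
    and ii: "((\<lambda>c. genus (sublevel M0 \<Phi> c)) \<longlongrightarrow> enat kstar) (at_right cstar)"
    and iii: "((\<lambda>c. genus (sublevel M0 \<Phi> c)) \<longlongrightarrow> \<infinity>) (at_left cinf)"
    and iv: "\<forall>c :: real. cstar < ereal c \<and> ereal c < cinf \<longrightarrow>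
              NCG G act ip M0 \<Phi> c \<and>
              (\<forall>u\<in>critical_set M0 \<Phi> c. \<forall>g\<in>carrier G - G0. act g u \<noteq> - u)"
  shows "cstar < LS_value M0 \<Phi> (kstar + 1) \<and>
         (\<forall>l\<ge>1. LS_value M0 \<Phi> (kstar + l) \<le> LS_value M0 \<Phi> (kstar + l + 1)) \<and>
         (\<lambda>l. LS_value M0 \<Phi> (kstar + l)) \<longlonglongrightarrow> cinf \<and>
         (\<forall>l\<ge>1. critical_value M0 \<Phi> (LS_value M0 \<Phi> (kstar + l))) \<and>
         (\<exists>u :: nat \<Rightarrow> 'a.
            (\<forall>k. critical_point M0 \<Phi> (u k) \<and> critical_point M0 \<Phi> (- u k)) \<and>
            (\<lambda>k. ereal (\<Phi> (u k))) \<longlonglongrightarrow> cinf)"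
proof -
  have fixed: "act h u = u" if "h \<in> G0" "u \<in> M0" for h u
    using that M0_eq by (simp add: fixed_space_def)
  have ga: "group_action G UNIV act" and lin: "\<And>g. g \<in> carrier G \<Longrightarrow> linear (act g)"
    using action by (simp_all add: linear_group_action_def)
  have G0_sub: "h \<in> carrier G" if "h \<in> G0" for h
    using normal_imp_subgroup[OF G0_normal] subgroup.subset that by blast
  have mult: "act (g \<otimes>\<^bsub>G\<^esub> h) u = act g (act h u)" if "g \<in> carrier G" "h \<in> carrier G" for g h u
    using group_action.composition_rule[OF ga _ that, of u] by simp
  have G: "group G" using ga by (simp add: group_action_def group_hom_def)
  interpret equivariant ip "fixed_space act G0" M M0 \<Phi> G act
  proof (intro equivariant.intro ip_manifold.intro ip_family.intro ip_manifold_axioms.intro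
      equivariant_axioms.intro)
    show "0 \<notin> M0" "M0 \<subseteq> M" using M_nonzero M0_eq by auto
    fix u assume u: "u \<in> M0"
    then have uM: "u \<in> M" using M0_eq by simp
    show "- u \<in> M0"
    proof -
      have "- u \<in> M" using M_symmetric uM by blast
      moreover have "act h (- u) = - u" if "h \<in> G0" for h
        using lin[OF G0_sub[OF that]] fixed[OF that u] by (simp add: linear_neg)
      ultimately show ?thesis using M0_eq by (simp add: fixed_space_def)
    qed
    show "\<Phi> (- u) = \<Phi> u" using \<Phi>_even uM by blast
    fix g assume g: "g \<in> carrier G"
    show "\<Phi> (act g u) = \<Phi> u" using \<Phi>_invariant g uM by blast
    have "act h (act g u) = act g u" if h: "h \<in> G0" for h
    proof -
      \<comment> \<open>By normality the conjugate lies in \<open>G0\<close> and fixes u; hence h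
        fixes the image of u under g.\<close>
      let ?h = "inv\<^bsub>G\<^esub> g \<otimes>\<^bsub>G\<^esub> h \<otimes>\<^bsub>G\<^esub> g"
      have h': "?h \<in> G0" by (rule normal.inv_op_closed1[OF G0_normal g h])
      have "g \<otimes>\<^bsub>G\<^esub> ?h = h \<otimes>\<^bsub>G\<^esub> g"
        using g G0_sub[OF h] G group.inv_closed[OF G g]
        by (simp add: monoid.m_assoc[OF group.is_monoid, symmetric] monoid.m_closed[OF group.is_monoid]
            group.r_inv monoid.l_one[OF group.is_monoid])
      then have "act h (act g u) = act g (act ?h u)"
        using mult[OF G0_sub[OF h] g, of u] mult[OF g G0_sub[OF h'], of u] by simp
      then show ?thesis using fixed[OF h' u] by simp
    qed
    then show "act g u \<in> M0" using M_invariant g uM M0_eq by (simp add: fixed_space_def)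
  qed (use scalar_products M1 M2 \<Phi>_C11 M0_submanifold ga lin M3 G_star in auto)
  define \<gamma> where "\<gamma> c = genus {u \<in> M0. \<Phi> u \<le> c}" for c
  have sub_\<gamma>: "genus (sublevel M0 \<Phi> (ereal c)) = \<gamma> c" for c by (simp add: \<gamma>_def sublevel_def)
  have \<gamma>_mono: "\<gamma> b \<le> \<gamma> c" if "b \<le> c" for b c
    unfolding \<gamma>_def by (rule genus_mono) (use that in auto)
  have crossing: "\<exists>\<epsilon>>0. \<exists>m. (critical_set M0 \<Phi> c = {} \<longrightarrow> m = 0) \<and>
      (\<forall>n. \<gamma> (c - \<epsilon>) \<le> enat n \<longrightarrow> \<gamma> (c + \<epsilon>) \<le> enat (n + m))"
    if c: "cstar < ereal c" "ereal c < cinf" for c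
  proof -
    interpret critical_level ip "fixed_space act G0" M M0 \<Phi> G act c
    proof
      show "NCG G act ip M0 \<Phi> c" using iv c by blast
      fix u g assume u: "u \<in> critical_set M0 \<Phi> c" and g: "g \<in> carrier G"
      have uM: "u \<in> M0" using u by (simp add: critical_set_def critical_point_def)
      show "act g u \<noteq> - u"
      proof (cases "g \<in> G0")
        \<comment> \<open>Hypothesis (iv) speaks only of elements outside \<open>G0\<close>. An
          element of \<open>G0\<close> fixes u, and u differs from -u because it is nonzero.\<close>
        case True
        have "2 *\<^sub>R u \<noteq> 0" using ne0[OF uM] by simp
        then have "u \<noteq> - u" by (metis add.right_inverse scaleR_2)
        then show ?thesis using fixed[OF True uM] by simp
      next
        case False
        then show ?thesis using iv c u g by blast
      qed
    qed
    \<comment> \<open>Finite levels on both sides of c, since the ends of the range may be infinite;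
      they give a slab on which completeness is assumed.\<close>
    obtain a where a: "cstar < ereal a" "ereal a < ereal c" using ereal_dense2[OF c(1)] by blast
    obtain b where b: "ereal c < ereal b" "ereal b < cinf" using ereal_dense2[OF c(2)] by blast
    define e where "e = min (c - a) (b - c)"
    let ?S = "{u \<in> M0. cstar \<le> ereal (\<Phi> u) \<and> \<Phi> u \<le> b}"
    have "complete_wrt (path_dist ip M0) ?S" using i b(2) by blast
    moreover have "e > 0" using a b by (simp add: e_def)
    moreover have "u \<in> ?S" if "u \<in> M0" "c - e \<le> \<Phi> u" "\<Phi> u \<le> c + e" for u
    proof -
      have "a \<le> \<Phi> u" "\<Phi> u \<le> b" using that by (auto simp: e_def)
      then show ?thesis using that(1) a(1) by (auto intro: order_trans[of cstar "ereal a"] less_imp_le)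
    qed
    ultimately show ?thesis
      using genus_bound_crossing_level[of e ?S] unfolding \<gamma>_def genus_le_iff by blast
  qed
  let ?LS = "LS_value M0 \<Phi>"
  have LS: "?LS k = Inf {ereal c | c. enat k \<le> \<gamma> c}" for k by (simp add: LS_value_def sub_\<gamma>)
  have LS_le: "?LS k \<le> ereal c" if "enat k \<le> \<gamma> c" for k c
    unfolding LS by (rule Inf_lower) (use that in blast)
  have LS_ge: "ereal c \<le> ?LS k" if "\<not> enat k \<le> \<gamma> c" for k c
    unfolding LS
  proof (rule Inf_greatest)
    fix x assume "x \<in> {ereal c | c. enat k \<le> \<gamma> c}"
    then obtain b where b: "x = ereal b" "enat k \<le> \<gamma> b" by blast
    then have "c \<le> b" using \<gamma>_mono[of b c] that order_trans by (metis linear)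
    then show "ereal c \<le> x" using b by simp
  qed
  have LS_mono: "?LS k \<le> ?LS k'" if "k \<le> k'" for k k'
    unfolding LS
  proof (rule Inf_superset_mono)
    have "enat k \<le> enat k'" using that by simp
    then show "{ereal c | c. enat k' \<le> \<gamma> c} \<subseteq> {ereal c | c. enat k \<le> \<gamma> c}" using order_trans by blast
  qed
  \<comment> \<open>The genus is discrete, so convergence to \<open>kstar\<close> gives a finite
    level strictly above \<open>cstar\<close> with genus below \<open>kstar + 1\<close>. This makes
    the inequality for the first value strict.\<close>
  obtain c0 where c0: "cstar < ereal c0" "\<gamma> c0 < enat (kstar + 1)"
  proof -
    have "eventually (\<lambda>c. genus (sublevel M0 \<Phi> c) < enat (kstar + 1)) (at_right cstar)"
      by (rule order_tendstoD(2)[OF ii]) simp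
    then obtain b where b: "cstar < b" "\<And>y. cstar < y \<Longrightarrow> y < b \<Longrightarrow> genus (sublevel M0 \<Phi> y) < enat (kstar + 1)"
      unfolding eventually_at_right[OF c_range(3)] by blast
    obtain c where "cstar < ereal c" "ereal c < b" using ereal_dense2[OF b(1)] by blast
    then show thesis using that b(2)[of "ereal c"] by (simp add: sub_\<gamma>)
  qed
  have LS_less: "?LS k < cinf" for k
  proof -
    have "eventually (\<lambda>c. enat k < genus (sublevel M0 \<Phi> c)) (at_left cinf)"
      by (rule order_tendstoD(1)[OF iii]) simp
    then obtain b where b: "b < cinf" "\<And>y. b < y \<Longrightarrow> y < cinf \<Longrightarrow> enat k < genus (sublevel M0 \<Phi> y)"
      unfolding eventually_at_left[OF c_range(3)] by blast
    obtain c where c: "b < ereal c" "ereal c < cinf" using ereal_dense2[OF b(1)] by blast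
    then have "enat k \<le> \<gamma> c" using b(2)[of "ereal c"] by (simp add: sub_\<gamma>)
    then show ?thesis using LS_le c(2) by (meson le_less_trans)
  qed
  have LS_greater: "cstar < ?LS (kstar + l)" if "l \<ge> 1" for l
  proof -
    have "enat (kstar + 1) \<le> enat (kstar + l)" using that by simp
    then have "ereal c0 \<le> ?LS (kstar + l)" using LS_ge c0(2) by (meson leD order_trans)
    then show ?thesis using c0(1) by (rule less_le_trans[rotated])
  qed
  have finite: "\<gamma> c \<noteq> \<infinity>" if c: "ereal c < cinf" for c
  proof
    assume inf: "\<gamma> c = \<infinity>"
    \<comment> \<open>The infimum s of the levels with infinite genus lies in the open range because
      of \<open>c0\<close>. The genus is finite just below s, so crossing s leaves it finite just
      above, against the choice of s.\<close>
    define A where "A = {a. \<gamma> a = \<infinity>}"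
    have A_ge: "c0 \<le> a" if "a \<in> A" for a
    proof (rule ccontr)
      assume "\<not> c0 \<le> a"
      then have "\<gamma> a \<le> \<gamma> c0" by (intro \<gamma>_mono) simp
      then show False using c0(2) that by (simp add: A_def)
    qed
    have cA: "c \<in> A" using inf by (simp add: A_def)
    have bdd: "bdd_below A" using A_ge by (rule bdd_belowI)
    define s where "s = Inf A"
    have s: "c0 \<le> s" "s \<le> c"
      unfolding s_def using cA A_ge bdd by (auto intro: cInf_greatest cInf_lower)
    have "cstar < ereal s" using c0(1) s(1) by (meson ereal_less_eq(3) less_le_trans)
    moreover have "ereal s < cinf" using c s(2) by (meson ereal_less_eq(3) le_less_trans)
    ultimately obtain \<epsilon> m where \<epsilon>: "\<epsilon> > 0"
      "\<And>n. \<gamma> (s - \<epsilon>) \<le> enat n \<Longrightarrow> \<gamma> (s + \<epsilon>) \<le> enat (n + m)"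
      using crossing[of s] by blast
    have "s - \<epsilon> \<notin> A" using cInf_lower[OF _ bdd, of "s - \<epsilon>"] \<epsilon>(1) by (auto simp: s_def)
    then obtain n where "\<gamma> (s - \<epsilon>) = enat n" by (auto simp: A_def)
    then have le: "\<gamma> (s + \<epsilon>) \<le> enat (n + m)" using \<epsilon>(2) by simp
    obtain a where "a \<in> A" "a < s + \<epsilon>"
      using cInf_less_iff[of A "s + \<epsilon>"] cA bdd \<epsilon>(1) by (auto simp: s_def)
    then have "\<infinity> \<le> \<gamma> (s + \<epsilon>)" using \<gamma>_mono[of a "s + \<epsilon>"] by (simp add: A_def)
    then show False using le by simp
  qed
  have lim: "(\<lambda>l. ?LS (kstar + l)) \<longlonglongrightarrow> cinf"
  proof (rule order_tendstoI)
    fix y assume "y < cinf"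
    then obtain c where c: "y < ereal c" "ereal c < cinf" using ereal_dense2 by blast
    obtain n where n: "\<gamma> c = enat n" using finite[OF c(2)] by auto
    show "eventually (\<lambda>l. y < ?LS (kstar + l)) sequentially"
      using eventually_gt_at_top[of n]
    proof eventually_elim
      case (elim l)
      then have "\<not> enat (kstar + l) \<le> \<gamma> c" by (simp add: n)
      then show ?case using LS_ge c(1) less_le_trans by blast
    qed
  next
    fix y assume "cinf < y"
    then show "eventually (\<lambda>l. ?LS (kstar + l) < y) sequentially"
      using LS_less less_trans by (auto intro!: always_eventually)
  qed
  have critical: "\<exists>u. critical_point M0 \<Phi> u \<and> ereal (\<Phi> u) = ?LS (kstar + l)" if l: "l \<ge> 1" for l
  proof -
    obtain r where r: "?LS (kstar + l) = ereal r"
      using LS_greater[OF l] LS_less[of "kstar + l"] by (cases "?LS (kstar + l)") auto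
    \<comment> \<open>Without critical points at level r the bound on the genus just below r
      persists just above r, although r is the infimum of the levels whose genus is at least
      \<open>kstar + l\<close>.\<close>
    have "critical_set M0 \<Phi> r \<noteq> {}"
    proof
      assume "critical_set M0 \<Phi> r = {}"
      moreover have "cstar < ereal r" "ereal r < cinf" using LS_greater[OF l] LS_less[of "kstar + l"] r by simp_all
      ultimately obtain \<epsilon> where \<epsilon>: "\<epsilon> > 0" "\<And>n. \<gamma> (r - \<epsilon>) \<le> enat n \<Longrightarrow> \<gamma> (r + \<epsilon>) \<le> enat n"
        using crossing[of r] by (metis add.right_neutral)
      have "\<not> enat (kstar + l) \<le> \<gamma> (r - \<epsilon>)"
      proof
        assume "enat (kstar + l) \<le> \<gamma> (r - \<epsilon>)"
        from LS_le[OF this] show False using r \<epsilon>(1) by simp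
      qed
      then obtain n where n: "\<gamma> (r - \<epsilon>) = enat n" "n < kstar + l" by (cases "\<gamma> (r - \<epsilon>)") auto
      then have "\<gamma> (r + \<epsilon>) \<le> enat n" using \<epsilon>(2) by simp
      then have "\<not> enat (kstar + l) \<le> \<gamma> (r + \<epsilon>)" using n(2) by (metis enat_ord_simps(1) leD order_trans)
      from LS_ge[OF this] show False using r \<epsilon>(1) by simp
    qed
    then show ?thesis by (auto simp: r critical_set_def)
  qed
  have "\<forall>k. \<exists>u. critical_point M0 \<Phi> u \<and> ereal (\<Phi> u) = ?LS (kstar + Suc k)"
  proof
    show "\<exists>u. critical_point M0 \<Phi> u \<and> ereal (\<Phi> u) = ?LS (kstar + Suc k)" for k
      by (rule critical) simp
  qed
  then obtain u where u: "\<And>k. critical_point M0 \<Phi> (u k)" "\<And>k. ereal (\<Phi> (u k)) = ?LS (kstar + Suc k)"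
    using choice[of "\<lambda>k u. critical_point M0 \<Phi> u \<and> ereal (\<Phi> u) = ?LS (kstar + Suc k)"] by blast
  have "(\<lambda>k. ereal (\<Phi> (u k))) \<longlonglongrightarrow> cinf"
    using LIMSEQ_Suc[OF lim] by (simp only: u(2))
  then have "\<exists>u :: nat \<Rightarrow> 'a. (\<forall>k. critical_point M0 \<Phi> (u k) \<and> critical_point M0 \<Phi> (- u k)) \<and>
      (\<lambda>k. ereal (\<Phi> (u k))) \<longlonglongrightarrow> cinf"
    using u(1) critical_point_minus by blast
  moreover have "\<forall>l\<ge>1. ?LS (kstar + l) \<le> ?LS (kstar + l + 1)" by (intro allI impI LS_mono) simp
  moreover have "\<forall>l\<ge>1. critical_value M0 \<Phi> (?LS (kstar + l))"
    using critical by (simp add: critical_value_def)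
  ultimately show ?thesis using LS_greater[of 1] lim by simp
qed


end
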